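(* Let $E$ and $F$ be finite-dimensional vector spaces over a field, and let $A\subseteq E$ be a linear subspace. Write $e:=\dim E$, $f:=\dim F$ and $a:=\dim A$. Let $H$ be the vector space of linear maps $h:E\to\operatorname{Hom}(A,F)$ such that the bilinear map $A\times A\to F$, $(v,w)\mapsto h(v)(w)$, is symmetric. Let $i$ and $p$ be nonnegative integers. Let $\Delta^{i,p}\subseteq H$ be the locally closed subscheme parametrizing linear maps $h\in H$ such that (1) $h$ has rank $\min(e,af)-i$, and (2) $\dim(\ker(h)\cap A)=p$. If $\Delta^{i,p}$ is nonempty, then $\Delta^{i,p}$ is smooth of pure codimension $$p(n-a+p)+f\cdot\left[\tfrac12(-p^2+p)+(e-n)a\right]-n(e-n)$$ in $H$, where $n:=\min(e,af)-i$.
   Context: $H$ is regarded as an affine space over the base field. The scheme structure on $\Delta^{i,p}$ is the determinantal one: with $\mathbf h$ the tautological (universal) linear map on $H$, $\Delta^{i,p}$ is the locally closed subscheme where all minors of $\mathbf h$ of size $\min(e,af)-i+1$ and all minors of the restriction $\mathbf h|_A$ of size $a-p+1$ vanish, intersected with the open subset where some minor of $\mathbf h$ of size $\min(e,af)-i$ and some minor of $\mathbf h|_A$ of size $a-p$ are nonzero. *)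

theory Defs
  imports
    "HOL-Algebra.Ring"
    "HOL-Algebra.Ideal"
    "HOL-Library.Poly_Mapping"
    "HOL-Library.Function_Algebras"
    "HOL-Library.Extended_Nat"
    "Jordan_Normal_Form.Determinant"
begin

section \<open>The vector space of symmetric maps\<close>

definition fun_scale :: "('k \<Rightarrow> 'b \<Rightarrow> 'b) \<Rightarrow> 'k \<Rightarrow> ('a \<Rightarrow> 'b) \<Rightarrow> 'a \<Rightarrow> 'b" where
  "fun_scale s c g = (\<lambda>x. s c (g x))"

definition is_basis ::
  "('k::field \<Rightarrow> 'b::ab_group_add \<Rightarrow> 'b) \<Rightarrow> 'b set \<Rightarrow> 'b set \<Rightarrow> bool" where
  "is_basis s W B \<longleftrightarrow> B \<subseteq> W \<and> \<not> module.dependent s B \<and> module.span s B = W"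

text \<open>Hom(A,F): a linear map on the subspace A is represented by its extension by 0 to
  the (non-linear) total function on E.\<close>
definition hom_from ::
  "('k \<Rightarrow> 'e::ab_group_add \<Rightarrow> 'e) \<Rightarrow> ('k \<Rightarrow> 'f::ab_group_add \<Rightarrow> 'f) \<Rightarrow> 'e set \<Rightarrow> ('e \<Rightarrow> 'f) set" where
  "hom_from sE sF A = {g.
     (\<forall>v\<in>A. \<forall>w\<in>A. g (v + w) = g v + g w) \<and>
     (\<forall>c. \<forall>v\<in>A. g (sE c v) = sF c (g v)) \<and>
     (\<forall>v. v \<notin> A \<longrightarrow> g v = 0)}"

definition sym_maps ::
  "('k::field \<Rightarrow> 'e::ab_group_add \<Rightarrow> 'e) \<Rightarrow> ('k \<Rightarrow> 'f::ab_group_add \<Rightarrow> 'f) \<Rightarrow> 'e set \<Rightarrow>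
   ('e \<Rightarrow> 'e \<Rightarrow> 'f) set" where
  "sym_maps sE sF A = {h.
     Vector_Spaces.linear sE (fun_scale sF) h \<and>
     range h \<subseteq> hom_from sE sF A \<and>
     (\<forall>v\<in>A. \<forall>w\<in>A. h v w = h w v)}"

section \<open>Affine space and its locally closed subschemes\<close>

type_synonym ('v, 'k) mpol = "('v \<Rightarrow>\<^sub>0 nat) \<Rightarrow>\<^sub>0 'k"

text \<open>The polynomial ring k[V] with variables the elements of the set V.  A point of affine
  space Spec k[V] is a prime ideal of this ring.\<close>
definition mpol_ring :: "'v set \<Rightarrow> ('v, 'k::field) mpol ring" where
  "mpol_ring V = \<lparr>carrier = {q. \<forall>m \<in> Poly_Mapping.keys q. Poly_Mapping.keys m \<subseteq> V},
     monoid.mult = (*), one = 1, ring.zero = 0, add = (+)\<rparr>"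

definition mpartial :: "'v \<Rightarrow> ('v, 'k::field) mpol \<Rightarrow> ('v, 'k) mpol" where
  "mpartial v q = (\<Sum>m \<in> Poly_Mapping.keys q.
     Poly_Mapping.single (m - Poly_Mapping.single v 1)
       (of_nat (Poly_Mapping.lookup m v) * Poly_Mapping.lookup q m))"

text \<open>A locally closed subscheme of Spec R is given by a pair (I, U) of an ideal I and a Zariski open
  set U of primes: it is the intersection of the closed subscheme Spec R/I with the open subscheme U.\<close>
type_synonym 'r lc_subscheme = "'r set \<times> 'r set set"

definition points :: "'r lc_subscheme \<Rightarrow> 'r set set" where
  "points X = {P \<in> snd X. fst X \<subseteq> P}"

text \<open>Smoothness over k of a locally closed subscheme of Spec k[V] at the point P:
  on some open neighbourhood D(s) of P the ideal is generated by finitely many elements gs whose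
  differentials at P are linearly independent over the residue field Frac(k[V]/P).  Linear
  independence is stated with denominators cleared, that is, over the domain k[V]/P.\<close>
definition smooth_at :: "'v set \<Rightarrow> ('v, 'k::field) mpol lc_subscheme \<Rightarrow> ('v, 'k) mpol set \<Rightarrow> bool" where
  "smooth_at V X P \<longleftrightarrow> (\<exists>gs. set gs \<subseteq> fst X \<and>
     (\<exists>s \<in> carrier (mpol_ring V) - P. \<forall>q \<in> fst X. s * q \<in> Idl\<^bsub>mpol_ring V\<^esub> (set gs)) \<and>
     (\<forall>c. (\<forall>j < length gs. c j \<in> carrier (mpol_ring V)) \<longrightarrow>
          (\<forall>v\<in>V. (\<Sum>j < length gs. c j * mpartial v (gs ! j)) \<in> P) \<longrightarrow>
          (\<forall>j < length gs. c j \<in> P)))"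

definition smooth_scheme :: "'v set \<Rightarrow> ('v, 'k::field) mpol lc_subscheme \<Rightarrow> bool" where
  "smooth_scheme V X \<longleftrightarrow> (\<forall>P \<in> points X. smooth_at V X P)"

text \<open>The codimension in Spec R of the irreducible closed subset V(P), for P prime.\<close>
definition prime_height :: "('r, 'm) ring_scheme \<Rightarrow> 'r set \<Rightarrow> enat" where
  "prime_height R P = Sup {enat m | m.
     \<exists>Q. (\<forall>j\<le>m. primeideal (Q j) R) \<and> (\<forall>j<m. Q j \<subset> Q (Suc j)) \<and> Q m = P}"

text \<open>The irreducible components of X are the closures of its generic points.\<close>
definition generic_points :: "'r lc_subscheme \<Rightarrow> 'r set set" where
  "generic_points X = {P \<in> points X. \<forall>Q \<in> points X. Q \<subseteq> P \<longrightarrow> Q = P}"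

definition pure_codimension :: "('r, 'm) ring_scheme \<Rightarrow> 'r lc_subscheme \<Rightarrow> nat \<Rightarrow> bool" where
  "pure_codimension R X c \<longleftrightarrow> (\<forall>P \<in> generic_points X. prime_height R P = enat c)"

section \<open>The determinantal subscheme\<close>

text \<open>The minors of size r (up to sign) of the matrix M with rows indexed by Rs and columns by Cs.
  For r = 0 this is {1}; for r < 0 there are none.\<close>
definition minors :: "('r \<Rightarrow> 'c \<Rightarrow> 'a::comm_ring_1) \<Rightarrow> 'r set \<Rightarrow> 'c set \<Rightarrow> int \<Rightarrow> 'a set" where
  "minors M Rs Cs r = {det (mat m m (\<lambda>(j, l). M (rs ! j) (cs ! l))) | m rs cs.
     int m = r \<and>
     length rs = m \<and> distinct rs \<and> set rs \<subseteq> Rs \<and>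
     length cs = m \<and> distinct cs \<and> set cs \<subseteq> Cs}"

text \<open>A basis BH of H provides linear coordinates, one variable for each b in BH, and the
  tautological map is the sum of the b, each multiplied by its variable.  This is its matrix with
  respect to bases of E, A and F: the row (x, y) in BA \<times> BF is the coefficient of y in the value at
  x, i.e. the coordinate with respect to the basis of Hom(A,F) induced by BA and BF.\<close>
definition taut ::
  "('k::field \<Rightarrow> 'f::ab_group_add \<Rightarrow> 'f) \<Rightarrow> 'f set \<Rightarrow> ('e \<Rightarrow> 'e \<Rightarrow> 'f) set \<Rightarrow>
   'e \<times> 'f \<Rightarrow> 'e \<Rightarrow> ('e \<Rightarrow> 'e \<Rightarrow> 'f, 'k) mpol" where
  "taut sF BF BH = (\<lambda>(x, y) u. \<Sum>b\<in>BH.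
     Poly_Mapping.single (Poly_Mapping.single b 1) (module.representation sF BF (b u x) y))"

definition Delta ::
  "('k::field \<Rightarrow> 'e::ab_group_add \<Rightarrow> 'e) \<Rightarrow> ('k \<Rightarrow> 'f::ab_group_add \<Rightarrow> 'f) \<Rightarrow> 'e set \<Rightarrow>
   'e set \<Rightarrow> 'e set \<Rightarrow> 'f set \<Rightarrow> ('e \<Rightarrow> 'e \<Rightarrow> 'f) set \<Rightarrow> nat \<Rightarrow> nat \<Rightarrow>
   ('e \<Rightarrow> 'e \<Rightarrow> 'f, 'k) mpol lc_subscheme" where
  "Delta sE sF A BE BA BF BH i p = (let
     R = mpol_ring BH;
     e = vector_space.dim sE UNIV;
     f = vector_space.dim sF UNIV;
     a = vector_space.dim sE A;
     n = int (min e (a * f)) - int i;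
     d = int a - int p;
     minorsE = minors (taut sF BF BH) (BA \<times> BF) BE;
     minorsA = minors (taut sF BF BH) (BA \<times> BF) BA
   in (Idl\<^bsub>R\<^esub> (minorsE (n + 1) \<union> minorsA (d + 1)),
       {P. primeideal P R \<and> (\<exists>g \<in> minorsE n. g \<notin> P) \<and> (\<exists>g \<in> minorsA d. g \<notin> P)}))"

end

theory Submission
  imports Defs "HOL-Computational_Algebra.Fraction_Field"
begin

text \<open>
  Extend a basis \<open>BA\<close> of \<open>A\<close> by a set \<open>C\<close> to a basis of \<open>E\<close> and write \<open>h\<close> as a matrix with a row for each
  \<open>(x, y)\<close> in \<open>BA \<times> BF\<close> and a column for each \<open>u\<close> in \<open>BA \<union> C\<close>.  By symmetry the entry in row \<open>(x, y)\<close> and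
  column \<open>u\<close> depends on \<open>({x, u}, y)\<close> only, and these entries are coordinates on \<open>H\<close>.

  Let \<open>P\<close> be a point of the scheme and \<open>d = a - p\<close> the rank of \<open>h\<close> on \<open>A\<close> at \<open>P\<close>.  Symmetry provides a
  nonvanishing minor of size \<open>d\<close> with columns \<open>L \<subseteq> BA\<close> and rows \<open>I \<subseteq> L \<times> BF\<close> (\<open>symmetric_pivot\<close>), and this pivot
  extends to a nonvanishing minor of size \<open>n\<close> by columns from \<open>C\<close> alone (\<open>pivot_extension\<close>).  Near \<open>P\<close> the
  condition on the rank of \<open>h\<close> on \<open>A\<close> says that the \<open>BF\<close>-tuple of symmetric forms is the pullback of its
  restriction to \<open>L\<close> along the projection with kernel \<open>ker h \<inter> A\<close>.  Cramer's rule turns this into one equation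
  for each coordinate \<open>({x, k}, y)\<close> with \<open>k \<in> BA - L\<close> and \<open>(x, y) \<notin> I\<close>, and it turns the condition on the rank
  of \<open>h\<close> into one equation for each entry of a remaining column of \<open>C\<close> in a row outside the pivot.  Each
  equation has the form \<open>den * z = num\<close> with \<open>den\<close> nonzero at \<open>P\<close>, where \<open>den\<close> and \<open>num\<close> involve only coordinates
  that are free or solved earlier.  Together they cut out the scheme near \<open>P\<close>
  (\<open>relations_in_saturated\<close>, \<open>relations_imp_rank\<close>), so the scheme is locally a graph over an affine space.

  Smoothness follows because the Jacobian matrix with respect to the solved coordinates is triangular with
  the denominators on the diagonal (\<open>differentials_independent\<close>).  The codimension is the number of solved
  coordinates, \<open>f(pd + p(p + 1)/2) - pd + (e - a - n + d)(af - n)\<close>, which equals the formula in the theorem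
  (\<open>card_solvedA\<close>, \<open>card_solvedC\<close>, \<open>codimension_formula\<close>).

  It remains to see that \<open>c\<close> solved coordinates give height \<open>c\<close>.  Solving for one coordinate at a time
  produces points with values in a field of rational functions whose vanishing ideals form a chain of
  \<open>c + 1\<close> primes, and the last of them lies in \<open>P\<close> and belongs to the scheme, so it is \<open>P\<close> when \<open>P\<close> is a generic
  point (\<open>generic_chain\<close>, \<open>local_structure\<close>).  No chain is longer, by counting: if \<open>D\<close> variables are
  independent modulo the top of a chain of \<open>m + 1\<close> primes, then among the polynomials with exponents bounded by a
  multiple of \<open>u\<close> there are \<open>u ^ (m + D)\<close> linearly independent ones, and so \<open>m + D\<close> is at most the number of all
  variables (\<open>prime_chain_bound\<close>).

  Local rings at \<open>P\<close> are avoided by working with saturations: \<open>saturation P I\<close> is the contraction of the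
  extension of the ideal \<open>I\<close> to the local ring at \<open>P\<close>.
\<close>

section \<open>Polynomial rings\<close>

alias keys = Poly_Mapping.keys
alias lookup = Poly_Mapping.lookup
alias single = Poly_Mapping.single

definition mconst :: "'k::field \<Rightarrow> ('v, 'k) mpol" where
  "mconst c = single 0 c"

definition mvar :: "'v \<Rightarrow> ('v, 'k::field) mpol" where
  "mvar v = single (single v 1) 1"

text \<open>The carrier is a subset of a fixed type, so all polynomial rings share the operations of that type.\<close>
abbreviation polys :: "'v set \<Rightarrow> ('v, 'k::field) mpol set" where
  "polys V \<equiv> carrier (mpol_ring V)"

lemma polys_iff: "q \<in> polys V \<longleftrightarrow> (\<forall>m \<in> keys q. keys m \<subseteq> V)"
  by (simp add: mpol_ring_def)

lemma mpol_ring_ops [simp]: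
  "monoid.mult (mpol_ring V) = (*)" "monoid.one (mpol_ring V) = 1"
  "ring.zero (mpol_ring V) = 0" "ring.add (mpol_ring V) = (+)"
  by (simp_all add: mpol_ring_def)

lemma polys_single: "keys m \<subseteq> V \<Longrightarrow> single m c \<in> polys V"
  by (simp add: polys_iff)

lemma polys_0 [simp, intro]: "0 \<in> polys V"
  by (simp add: polys_iff)

lemma polys_1 [simp, intro]: "1 \<in> polys V"
  by (simp add: polys_iff)

lemma polys_const [simp, intro]: "mconst c \<in> polys V"
  by (simp add: mconst_def polys_single)

lemma polys_var [intro]: "v \<in> V \<Longrightarrow> mvar v \<in> polys V"
  by (simp add: mvar_def polys_single)

lemma polys_add [intro]: "a \<in> polys V \<Longrightarrow> b \<in> polys V \<Longrightarrow> a + b \<in> polys V"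
  unfolding polys_iff using Poly_Mapping.keys_add[of a b] by blast

lemma polys_uminus [intro]: "a \<in> polys V \<Longrightarrow> - a \<in> polys V"
  by (simp add: polys_iff in_keys_iff)

lemma polys_diff [intro]: "a \<in> polys V \<Longrightarrow> b \<in> polys V \<Longrightarrow> a - b \<in> polys V"
  using polys_add[of a V "- b"] polys_uminus by fastforce

lemma polys_mult [intro]:
  assumes "a \<in> polys V" "b \<in> polys V" shows "a * b \<in> polys V"
  unfolding polys_iff
proof
  fix m assume "m \<in> keys (a * b)"
  with keys_mult[of a b] obtain m1 m2 where m: "m = m1 + m2" "m1 \<in> keys a" "m2 \<in> keys b"
    by blast
  then show "keys m \<subseteq> V"
    using assms Poly_Mapping.keys_add[of m1 m2] unfolding polys_iff by blast
qed

lemma polys_power [intro]: "a \<in> polys V \<Longrightarrow> a ^ n \<in> polys V"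
  by (induction n) auto

lemma polys_sum [intro]: "(\<And>i. i \<in> I \<Longrightarrow> f i \<in> polys V) \<Longrightarrow> (\<Sum>i\<in>I. f i) \<in> polys V"
  by (induction I rule: infinite_finite_induct) auto

lemma polys_prod [intro]: "(\<And>i. i \<in> I \<Longrightarrow> f i \<in> polys V) \<Longrightarrow> (\<Prod>i\<in>I. f i) \<in> polys V"
  by (induction I rule: infinite_finite_induct) auto

lemma polys_mono: "V \<subseteq> W \<Longrightarrow> q \<in> polys V \<Longrightarrow> q \<in> polys W"
  unfolding polys_iff by blast

lemma cring_mpol_ring: "cring (mpol_ring V)"
proof (rule cringI)
  show "abelian_group (mpol_ring V :: ('a, 'b) mpol ring)"
  proof (rule abelian_groupI)
    fix x :: "('a, 'b) mpol" assume "x \<in> polys V"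
    then show "\<exists>y\<in>polys V. y \<oplus>\<^bsub>mpol_ring V\<^esub> x = \<zero>\<^bsub>mpol_ring V\<^esub>"
      by (intro bexI[of _ "- x"]) auto
  qed (auto simp: add.assoc add.commute)
  show "comm_monoid (mpol_ring V :: ('a, 'b) mpol ring)"
    by (rule comm_monoidI) (auto simp: mult.assoc mult.commute)
qed (auto simp: distrib_right)

lemma mpol_sum_single:
  "q = (\<Sum>m\<in>keys q. single m (lookup q m))"
proof (rule poly_mapping_eqI)
  fix k
  have "(\<Sum>m\<in>keys q. lookup (single m (lookup q m)) k)
      = (\<Sum>m\<in>keys q. if k = m then lookup q m else 0)"
    by (intro sum.cong) (auto simp: lookup_single)
  then show "lookup q k = lookup
      (\<Sum>m\<in>keys q. single m (lookup q m)) k"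
    by (simp add: lookup_sum in_keys_iff)
qed

definition mono_eval :: "('v \<Rightarrow> 'r::comm_ring_1) \<Rightarrow> ('v \<Rightarrow>\<^sub>0 nat) \<Rightarrow> 'r" where
  "mono_eval \<eta> m = (\<Prod>v\<in>keys m. \<eta> v ^ lookup m v)"

lemma mono_eval_superset:
  assumes "finite S" "keys m \<subseteq> S"
  shows "mono_eval \<eta> m = (\<Prod>v\<in>S. \<eta> v ^ lookup m v)"
  unfolding mono_eval_def using assms
  by (intro prod.mono_neutral_left) (auto simp: in_keys_iff)

lemma mono_eval_0 [simp]: "mono_eval \<eta> 0 = 1"
  by (simp add: mono_eval_def)

lemma mono_eval_add: "mono_eval \<eta> (m + m') = mono_eval \<eta> m * mono_eval \<eta> m'"
proof -
  let ?S = "keys m \<union> keys m'"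
  have "keys (m + m') \<subseteq> ?S" by (rule Poly_Mapping.keys_add)
  then show ?thesis
    by (simp add: mono_eval_superset[of ?S] lookup_add power_add prod.distrib)
qed

lemma mono_eval_var [simp]: "mono_eval \<eta> (single v (Suc 0)) = \<eta> v"
  by (simp add: mono_eval_def)

lemma single_conv_mono_eval:
  "single m c = mconst c * mono_eval mvar m"
proof -
  have pow: "(mvar v :: ('a, 'b) mpol) ^ n = single (single v n) 1" for v n
    by (induction n) (auto simp: mvar_def mult_single simp flip: single_add)
  have pr: "finite S \<Longrightarrow> (\<Prod>v\<in>S. (mvar v :: ('a, 'b) mpol) ^ f v)
    = single (\<Sum>v\<in>S. single v (f v)) 1" for S f
    by (induction S rule: finite_induct) (auto simp: pow mult_single)
  have "m = (\<Sum>v\<in>keys m. single v (lookup m v))"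
    by (rule mpol_sum_single)
  then have "mono_eval mvar m = (single m 1 :: ('a, 'b) mpol)"
    unfolding mono_eval_def by (simp add: pr)
  then show ?thesis by (simp add: mconst_def mult_single)
qed

lemma mconst_add: "mconst (a + b) = mconst a + mconst b"
  by (simp add: mconst_def single_add)

lemma mconst_mult: "mconst (a * b) = mconst a * mconst b"
  by (simp add: mconst_def mult_single)

lemma mconst_0 [simp]: "mconst 0 = 0" and mconst_1 [simp]: "mconst 1 = 1"
  by (simp_all add: mconst_def)

lemma mconst_hom: "comm_ring_hom mconst"
  by standard (auto simp: mconst_add mconst_mult)

lemma mconst_sum: "mconst (\<Sum>i\<in>I. f i) = (\<Sum>i\<in>I. mconst (f i))"
  by (induction I rule: infinite_finite_induct) (auto simp: mconst_add)

text \<open>Every polynomial is a sum of monomials, and these are products of constants and variables.\<close>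
lemma polys_induct [consumes 1, case_names const var add mult]:
  assumes q: "q \<in> polys V"
    and const: "\<And>c. Q (mconst c)"
    and var: "\<And>v. v \<in> V \<Longrightarrow> Q (mvar v)"
    and add: "\<And>a b. a \<in> polys V \<Longrightarrow> b \<in> polys V \<Longrightarrow> Q a \<Longrightarrow> Q b \<Longrightarrow> Q (a + b)"
    and mult: "\<And>a b. a \<in> polys V \<Longrightarrow> b \<in> polys V \<Longrightarrow> Q a \<Longrightarrow> Q b \<Longrightarrow> Q (a * b)"
  shows "Q q"
proof -
  have Q0: "Q 0" and Q1: "Q 1" using const[of 0] const[of 1] by simp_all
  have pow: "Q (mvar v ^ n)" if "v \<in> V" for v n
    by (induction n) (use that Q1 mult var in \<open>auto intro!: mult\<close>)
  have pr: "finite S \<Longrightarrow> S \<subseteq> V \<Longrightarrow> Q (\<Prod>v\<in>S. mvar v ^ f v)" for S and f :: "'a \<Rightarrow> nat"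
    by (induction S rule: finite_induct) (auto simp: Q1 intro!: mult pow)
  have si: "Q (single m c)" if "keys m \<subseteq> V" for m c
    unfolding single_conv_mono_eval mono_eval_def using that
    by (intro mult const pr) auto
  have su: "finite S \<Longrightarrow> (\<And>m. m \<in> S \<Longrightarrow> keys m \<subseteq> V) \<Longrightarrow>
    Q (\<Sum>m\<in>S. single m (f m))" for S f
    by (induction S rule: finite_induct) (auto simp: Q0 intro!: add si polys_single polys_sum)
  show ?thesis
    by (subst mpol_sum_single, rule su) (use q in \<open>auto simp: polys_iff\<close>)
qed

text \<open>The universal property of the polynomial ring: uniqueness.\<close>
lemma polys_hom_eq:
  assumes F: "comm_ring_hom F" and G: "comm_ring_hom G"
    and "\<And>c. F (mconst c) = G (mconst c)" "\<And>v. v \<in> V \<Longrightarrow> F (mvar v) = G (mvar v)"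
    and "q \<in> polys V"
  shows "F q = G q"
proof -
  interpret F: comm_ring_hom F by (rule F)
  interpret G: comm_ring_hom G by (rule G)
  show ?thesis using assms(5)
    by (induction rule: polys_induct) (auto simp: assms F.hom_add G.hom_add F.hom_mult G.hom_mult)
qed

text \<open>The homomorphism that extends \<open>\<kappa>\<close> and sends each variable \<open>v\<close> to \<open>\<eta> v\<close>.\<close>
definition meval :: "('k::field \<Rightarrow> 'r::comm_ring_1) \<Rightarrow> ('v \<Rightarrow> 'r) \<Rightarrow> ('v, 'k) mpol \<Rightarrow> 'r" where
  "meval \<kappa> \<eta> q = (\<Sum>m\<in>keys q. \<kappa> (lookup q m) * mono_eval \<eta> m)"

context
  fixes \<kappa> :: "'k::field \<Rightarrow> 'r::comm_ring_1"
  assumes \<kappa>: "comm_ring_hom \<kappa>"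
begin

interpretation \<kappa>: comm_ring_hom \<kappa> by (rule \<kappa>)

lemma meval_superset:
  assumes "finite S" "keys q \<subseteq> S"
  shows "meval \<kappa> \<eta> q = (\<Sum>m\<in>S. \<kappa> (lookup q m) * mono_eval \<eta> m)"
  unfolding meval_def using assms
  by (intro sum.mono_neutral_left) (auto simp: in_keys_iff)

lemma meval_add: "meval \<kappa> \<eta> (a + b) = meval \<kappa> \<eta> a + meval \<kappa> \<eta> b"
proof -
  let ?S = "keys a \<union> keys b"
  have "keys (a + b) \<subseteq> ?S" by (rule Poly_Mapping.keys_add)
  then show ?thesis
    by (simp add: meval_superset[of ?S] lookup_add \<kappa>.hom_add distrib_right sum.distrib)
qed

lemma meval_single: "meval \<kappa> \<eta> (single m c) = \<kappa> c * mono_eval \<eta> m"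
  by (simp add: meval_def)

lemma meval_sum: "meval \<kappa> \<eta> (\<Sum>i\<in>I. f i) = (\<Sum>i\<in>I. meval \<kappa> \<eta> (f i))"
  by (induction I rule: infinite_finite_induct) (auto simp: meval_add, simp_all add: meval_def)

lemma meval_const [simp]: "meval \<kappa> \<eta> (mconst c) = \<kappa> c"
  by (simp add: mconst_def meval_single)

lemma meval_var [simp]: "meval \<kappa> \<eta> (mvar v) = \<eta> v"
  by (simp add: mvar_def meval_single)

lemma meval_mult: "meval \<kappa> \<eta> (a * b) = meval \<kappa> \<eta> a * meval \<kappa> \<eta> b"
proof -
  let ?s = "\<lambda>q m. single m (lookup q m)"
  have "a * b = (\<Sum>m\<in>keys a. ?s a m) * (\<Sum>m\<in>keys b. ?s b m)"
    using mpol_sum_single[of a] mpol_sum_single[of b] by simp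
  also have "meval \<kappa> \<eta> \<dots> = (\<Sum>m\<in>keys a. \<Sum>m'\<in>keys b.
      meval \<kappa> \<eta> (?s a m) * meval \<kappa> \<eta> (?s b m'))"
    by (simp add: sum_product meval_sum mult_single meval_single \<kappa>.hom_mult mono_eval_add mult_ac)
  also have "\<dots> = meval \<kappa> \<eta> a * meval \<kappa> \<eta> b"
    unfolding meval_single by (simp add: meval_def sum_product)
  finally show ?thesis .
qed

lemma meval_hom: "comm_ring_hom (meval \<kappa> \<eta>)"
proof -
  have "meval \<kappa> \<eta> 0 = 0" "meval \<kappa> \<eta> 1 = 1"
    using meval_const[of \<eta> 0] meval_const[of \<eta> 1] by simp_all
  then show ?thesis by unfold_locales (auto simp: meval_add meval_mult)
qed

lemma meval_cong:
  assumes "q \<in> polys V" "\<And>v. v \<in> V \<Longrightarrow> \<eta> v = \<eta>' v"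
  shows "meval \<kappa> \<eta> q = meval \<kappa> \<eta>' q"
  using polys_hom_eq[OF meval_hom meval_hom _ _ assms(1), of \<eta> \<eta>'] assms(2) by simp

end

lemma comm_ring_hom_comp:
  assumes "comm_ring_hom F" "comm_ring_hom G" shows "comm_ring_hom (\<lambda>x. F (G x))"
proof -
  interpret F: comm_ring_hom F by (rule assms)
  interpret G: comm_ring_hom G by (rule assms)
  show ?thesis by unfold_locales (auto simp: F.hom_add G.hom_add F.hom_mult G.hom_mult)
qed

lemma meval_polys:
  assumes "\<And>v. \<eta> v \<in> polys V" shows "meval mconst \<eta> q \<in> polys V"
  unfolding meval_def mono_eval_def using assms by (auto intro!: polys_sum polys_mult polys_prod)

section \<open>Partial derivatives\<close>

lemma mpartial_superset:
  assumes "finite S" "keys q \<subseteq> S"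
  shows "mpartial v q = (\<Sum>m \<in> S. single (m - single v 1)
     (of_nat (lookup m v) * lookup q m))"
  unfolding mpartial_def using assms
  by (intro sum.mono_neutral_left) (auto simp: in_keys_iff)

lemma mpartial_add: "mpartial v (a + b) = mpartial v a + mpartial v b"
proof -
  let ?S = "keys a \<union> keys b"
  have "keys (a + b) \<subseteq> ?S" by (rule Poly_Mapping.keys_add)
  then show ?thesis
    by (simp add: mpartial_superset[of ?S] lookup_add single_add distrib_left sum.distrib)
qed

lemma mpartial_single:
  "mpartial v (single m c) =
     single (m - single v 1) (of_nat (lookup m v) * c)"
  by (simp add: mpartial_def)

lemma mpartial_0 [simp]: "mpartial v 0 = 0"
  by (simp add: mpartial_def)

lemma mpartial_sum: "mpartial v (\<Sum>i\<in>I. f i) = (\<Sum>i\<in>I. mpartial v (f i))"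
  by (induction I rule: infinite_finite_induct) (auto simp: mpartial_add)

lemma mpartial_const [simp]: "mpartial v (mconst c) = 0"
  by (simp add: mconst_def mpartial_single)

lemma mpartial_var: "mpartial v (mvar w) = (if v = w then 1 else 0)"
  by (auto simp: mvar_def mpartial_single lookup_single)

text \<open>On monomials the only point is truncated subtraction: where the exponent of \<open>v\<close> is 0, it is
  multiplied by the coefficient 0.\<close>
lemma mpartial_mult: "mpartial v (a * b) = a * mpartial v b + mpartial v a * b"
proof -
  let ?e = "single v (1::nat)"
  have sh: "x + m - ?e = x + (m - ?e)" if "lookup m v \<noteq> 0" for x m :: "'a \<Rightarrow>\<^sub>0 nat"
    by (rule poly_mapping_eqI) (use that in \<open>auto simp: lookup_add lookup_minus lookup_single when_def\<close>)
  have sgl: "mpartial v (single m c * single m' c') =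
      single m c * mpartial v (single m' c') +
      mpartial v (single m c) * single m' c'" for m m' and c c' :: 'b
  proof -
    have 1: "single (m + m' - ?e) (c * (of_nat (lookup m' v) * c')) =
      single (m + (m' - ?e)) (c * (of_nat (lookup m' v) * c'))"
      by (cases "lookup m' v = 0") (auto simp: sh[simplified])
    have 2: "single (m + m' - ?e) ((of_nat (lookup m v) * c) * c') =
      single ((m - ?e) + m') ((of_nat (lookup m v) * c) * c')"
      by (cases "lookup m v = 0") (use sh[of m m'] in \<open>auto simp: add.commute\<close>)
    show ?thesis
      using 1 2 by (simp add: mult_single mpartial_single lookup_add algebra_simps single_add)
  qed
  let ?s = "\<lambda>q m. single m (lookup q m)"
  let ?A = "keys a" and ?B = "keys b"
  have "mpartial v ((\<Sum>m\<in>?A. ?s a m) * (\<Sum>m\<in>?B. ?s b m)) =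
    (\<Sum>m\<in>?A. ?s a m) * mpartial v (\<Sum>m\<in>?B. ?s b m) + mpartial v (\<Sum>m\<in>?A. ?s a m) * (\<Sum>m\<in>?B. ?s b m)"
    by (simp add: sum_product mpartial_sum sgl sum.distrib)
  then show ?thesis
    by (simp flip: mpol_sum_single)
qed

lemma mpartial_not_in:
  assumes "q \<in> polys V" "v \<notin> V" shows "mpartial v q = 0"
proof -
  have "lookup m v = 0" if "m \<in> keys q" for m
    using assms that unfolding polys_iff by (metis in_keys_iff subsetD)
  then show ?thesis by (simp add: mpartial_def)
qed

text \<open>Both sides are derivations along the substitution that agree on constants and variables.\<close>
lemma mpartial_chain_rule:
  assumes "finite T" and q: "q \<in> polys T"
  shows "mpartial b (meval mconst \<eta> q) = (\<Sum>t\<in>T. mpartial b (\<eta> t) * meval mconst \<eta> (mpartial t q))"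
proof -
  interpret comm_ring_hom "meval mconst \<eta>" by (rule meval_hom[OF mconst_hom])
  show ?thesis using q
  proof (induction rule: polys_induct)
    case (var v)
    have "(\<Sum>t\<in>T. mpartial b (\<eta> t) * meval mconst \<eta> (mpartial t (mvar v)))
      = (\<Sum>t\<in>T. if t = v then mpartial b (\<eta> t) else 0)"
      by (intro sum.cong) (auto simp: mpartial_var)
    then show ?case using var assms(1) by (simp add: meval_var[OF mconst_hom])
  next
    case (mult x y)
    then show ?case
      by (simp add: mpartial_mult hom_mult hom_add sum.distrib sum_distrib_left sum_distrib_right algebra_simps)
  qed (auto simp: meval_const[OF mconst_hom] mpartial_add hom_add sum.distrib distrib_left)
qed

section \<open>Ideals saturated at a prime\<close>

text \<open>Ideals are the submodules of the ring over itself, and generated ideals are spans.\<close>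
global_interpretation ring_module: Modules.module "(*) :: 'a::comm_ring_1 \<Rightarrow> 'a \<Rightarrow> 'a"
  by standard (auto simp: algebra_simps)

(* As a simplification rule this law would oppose mult.assoc. *)
declare ring_module.scale_scale [simp del]

definition prime_set :: "'a::comm_ring_1 set \<Rightarrow> bool" where
  "prime_set P \<longleftrightarrow> ring_module.subspace P \<and> 1 \<notin> P \<and> (\<forall>a b. a * b \<in> P \<longrightarrow> a \<in> P \<or> b \<in> P)"

text \<open>The contraction of the extension of \<open>I\<close> to the localisation at \<open>P\<close>.\<close>
definition saturation :: "'a::comm_ring_1 set \<Rightarrow> 'a set \<Rightarrow> 'a set" where
  "saturation P I = {q. \<exists>s. s \<notin> P \<and> s * q \<in> I}"

text \<open>Modulo such an ideal \<open>J\<close> the elements outside \<open>P\<close> can be cancelled as if they were units.  The two cases in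
  use are \<open>J = P\<close> and a saturation at \<open>P\<close>.\<close>
locale saturated_ideal =
  fixes P J :: "'a::comm_ring_1 set"
  assumes ideal: "ring_module.subspace J"
    and one_notin: "1 \<notin> P"
    and mult_notin: "a \<notin> P \<Longrightarrow> b \<notin> P \<Longrightarrow> a * b \<notin> P"
    and saturated: "s \<notin> P \<Longrightarrow> s * q \<in> J \<Longrightarrow> q \<in> J"

lemma prime_set_saturated: "prime_set P \<Longrightarrow> saturated_ideal P P"
  by unfold_locales (auto simp: prime_set_def)

lemma saturation_saturated:
  assumes P: "prime_set P" and I: "ring_module.subspace I"
  shows "saturated_ideal P (saturation P I)"
proof
  show "ring_module.subspace (saturation P I)"
    unfolding ring_module.subspace_def
  proof (intro conjI ballI allI)
    show "0 \<in> saturation P I"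
      using P ring_module.subspace_0[OF I] by (auto simp: saturation_def prime_set_def intro!: exI[of _ 1])
  next
    fix x y assume "x \<in> saturation P I" "y \<in> saturation P I"
    then obtain s t where st: "s \<notin> P" "t \<notin> P" "s * x \<in> I" "t * y \<in> I" by (auto simp: saturation_def)
    have "t * (s * x) + s * (t * y) \<in> I"
      by (rule ring_module.subspace_add[OF I ring_module.subspace_scale[OF I] ring_module.subspace_scale[OF I]]) (use st in auto)
    then have "s * t * (x + y) \<in> I" by (simp add: algebra_simps)
    moreover have "s * t \<notin> P" using st P unfolding prime_set_def by blast
    ultimately show "x + y \<in> saturation P I" unfolding saturation_def by blast
  next
    fix c x assume "x \<in> saturation P I"
    then obtain s where s: "s \<notin> P" "s * x \<in> I" by (auto simp: saturation_def)
    have "c * (s * x) \<in> I" by (rule ring_module.subspace_scale[OF I s(2)])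
    then have "s * (c * x) \<in> I" by (simp add: mult.left_commute)
    then show "c * x \<in> saturation P I" unfolding saturation_def using s by blast
  qed
  show "q \<in> saturation P I" if sq: "s \<notin> P" "s * q \<in> saturation P I" for s q
  proof -
    from sq obtain t where "t \<notin> P" "t * (s * q) \<in> I" by (auto simp: saturation_def)
    then have "t * s * q \<in> I" "t * s \<notin> P" using sq P by (auto simp: prime_set_def mult.assoc)
    then show ?thesis unfolding saturation_def by blast
  qed
qed (use P in \<open>auto simp: prime_set_def\<close>)

lemma common_denominator:
  assumes "prime_set P" "ring_module.subspace I" "finite G" "G \<subseteq> saturation P I"
  shows "\<exists>s. s \<notin> P \<and> (\<forall>q\<in>G. s * q \<in> I)"
  using assms(3,4)
proof (induction G rule: finite_induct)
  case empty
  then show ?case using assms(1) by (auto simp: prime_set_def)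
next
  case (insert q G)
  then obtain s t where st: "s \<notin> P" "\<forall>q\<in>G. s * q \<in> I" "t \<notin> P" "t * q \<in> I"
    by (auto simp: saturation_def)
  have "s * (t * q) \<in> I" using st(4) by (rule ring_module.subspace_scale[OF assms(2)])
  moreover have "t * (s * q') \<in> I" if "q' \<in> G" for q'
    by (rule ring_module.subspace_scale[OF assms(2) bspec[OF st(2) that]])
  ultimately have "\<forall>q'\<in>insert q G. s * t * q' \<in> I" by (simp add: mult_ac)
  moreover have "s * t \<notin> P" using st assms(1) by (auto simp: prime_set_def)
  ultimately show ?case by blast
qed

lemma span_scaled:
  assumes "q \<in> ring_module.span H"
  shows "s * q \<in> ring_module.span ((*) s ` H)"
proof -
  let ?N = "ring_module.span ((*) s ` H)"
  have "ring_module.subspace {q. s * q \<in> ?N}"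
    using ring_module.subspace_span[of "(*) s ` H"]
    by (auto simp: ring_module.subspace_def distrib_left mult.left_commute[of s])
  moreover have "H \<subseteq> {q. s * q \<in> ?N}" using ring_module.span_superset[of "(*) s ` H"] by blast
  ultimately show ?thesis using assms ring_module.span_minimal by blast
qed

lemma saturation_superset: "prime_set P \<Longrightarrow> I \<subseteq> saturation P I"
  by (auto simp: saturation_def prime_set_def intro!: exI[of _ 1])

definition eqv :: "'a::comm_ring_1 \<Rightarrow> 'a set \<Rightarrow> 'a \<Rightarrow> bool"  (\<open>_ \<approx>[_] _\<close> [51, 0, 51] 50) where
  "a \<approx>[J] b \<longleftrightarrow> a - b \<in> J"

context saturated_ideal
begin

lemma eqv_refl [simp, intro]: "a \<approx>[J] a"
  using ring_module.subspace_0[OF ideal] by (simp add: eqv_def)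

lemma eqv_trans [trans]: "a \<approx>[J] b \<Longrightarrow> b \<approx>[J] c \<Longrightarrow> a \<approx>[J] c"
  using ring_module.subspace_add[OF ideal, of "a - b" "b - c"] by (simp add: eqv_def)

lemma eqv_add: "a \<approx>[J] b \<Longrightarrow> c \<approx>[J] d \<Longrightarrow> a + c \<approx>[J] b + d"
  using ring_module.subspace_add[OF ideal, of "a - b" "c - d"] by (simp add: eqv_def algebra_simps)

lemma eqv_mult_left: "a \<approx>[J] b \<Longrightarrow> c * a \<approx>[J] c * b"
  using ring_module.subspace_scale[OF ideal, of "a - b" c] by (simp add: eqv_def algebra_simps)

lemma eqv_mult: "a \<approx>[J] b \<Longrightarrow> c \<approx>[J] d \<Longrightarrow> a * c \<approx>[J] b * d"
  using eqv_mult_left[of a b c] eqv_mult_left[of c d b] by (metis eqv_trans mult.commute)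

lemma eqv_sum: "(\<And>i. i \<in> I \<Longrightarrow> f i \<approx>[J] g i) \<Longrightarrow> (\<Sum>i\<in>I. f i) \<approx>[J] (\<Sum>i\<in>I. g i)"
  by (induction I rule: infinite_finite_induct) (auto intro: eqv_add)

lemma eqv_prod: "(\<And>i. i \<in> I \<Longrightarrow> f i \<approx>[J] g i) \<Longrightarrow> (\<Prod>i\<in>I. f i) \<approx>[J] (\<Prod>i\<in>I. g i)"
  by (induction I rule: infinite_finite_induct) (auto intro: eqv_mult)

lemma power_notin: "s \<notin> P \<Longrightarrow> s ^ n \<notin> P"
  by (induction n) (auto simp: one_notin mult_notin)

lemma eqv_det:
  assumes "\<And>i j. i < m \<Longrightarrow> j < m \<Longrightarrow> f (i, j) \<approx>[J] g (i, j)"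
  shows "det (mat m m f) \<approx>[J] det (mat m m g)"
proof -
  have *: "(\<Prod>i = 0..<m. mat m m f $$ (i, p i)) \<approx>[J] (\<Prod>i = 0..<m. mat m m g $$ (i, p i))"
    if p: "p permutes {0..<m}" for p
  proof (rule eqv_prod)
    fix i assume i: "i \<in> {0..<m}"
    then have "p i < m" using permutes_in_image[OF p, of i] by simp
    then show "mat m m f $$ (i, p i) \<approx>[J] mat m m g $$ (i, p i)" using i assms by simp
  qed
  show ?thesis
    unfolding det_def'[OF mat_carrier]
    by (rule eqv_sum, rule eqv_mult_left, rule *, simp)
qed

end

section \<open>Minors and Cramer's rule\<close>

definition sub_det :: "('r \<Rightarrow> 'c \<Rightarrow> 'a::comm_ring_1) \<Rightarrow> 'r list \<Rightarrow> 'c list \<Rightarrow> 'a" where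
  "sub_det M rs cs = det (mat (length rs) (length rs) (\<lambda>(j, l). M (rs ! j) (cs ! l)))"

lemma minors_iff:
  "\<mu> \<in> minors M Rs Cs (int m) \<longleftrightarrow> (\<exists>rs cs. \<mu> = sub_det M rs cs \<and>
     length rs = m \<and> distinct rs \<and> set rs \<subseteq> Rs \<and> length cs = m \<and> distinct cs \<and> set cs \<subseteq> Cs)"
  unfolding minors_def sub_det_def by auto

text \<open>With \<open>\<delta> = sub_det M rs cs\<close>, the numbers \<open>cramer M rs cs l c / \<delta>\<close> are the coefficients that express column \<open>c\<close>
  through the columns \<open>cs\<close> in the rows \<open>rs\<close>.\<close>
definition cramer :: "('r \<Rightarrow> 'c \<Rightarrow> 'a::comm_ring_1) \<Rightarrow> 'r list \<Rightarrow> 'c list \<Rightarrow> nat \<Rightarrow> 'c \<Rightarrow> 'a" where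
  "cramer M rs cs l c = (\<Sum>j<length rs.
     adj_mat (mat (length rs) (length rs) (\<lambda>(j, l). M (rs ! j) (cs ! l))) $$ (l, j) * M (rs ! j) c)"

lemma cramer_row:
  assumes "i < length rs"
  shows "(\<Sum>l<length rs. M (rs ! i) (cs ! l) * cramer M rs cs l c) = sub_det M rs cs * M (rs ! i) c"
proof -
  let ?m = "length rs"
  let ?A = "mat ?m ?m (\<lambda>(j, l). M (rs ! j) (cs ! l))"
  have A: "?A \<in> carrier_mat ?m ?m" by simp
  have AB: "(\<Sum>l<?m. M (rs ! i) (cs ! l) * adj_mat ?A $$ (l, j)) = (if i = j then sub_det M rs cs else 0)"
    if "j < ?m" for j
  proof -
    have "(?A * adj_mat ?A) $$ (i, j) = (\<Sum>l<?m. M (rs ! i) (cs ! l) * adj_mat ?A $$ (l, j))"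
      using adj_mat(1)[OF A] assms that
      by (auto simp: times_mat_def scalar_prod_def lessThan_atLeast0 intro!: sum.cong)
    then show ?thesis unfolding adj_mat(2)[OF A] using assms that by (auto simp: sub_det_def)
  qed
  have "(\<Sum>l<?m. M (rs ! i) (cs ! l) * cramer M rs cs l c)
      = (\<Sum>j<?m. (\<Sum>l<?m. M (rs ! i) (cs ! l) * adj_mat ?A $$ (l, j)) * M (rs ! j) c)"
    unfolding cramer_def sum_distrib_left sum_distrib_right
    by (subst sum.swap) (simp add: mult.assoc)
  also have "\<dots> = (\<Sum>j<?m. if i = j then sub_det M rs cs * M (rs ! j) c else 0)"
    by (intro sum.cong refl) (use AB in auto)
  finally show ?thesis using assms by simp
qed

lemma cramer_col:
  assumes "l < length rs" "l' < length rs"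
  shows "cramer M rs cs l (cs ! l') = (if l = l' then sub_det M rs cs else 0)"
proof -
  let ?m = "length rs"
  let ?A = "mat ?m ?m (\<lambda>(j, l). M (rs ! j) (cs ! l))"
  have A: "?A \<in> carrier_mat ?m ?m" by simp
  have "(adj_mat ?A * ?A) $$ (l, l') = cramer M rs cs l (cs ! l')"
    using adj_mat(1)[OF A] assms unfolding cramer_def
    by (auto simp: times_mat_def scalar_prod_def lessThan_atLeast0 intro!: sum.cong)
  then show ?thesis unfolding adj_mat(3)[OF A] using assms by (auto simp: sub_det_def)
qed

text \<open>The Schur complement of a bordered minor.  The factor \<open>sub_det M rs cs\<close> on both sides stands for the
  determinant of the column operations that clear the last column; the lemma serves only modulo ideals in
  which this factor can be cancelled.\<close>
lemma sub_det_bordered: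
  assumes len: "length cs = length rs"
  shows "sub_det M rs cs * sub_det M (rs @ [r]) (cs @ [c]) =
    sub_det M rs cs * (sub_det M rs cs * M r c - (\<Sum>l<length rs. M r (cs ! l) * cramer M rs cs l c))"
proof -
  define m where "m = length rs"
  define \<delta> where "\<delta> = sub_det M rs cs"
  define E where "E = \<delta> * M r c - (\<Sum>l<m. M r (cs ! l) * cramer M rs cs l c)"
  define B where "B = mat (Suc m) (Suc m) (\<lambda>(j, l). M ((rs @ [r]) ! j) ((cs @ [c]) ! l))"
  \<comment> \<open>Right multiplication by \<open>U\<close> replaces the last column by \<open>\<delta>\<close> times it minus a combination of the others.\<close>
  define U where "U = mat (Suc m) (Suc m) (\<lambda>(j, l).
    if l < m then (if j = l then 1 else 0) else if j < m then - cramer M rs cs j c else \<delta>)"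
  define W where "W = mat (Suc m) (Suc m) (\<lambda>(j, l).
    if l < m then M ((rs @ [r]) ! j) (cs ! l) else if j < m then 0 else E)"
  have dims: "B \<in> carrier_mat (Suc m) (Suc m)" "U \<in> carrier_mat (Suc m) (Suc m)" "W \<in> carrier_mat (Suc m) (Suc m)"
    by (simp_all add: B_def U_def W_def)
  have "B * U = W"
  proof (rule eq_matI)
    fix i j assume "i < dim_row W" "j < dim_col W"
    then have ij: "i < Suc m" "j < Suc m" by (auto simp: W_def)
    have "(B * U) $$ (i, j) = (\<Sum>l<Suc m. B $$ (i, l) * U $$ (l, j))"
      using ij dims by (auto simp: times_mat_def scalar_prod_def lessThan_atLeast0 intro!: sum.cong)
    also have "\<dots> = W $$ (i, j)"
    proof (cases "j < m")
      case True
      have "(\<Sum>l<Suc m. B $$ (i, l) * U $$ (l, j)) = (\<Sum>l<Suc m. if l = j then B $$ (i, l) else 0)"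
        using ij True by (intro sum.cong) (auto simp: U_def)
      also have "\<dots> = W $$ (i, j)" using ij True len
        by (simp add: B_def W_def nth_append m_def)
      finally show ?thesis .
    next
      case False
      then have j: "j = m" using ij by simp
      have "(\<Sum>l<Suc m. B $$ (i, l) * U $$ (l, j)) =
        (\<Sum>l<m. M ((rs @ [r]) ! i) (cs ! l) * - cramer M rs cs l c) + M ((rs @ [r]) ! i) c * \<delta>"
        using ij len j by (simp add: B_def U_def nth_append m_def)
      also have "\<dots> = W $$ (i, j)"
      proof (cases "i < m")
        case True
        then show ?thesis using cramer_row[of i rs M cs c] ij j
          by (simp add: W_def m_def nth_append \<delta>_def sum_negf mult.commute)
      next
        case F: False
        then have "i = m" using ij by simp
        then show ?thesis using ij j
          by (simp add: W_def m_def nth_append E_def sum_negf mult.commute)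
      qed
      finally show ?thesis .
    qed
    finally show "(B * U) $$ (i, j) = W $$ (i, j)" .
  qed (use dims in auto)
  then have 1: "det B * det U = det W" using det_mult[OF dims(1,2)] by simp
  have "det U = prod_list (diag_mat U)"
    by (rule det_upper_triangular[OF _ dims(2)]) (auto simp: U_def)
  also have "\<dots> = (\<Prod>i = 0..<Suc m. U $$ (i, i))"
    using dims by (simp add: prod_list_diag_prod)
  also have "\<dots> = \<delta>" by (simp add: U_def)
  finally have 2: "det U = \<delta>" .
  have "det W = (\<Sum>i<Suc m. W $$ (i, m) * cofactor W i m)"
    by (rule laplace_expansion_column[OF dims(3)]) simp
  also have "\<dots> = E * cofactor W m m" by (simp add: W_def)
  also have "mat_delete W m m = mat m m (\<lambda>(j, l). M (rs ! j) (cs ! l))"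
    by (rule eq_matI) (auto simp: mat_delete_def W_def nth_append m_def)
  then have "cofactor W m m = \<delta>" by (simp add: cofactor_def \<delta>_def sub_det_def m_def)
  finally have "det W = E * \<delta>" .
  moreover have "det B = sub_det M (rs @ [r]) (cs @ [c])"
    by (simp add: B_def sub_det_def m_def)
  ultimately have "\<delta> * sub_det M (rs @ [r]) (cs @ [c]) = \<delta> * E"
    using 1 2 by (metis mult.commute)
  then show ?thesis unfolding E_def unfolding \<delta>_def m_def .
qed

text \<open>Padded by zeros to square size, the first factor has a zero column.\<close>
lemma det_low_rank_eq_0:
  assumes "k < m"
  shows "det (mat m m (\<lambda>(i, j). \<Sum>l<k. a i l * b l j)) = (0 :: 'a::comm_ring_1)"
proof -
  let ?A = "mat m m (\<lambda>(i, l). if l < k then a i l else 0)" and ?B = "mat m m (\<lambda>(l, j). b l j)"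
  have dims: "?A \<in> carrier_mat m m" "?B \<in> carrier_mat m m" by auto
  have "(\<Sum>l<k. a i l * b l j) = (\<Sum>l<m. (if l < k then a i l else 0) * b l j)" for i j
    using assms by (intro sum.mono_neutral_cong_left) auto
  then have "mat m m (\<lambda>(i, j). \<Sum>l<k. a i l * b l j) = ?A * ?B"
    by (intro eq_matI) (auto simp: times_mat_def scalar_prod_def lessThan_atLeast0 intro!: sum.cong)
  moreover have "det ?A = (\<Sum>i<m. ?A $$ (i, k) * cofactor ?A i k)"
    by (rule laplace_expansion_column[OF dims(1) assms])
  then have "det ?A = 0" using assms by simp
  ultimately show ?thesis using det_mult[OF dims] by simp
qed

context saturated_ideal
begin

text \<open>The rank is at most \<open>k\<close> over the localisation of the ring at \<open>P\<close> modulo \<open>J\<close>, stated with the denominators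
  cleared.  In contrast to the vanishing of minors, a factorisation is visibly inherited by matrices whose
  columns are combinations of the given ones (\<open>rank_le_columns\<close>).\<close>
definition rank_le :: "nat \<Rightarrow> ('r \<Rightarrow> 'c \<Rightarrow> 'a) \<Rightarrow> 'r set \<Rightarrow> 'c set \<Rightarrow> bool" where
  "rank_le k M Rs Cs \<longleftrightarrow> (\<exists>\<delta> A B. \<delta> \<notin> P \<and>
     (\<forall>r\<in>Rs. \<forall>c\<in>Cs. \<delta> * M r c \<approx>[J] (\<Sum>l<k. A r l * B l c)))"

lemma rank_leI:
  assumes "\<delta> \<notin> P" "\<And>r c. r \<in> Rs \<Longrightarrow> c \<in> Cs \<Longrightarrow> \<delta> * M r c \<approx>[J] (\<Sum>l<k. A r l * B l c)"
  shows "rank_le k M Rs Cs"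
  unfolding rank_le_def by (rule exI[of _ \<delta>], rule exI[of _ A], rule exI[of _ B]) (use assms in simp)

lemma rank_leE:
  assumes "rank_le k M Rs Cs"
  obtains \<delta> A B where "\<delta> \<notin> P"
    "\<And>r c. r \<in> Rs \<Longrightarrow> c \<in> Cs \<Longrightarrow> \<delta> * M r c \<approx>[J] (\<Sum>l<k. A r l * B l c)"
  using assms unfolding rank_le_def by (elim exE conjE) (rule that, auto)

text \<open>A power of the common denominator \<open>\<delta>\<close> times the minor is the determinant of a product through size \<open>k\<close>.\<close>
lemma rank_le_minors:
  assumes "rank_le k M Rs Cs" "k < m"
  shows "minors M Rs Cs (int m) \<subseteq> J"
proof
  fix \<mu> assume "\<mu> \<in> minors M Rs Cs (int m)"
  then obtain rs cs where \<mu>: "\<mu> = sub_det M rs cs" and len: "length rs = m" "length cs = m"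
    and sub: "set rs \<subseteq> Rs" "set cs \<subseteq> Cs"
    unfolding minors_iff by blast
  from assms(1) obtain \<delta> A B where \<delta>: "\<delta> \<notin> P"
    and eq: "\<And>r c. r \<in> Rs \<Longrightarrow> c \<in> Cs \<Longrightarrow> \<delta> * M r c \<approx>[J] (\<Sum>l<k. A r l * B l c)"
    by (rule rank_leE) (rule that, auto)
  have "\<delta> \<cdot>\<^sub>m mat m m (\<lambda>(j, l). M (rs ! j) (cs ! l)) = mat m m (\<lambda>(j, l). \<delta> * M (rs ! j) (cs ! l))"
    by (rule eq_matI) auto
  then have "\<delta> ^ m * \<mu> = det (mat m m (\<lambda>(j, l). \<delta> * M (rs ! j) (cs ! l)))"
    by (metis \<mu> det_smult dim_col_mat(1) len(1) sub_det_def)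
  also have "\<dots> \<approx>[J] det (mat m m (\<lambda>(i, j). \<Sum>l<k. A (rs ! i) l * B l (cs ! j)))"
    by (rule eqv_det) (use sub len eq in \<open>auto simp: subset_iff\<close>)
  also have "\<dots> = 0" by (rule det_low_rank_eq_0[OF assms(2)])
  finally have "\<delta> ^ m * \<mu> \<in> J" by (simp add: eqv_def)
  then show "\<mu> \<in> J" using saturated power_notin[OF \<delta>] by blast
qed

text \<open>If the bordered minors of a pivot vanish, the pivot columns span all columns.  In a pivot row or a pivot
  column the relation is an identity.\<close>
lemma cramer_eqv:
  assumes \<delta>: "sub_det M rs cs \<notin> P" and len: "length cs = length rs"
    and border: "\<And>r c. r \<in> Rs - set rs \<Longrightarrow> c \<in> Cs - set cs \<Longrightarrow> sub_det M (rs @ [r]) (cs @ [c]) \<in> J"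
    and rc: "r \<in> Rs" "c \<in> Cs"
  shows "sub_det M rs cs * M r c \<approx>[J] (\<Sum>l<length rs. M r (cs ! l) * cramer M rs cs l c)"
proof -
  consider (row) "r \<in> set rs" | (col) "c \<in> set cs" | (border) "r \<notin> set rs" "c \<notin> set cs" by blast
  then show ?thesis
  proof cases
    case row
    then obtain i where "i < length rs" "r = rs ! i" by (auto simp: in_set_conv_nth)
    then show ?thesis using cramer_row[of i rs M cs c] by simp
  next
    case col
    then obtain l' where l': "l' < length rs" "c = cs ! l'" using len by (auto simp: in_set_conv_nth)
    have "(\<Sum>l<length rs. M r (cs ! l) * cramer M rs cs l c) =
      (\<Sum>l<length rs. if l = l' then M r (cs ! l) * sub_det M rs cs else 0)"
      using l' by (intro sum.cong) (auto simp: cramer_col)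
    then show ?thesis using l' by (simp add: mult.commute)
  next
    case border
    then have "sub_det M (rs @ [r]) (cs @ [c]) \<in> J" using assms(3) rc by auto
    then have "sub_det M rs cs * sub_det M (rs @ [r]) (cs @ [c]) \<in> J"
      by (rule ring_module.subspace_scale[OF ideal])
    then show ?thesis unfolding sub_det_bordered[OF len] eqv_def
      using saturated[OF \<delta>] by blast
  qed
qed

lemma bordered_minor:
  assumes "distinct rs" "set rs \<subseteq> Rs" "distinct cs" "set cs \<subseteq> Cs" "length cs = length rs"
    "r \<in> Rs - set rs" "c \<in> Cs - set cs"
  shows "sub_det M (rs @ [r]) (cs @ [c]) \<in> minors M Rs Cs (int (Suc (length rs)))"
  unfolding minors_iff using assms by (intro exI[of _ "rs @ [r]"] exI[of _ "cs @ [c]"]) auto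

lemma minors_rank_le:
  assumes "\<mu> \<in> minors M Rs Cs (int k)" "\<mu> \<notin> P" "minors M Rs Cs (int (Suc k)) \<subseteq> J"
  shows "rank_le k M Rs Cs"
proof -
  from assms(1) obtain rs cs where *: "\<mu> = sub_det M rs cs" "length rs = k" "distinct rs"
    "set rs \<subseteq> Rs" "length cs = k" "distinct cs" "set cs \<subseteq> Cs"
    unfolding minors_iff by blast
  have "sub_det M (rs @ [r]) (cs @ [c]) \<in> J" if "r \<in> Rs - set rs" "c \<in> Cs - set cs" for r c
    using bordered_minor[of rs Rs cs Cs r c M] that * assms(3) by auto
  then have eq: "sub_det M rs cs * M r c \<approx>[J] (\<Sum>l<k. M r (cs ! l) * cramer M rs cs l c)"
    if "r \<in> Rs" "c \<in> Cs" for r c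
    using cramer_eqv[of M rs cs Rs Cs] * assms(2) that by simp
  from assms(2) * have "sub_det M rs cs \<notin> P" by simp
  from rank_leI[OF this eq] show ?thesis .
qed

lemma rank_le_columns:
  assumes "rank_le k M Rs Cs"
    and comb: "\<And>r c'. r \<in> Rs \<Longrightarrow> c' \<in> Cs' \<Longrightarrow> M' r c' = (\<Sum>c\<in>Cs. g c c' * M r c)"
  shows "rank_le k M' Rs Cs'"
proof -
  from assms(1) obtain \<delta> A B where \<delta>: "\<delta> \<notin> P"
    and eq: "\<And>r c. r \<in> Rs \<Longrightarrow> c \<in> Cs \<Longrightarrow> \<delta> * M r c \<approx>[J] (\<Sum>l<k. A r l * B l c)"
    by (rule rank_leE) (rule that, auto)
  have "\<delta> * M' r c' \<approx>[J] (\<Sum>l<k. A r l * (\<Sum>c\<in>Cs. g c c' * B l c))" if "r \<in> Rs" "c' \<in> Cs'" for r c'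
  proof -
    have "\<delta> * M' r c' = (\<Sum>c\<in>Cs. g c c' * (\<delta> * M r c))"
      by (simp add: comb that sum_distrib_left algebra_simps)
    also have "\<dots> \<approx>[J] (\<Sum>c\<in>Cs. g c c' * (\<Sum>l<k. A r l * B l c))"
      by (intro eqv_sum eqv_mult_left eq that)
    also have "\<dots> = (\<Sum>l<k. A r l * (\<Sum>c\<in>Cs. g c c' * B l c))"
      unfolding sum_distrib_left by (subst sum.swap) (simp add: algebra_simps)
    finally show ?thesis .
  qed
  then show ?thesis by (rule rank_leI[OF \<delta>])
qed

text \<open>The denominators of the two factorisations are multiplied up.\<close>
lemma rank_le_union:
  assumes "\<delta>\<^sub>1 \<notin> P" "\<delta>\<^sub>2 \<notin> P" "k\<^sub>1 \<le> k"
    and eq1: "\<And>r c. r \<in> Rs \<Longrightarrow> c \<in> Cs\<^sub>1 \<Longrightarrow> \<delta>\<^sub>1 * M r c \<approx>[J] (\<Sum>l<k\<^sub>1. A r l * B\<^sub>1 l c)"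
    and eq2: "\<And>r c. r \<in> Rs \<Longrightarrow> c \<in> Cs\<^sub>2 \<Longrightarrow> \<delta>\<^sub>2 * M r c \<approx>[J] (\<Sum>l<k. A r l * B\<^sub>2 l c)"
  shows "rank_le k M Rs (Cs\<^sub>1 \<union> Cs\<^sub>2)"
proof (rule rank_leI)
  let ?B = "\<lambda>l c. if c \<in> Cs\<^sub>1 then if l < k\<^sub>1 then \<delta>\<^sub>2 * B\<^sub>1 l c else 0 else \<delta>\<^sub>1 * B\<^sub>2 l c"
  show "\<delta>\<^sub>1 * \<delta>\<^sub>2 \<notin> P" using assms(1,2) by (rule mult_notin)
  fix r c assume r: "r \<in> Rs" and c: "c \<in> Cs\<^sub>1 \<union> Cs\<^sub>2"
  show "\<delta>\<^sub>1 * \<delta>\<^sub>2 * M r c \<approx>[J] (\<Sum>l<k. A r l * ?B l c)"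
  proof (cases "c \<in> Cs\<^sub>1")
    case True
    have "\<delta>\<^sub>2 * (\<delta>\<^sub>1 * M r c) \<approx>[J] \<delta>\<^sub>2 * (\<Sum>l<k\<^sub>1. A r l * B\<^sub>1 l c)"
      using eq1 r True by (intro eqv_mult_left)
    also have "\<dots> = (\<Sum>l<k\<^sub>1. A r l * ?B l c)"
      using True by (simp add: sum_distrib_left mult_ac)
    also have "\<dots> = (\<Sum>l<k. A r l * ?B l c)"
      using True assms(3) by (intro sum.mono_neutral_left) auto
    finally show ?thesis by (simp add: mult_ac)
  next
    case False
    then have "\<delta>\<^sub>1 * (\<delta>\<^sub>2 * M r c) \<approx>[J] \<delta>\<^sub>1 * (\<Sum>l<k. A r l * B\<^sub>2 l c)"
      using eq2 r c by (intro eqv_mult_left) blast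
    also have "\<dots> = (\<Sum>l<k. A r l * ?B l c)"
      using False by (simp add: sum_distrib_left mult_ac)
    finally show ?thesis by (simp add: mult_ac)
  qed
qed

end

lemma minors_0: "minors M Rs Cs 0 = {1}"
proof -
  have "sub_det M [] cs = 1" for cs by (simp add: sub_det_def)
  then have "x \<in> minors M Rs Cs 0 \<longleftrightarrow> x = 1" for x
    using minors_iff[of x M Rs Cs 0] by auto
  then show ?thesis by blast
qed

text \<open>A nonvanishing minor of largest size below \<open>m\<close> provides the factorisation.  It exists because the empty
  minor is 1.\<close>
lemma prime_rank_le:
  assumes P: "prime_set P" and "minors M Rs Cs (int m) \<subseteq> P"
  shows "\<exists>k<m. saturated_ideal.rank_le P P k M Rs Cs"
proof -
  interpret saturated_ideal P P by (rule prime_set_saturated[OF P])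
  let ?Q = "\<lambda>k. k < m \<and> \<not> minors M Rs Cs (int k) \<subseteq> P"
  have "m \<noteq> 0" using assms(2) one_notin by (cases m) (auto simp: minors_0)
  then have "?Q 0" using one_notin by (auto simp: minors_0)
  define k where "k = Max {k. ?Q k}"
  have fin: "finite {k. ?Q k}" by (rule finite_subset[of _ "{..<m}"]) auto
  have k: "?Q k" using Max_in[OF fin] \<open>?Q 0\<close> unfolding k_def by blast
  have max: "\<forall>j. ?Q j \<longrightarrow> j \<le> k" using Max_ge[OF fin] unfolding k_def by blast
  have "minors M Rs Cs (int (Suc k)) \<subseteq> P"
    using max[rule_format, of "Suc k"] k assms(2) by (cases "Suc k = m") auto
  moreover obtain \<mu> where "\<mu> \<in> minors M Rs Cs (int k)" "\<mu> \<notin> P" using k by blast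
  ultimately show ?thesis using minors_rank_le k by blast
qed

section \<open>Pivots at a point of the determinantal scheme\<close>

text \<open>The generic matrix of a symmetric map: one variable for each unordered pair and each \<open>y\<close>.\<close>
definition entry :: "'e \<times> 'f \<Rightarrow> 'e \<Rightarrow> ('e set \<times> 'f, 'k::field) mpol" where
  "entry = (\<lambda>(x, y) u. mvar ({x, u}, y))"

lemma entry_sym: "entry (x, y) u = entry (u, y) x"
  by (simp add: entry_def insert_commute)

text \<open>Since the columns \<open>cs\<close> of any nonvanishing minor span all columns of \<open>A\<close>, symmetry expresses every row \<open>(x, y)\<close>
  through the rows \<open>(l, y)\<close> with \<open>l\<close> in \<open>cs\<close>.  So the rows in \<open>set cs \<times> BF\<close> already have full rank \<open>d\<close>.\<close>
lemma symmetric_pivot: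
  fixes P :: "('e set \<times> 'f, 'k::field) mpol set"
  assumes P: "prime_set P"
    and vanish: "minors entry (BA \<times> BF) BA (int (Suc d)) \<subseteq> P"
    and nonvanish: "\<mu> \<in> minors entry (BA \<times> BF) BA (int d)" "\<mu> \<notin> P"
  obtains rs cs where "length rs = d" "length cs = d" "distinct rs" "distinct cs"
    "set cs \<subseteq> BA" "set rs \<subseteq> set cs \<times> BF" "sub_det entry rs cs \<notin> P"
proof -
  interpret saturated_ideal P P by (rule prime_set_saturated[OF P])
  let ?e = "entry :: 'e \<times> 'f \<Rightarrow> 'e \<Rightarrow> ('e set \<times> 'f, 'k) mpol"
  from nonvanish(1) obtain rs0 cs0 where \<mu>: "\<mu> = sub_det ?e rs0 cs0" and lists0: "length rs0 = d" "distinct rs0"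
    "set rs0 \<subseteq> BA \<times> BF" "length cs0 = d" "distinct cs0" "set cs0 \<subseteq> BA"
    unfolding minors_iff by blast
  define L where "L = set cs0"
  have \<delta>0: "sub_det ?e rs0 cs0 \<notin> P" using nonvanish(2) \<mu> by simp
  have cr: "sub_det ?e rs0 cs0 * ?e r c \<approx>[P] (\<Sum>j<d. ?e r (cs0 ! j) * cramer ?e rs0 cs0 j c)"
    if rc: "r \<in> BA \<times> BF" "c \<in> BA" for r c
  proof -
    have "sub_det ?e (rs0 @ [r]) (cs0 @ [c]) \<in> P" if "r \<in> BA \<times> BF - set rs0" "c \<in> BA - set cs0" for r c
      using bordered_minor[of rs0 "BA \<times> BF" cs0 BA r c ?e] that lists0 vanish by auto
    from cramer_eqv[OF \<delta>0 _ this rc] show ?thesis using lists0 by simp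
  qed
  have "\<not> minors ?e (L \<times> BF) L (int d) \<subseteq> P"
  proof
    assume "minors ?e (L \<times> BF) L (int d) \<subseteq> P"
    from prime_rank_le[OF P this] obtain k where k: "k < d" "rank_le k ?e (L \<times> BF) L" by blast
    from k(2) obtain \<delta>1 A B where \<delta>1: "\<delta>1 \<notin> P"
      and "\<forall>r\<in>L \<times> BF. \<forall>c\<in>L. \<delta>1 * ?e r c \<approx>[P] (\<Sum>l<k. A r l * B l c)"
      unfolding rank_le_def by (elim exE conjE) (rule that)
    then have AB: "\<delta>1 * ?e r c \<approx>[P] (\<Sum>l<k. A r l * B l c)" if "r \<in> L \<times> BF" "c \<in> L" for r c
      using that by blast
    have "rank_le k ?e (BA \<times> BF) L"
    proof (rule rank_leI)
      show "\<delta>1 * sub_det ?e rs0 cs0 \<notin> P" using \<delta>1 \<delta>0 by (rule mult_notin)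
      fix r l assume r: "r \<in> BA \<times> BF" and l: "l \<in> L"
      obtain x y where xy: "r = (x, y)" "x \<in> BA" "y \<in> BF" using r by blast
      have lA: "l \<in> BA" using l lists0 L_def by blast
      have "\<delta>1 * sub_det ?e rs0 cs0 * ?e r l = \<delta>1 * (sub_det ?e rs0 cs0 * ?e (l, y) x)"
        by (simp add: xy entry_sym[of x] mult.assoc)
      also have "\<dots> \<approx>[P] \<delta>1 * (\<Sum>j<d. ?e (l, y) (cs0 ! j) * cramer ?e rs0 cs0 j x)"
        by (intro eqv_mult_left cr) (use xy lA in auto)
      also have "\<dots> = (\<Sum>j<d. cramer ?e rs0 cs0 j x * (\<delta>1 * ?e (cs0 ! j, y) l))"
        by (simp add: sum_distrib_left entry_sym[of l] mult_ac)
      also have "\<dots> \<approx>[P] (\<Sum>j<d. cramer ?e rs0 cs0 j x * (\<Sum>i<k. A (cs0 ! j, y) i * B i l))"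
        by (intro eqv_sum eqv_mult_left AB) (use xy l lists0 in \<open>auto simp: L_def\<close>)
      also have "\<dots> = (\<Sum>i<k. (\<Sum>j<d. cramer ?e rs0 cs0 j x * A (cs0 ! j, y) i) * B i l)"
        unfolding sum_distrib_left sum_distrib_right by (subst sum.swap) (simp add: mult.assoc)
      finally show "\<delta>1 * sub_det ?e rs0 cs0 * ?e r l \<approx>[P]
        (\<Sum>i<k. (\<Sum>j<d. cramer ?e rs0 cs0 j (fst r) * A (cs0 ! j, snd r) i) * B i l)"
        by (simp add: xy)
    qed
    from rank_le_minors[OF this k(1)] have "minors ?e (BA \<times> BF) L (int d) \<subseteq> P" .
    moreover have "\<mu> \<in> minors ?e (BA \<times> BF) L (int d)"
      unfolding minors_iff using \<mu> lists0 by (intro exI[of _ rs0] exI[of _ cs0]) (auto simp: L_def)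
    ultimately show False using nonvanish(2) by blast
  qed
  then obtain \<nu> where "\<nu> \<in> minors ?e (L \<times> BF) L (int d)" "\<nu> \<notin> P" by blast
  then obtain rs cs where *: "sub_det ?e rs cs \<notin> P" "length rs = d" "distinct rs"
    "set rs \<subseteq> L \<times> BF" "length cs = d" "distinct cs" "set cs \<subseteq> L"
    unfolding minors_iff by blast
  have "card (set cs) = card L" using * lists0 by (simp add: L_def distinct_card)
  then have "set cs = L" using * by (intro card_subset_eq) (auto simp: L_def)
  with * lists0 show thesis by (intro that[of rs cs]) (auto simp: L_def)
qed

text \<open>As long as the size is below the rank \<open>n\<close>, some bordered minor does not vanish, and its new column lies in \<open>C\<close>
  because the columns of \<open>BA\<close> depend on those of the pivot in \<open>A\<close>.\<close>
lemma pivot_extension: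
  fixes P :: "('e set \<times> 'f, 'k::field) mpol set"
  assumes P: "prime_set P"
    and vanishA: "minors entry (BA \<times> BF) BA (int (Suc d)) \<subseteq> P"
    and nonvanish: "\<mu> \<in> minors entry (BA \<times> BF) (BA \<union> C) (int n)" "\<mu> \<notin> P"
    and pivot: "length rs = d" "length cs = d" "distinct rs" "distinct cs"
    "set cs \<subseteq> BA" "set rs \<subseteq> BA \<times> BF" "sub_det entry rs cs \<notin> P"
    and disj: "BA \<inter> C = {}"
    and "d \<le> m" "m \<le> n"
  shows "\<exists>rs' cs'. length rs' = m - d \<and> length cs' = m - d \<and> distinct (rs @ rs') \<and> distinct (cs @ cs') \<and>
    set rs' \<subseteq> BA \<times> BF \<and> set cs' \<subseteq> C \<and> sub_det entry (rs @ rs') (cs @ cs') \<notin> P"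
  using \<open>d \<le> m\<close> \<open>m \<le> n\<close>
proof (induction m rule: dec_induct)
  case base
  show ?case by (rule exI[of _ "[]"], rule exI[of _ "[]"]) (use pivot in simp)
next
  case (step m)
  interpret saturated_ideal P P by (rule prime_set_saturated[OF P])
  let ?e = "entry :: 'e \<times> 'f \<Rightarrow> 'e \<Rightarrow> ('e set \<times> 'f, 'k) mpol"
  from step obtain rs' cs' where l: "length rs' = m - d" "length cs' = m - d"
    "distinct (rs @ rs')" "distinct (cs @ cs')"
    "set rs' \<subseteq> BA \<times> BF" "set cs' \<subseteq> C" and \<delta>: "sub_det ?e (rs @ rs') (cs @ cs') \<notin> P" by auto
  let ?rs = "rs @ rs'" and ?cs = "cs @ cs'"
  have len: "length ?cs = length ?rs" "length ?rs = m" using l pivot step by auto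
  have "\<exists>r\<in>BA \<times> BF - set ?rs. \<exists>c\<in>C - set ?cs. sub_det ?e (?rs @ [r]) (?cs @ [c]) \<notin> P"
  proof (rule ccontr)
    assume "\<not> ?thesis"
    then have border: "sub_det ?e (?rs @ [r]) (?cs @ [c]) \<in> P" if "r \<in> BA \<times> BF - set ?rs" "c \<in> C - set ?cs" for r c
      using that by blast
    have borderA: "sub_det ?e (rs @ [r]) (cs @ [c]) \<in> P" if "r \<in> BA \<times> BF - set rs" "c \<in> BA - set cs" for r c
      using bordered_minor[of rs "BA \<times> BF" cs BA r c ?e] that pivot vanishA by auto
    have "rank_le m ?e (BA \<times> BF) (BA \<union> C)"
    proof (rule rank_le_union[OF pivot(7) \<delta>, of d])
      fix r c assume r: "r \<in> BA \<times> BF"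
      show "sub_det ?e rs cs * ?e r c \<approx>[P] (\<Sum>j<d. ?e r (?cs ! j) * cramer ?e rs cs j c)" if "c \<in> BA"
        using cramer_eqv[OF pivot(7) _ borderA r that] pivot by (simp add: nth_append)
      show "sub_det ?e ?rs ?cs * ?e r c \<approx>[P] (\<Sum>j<m. ?e r (?cs ! j) * cramer ?e ?rs ?cs j c)" if "c \<in> C"
        using cramer_eqv[OF \<delta> _ border r that] len by simp
    qed (use step in auto)
    then have "minors ?e (BA \<times> BF) (BA \<union> C) (int n) \<subseteq> P"
      using rank_le_minors step by (metis Suc_le_lessD)
    then show False using nonvanish by blast
  qed
  then obtain r c where rc: "r \<in> BA \<times> BF - set ?rs" "c \<in> C - set ?cs"
    "sub_det ?e (?rs @ [r]) (?cs @ [c]) \<notin> P" by blast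
  show ?case
    by (rule exI[of _ "rs' @ [r]"], rule exI[of _ "cs' @ [c]"]) (use rc l step in auto)
qed

section \<open>Solving for coordinates near a point\<close>

lemma det_polys:
  assumes "A \<in> carrier_mat m m" "\<And>i j. i < m \<Longrightarrow> j < m \<Longrightarrow> A $$ (i, j) \<in> polys V"
  shows "det A \<in> polys V"
proof -
  have "signof p \<in> polys V" for p :: "nat \<Rightarrow> nat"
    by (simp add: sign_def) (metis polys_1 polys_uminus)
  moreover have "A $$ (i, p i) \<in> polys V" if "p permutes {0..<m}" "i \<in> {0..<m}" for p i
    using assms(2)[of i "p i"] that permutes_in_image[OF that(1), of i] by simp
  ultimately show ?thesis
    unfolding det_def'[OF assms(1)] by (intro polys_sum polys_mult polys_prod) auto
qed

lemma adj_mat_polys: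
  assumes A: "A \<in> carrier_mat m m" and "\<And>i j. i < m \<Longrightarrow> j < m \<Longrightarrow> A $$ (i, j) \<in> polys V"
    and ij: "i < m" "j < m"
  shows "adj_mat A $$ (i, j) \<in> polys V"
proof -
  have "mat_delete A j i \<in> carrier_mat (m - 1) (m - 1)" by (rule mat_delete_carrier[OF A])
  then have "det (mat_delete A j i) \<in> polys V"
    by (rule det_polys) (use assms in \<open>auto simp: mat_delete_def\<close>)
  moreover have "(-1) ^ (j + i) \<in> polys V" by (intro polys_power polys_uminus polys_1)
  ultimately show ?thesis using A ij by (auto simp: adj_mat_def cofactor_def)
qed

lemma sub_det_polys:
  assumes "length cs = length rs" "\<And>r c. r \<in> set rs \<Longrightarrow> c \<in> set cs \<Longrightarrow> M r c \<in> polys V"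
  shows "sub_det M rs cs \<in> polys V"
  unfolding sub_det_def by (rule det_polys) (use assms in auto)

lemma cramer_polys:
  assumes "length cs = length rs" "\<And>r c. r \<in> set rs \<Longrightarrow> c \<in> set cs \<Longrightarrow> M r c \<in> polys V"
    and "\<And>r. r \<in> set rs \<Longrightarrow> M r c \<in> polys V" and l: "l < length rs"
  shows "cramer M rs cs l c \<in> polys V"
  unfolding cramer_def
proof (intro polys_sum polys_mult)
  fix j assume "j \<in> {..<length rs}"
  then show "adj_mat (mat (length rs) (length rs) (\<lambda>(j, l). M (rs ! j) (cs ! l))) $$ (l, j) \<in> polys V"
    using l by (intro adj_mat_polys[of _ "length rs"]) (auto intro!: assms(2) simp: assms(1))
qed (use assms in auto)

lemma entry_polys: "({x, u}, y) \<in> V \<Longrightarrow> entry (x, y) u \<in> polys V"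
  by (auto simp: entry_def)

definition coords :: "'e set \<Rightarrow> 'e set \<Rightarrow> 'f set \<Rightarrow> ('e set \<times> 'f) set" where
  "coords BA C BF = {({x, u}, y) | x u y. x \<in> BA \<and> u \<in> BA \<union> C \<and> y \<in> BF}"

lemma finite_coords:
  assumes "finite BA" "finite C" "finite BF"
  shows "finite (coords BA C BF)"
proof -
  have "coords BA C BF \<subseteq> (\<lambda>(x, u, y). ({x, u}, y)) ` (BA \<times> (BA \<union> C) \<times> BF)"
    unfolding coords_def by force
  then show ?thesis using assms by (meson finite_SigmaI finite_UnI finite_imageI finite_subset)
qed

text \<open>The unordered pair determines its representation by \<open>x\<close> in \<open>BA\<close> and \<open>u\<close> in \<open>BA \<union> C\<close> up to an exchange.  So the
  choice is immaterial if \<open>r\<close> is symmetric on \<open>BA\<close>.\<close>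
definition lift_pairs :: "'e set \<Rightarrow> 'e set \<Rightarrow> ('e \<Rightarrow> 'e \<Rightarrow> 'f \<Rightarrow> 'a) \<Rightarrow> 'e set \<times> 'f \<Rightarrow> 'a" where
  "lift_pairs BA C r t = (SOME q. \<exists>x u y. t = ({x, u}, y) \<and> x \<in> BA \<and> u \<in> BA \<union> C \<and> q = r x u y)"

lemma lift_pairs_eq:
  assumes "x \<in> BA" "u \<in> BA \<union> C" and sym: "x \<in> BA \<Longrightarrow> u \<in> BA \<Longrightarrow> r x u y = r u x y"
  shows "lift_pairs BA C r ({x, u}, y) = r x u y"
proof -
  have "q = r x u y"
    if "\<exists>x' u' y'. ({x, u}, y) = ({x', u'}, y') \<and> x' \<in> BA \<and> u' \<in> BA \<union> C \<and> q = r x' u' y'" for q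
  proof -
    from that obtain x' u' where *: "{x, u} = {x', u'}" "x' \<in> BA" "q = r x' u' y" by auto
    from *(1) consider "x' = x" "u' = u" | "x' = u" "u' = x" by (auto simp: doubleton_eq_iff)
    then show ?thesis by cases (use * assms in auto)
  qed
  moreover have "\<exists>q x' u' y'. ({x, u}, y) = ({x', u'}, y') \<and> x' \<in> BA \<and> u' \<in> BA \<union> C \<and> q = r x' u' y'"
    using assms by blast
  ultimately show ?thesis unfolding lift_pairs_def by (rule someI2_ex[rotated])
qed

text \<open>The relations \<open>den t * mvar t = num t\<close>, for \<open>t\<close> in \<open>xs\<close> in this order, can be solved one after the other:
  the coefficients of each one involve only earlier variables and the variables outside \<open>xs\<close>.\<close>
definition triangular :: "'t set \<Rightarrow> 't list \<Rightarrow> ('t \<Rightarrow> ('t, 'k::field) mpol) \<Rightarrow> ('t \<Rightarrow> ('t, 'k) mpol) \<Rightarrow> bool" where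
  "triangular T xs den num \<longleftrightarrow> distinct xs \<and> set xs \<subseteq> T \<and>
     (\<forall>i < length xs. den (xs ! i) \<in> polys (T - set (drop i xs)) \<and> num (xs ! i) \<in> polys (T - set (drop i xs)))"

lemma mpartial_diff: "mpartial v (a - b) = mpartial v a - mpartial v b"
  using mpartial_add[of v "a - b" b] by simp

lemma mpartial_triangular:
  assumes tri: "triangular T xs den num" and ij: "i \<le> j" "j < length xs"
  shows "mpartial (xs ! j) (den (xs ! i) * mvar (xs ! i) - num (xs ! i)) = (if i = j then den (xs ! j) else 0)"
proof -
  have i: "i < length xs" using ij by simp
  have j: "xs ! j \<in> set (drop i xs)"
    using ij nth_mem[of "j - i" "drop i xs"] by simp
  have "mpartial (xs ! j) (den (xs ! i)) = 0" "mpartial (xs ! j) (num (xs ! i)) = 0"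
    using tri i j by (auto simp: triangular_def intro: mpartial_not_in)
  moreover have "xs ! j = xs ! i \<longleftrightarrow> i = j"
    using tri i ij by (auto simp: triangular_def nth_eq_iff_index_eq)
  ultimately show ?thesis by (auto simp: mpartial_diff mpartial_mult mpartial_var)
qed

text \<open>The pivot \<open>rsA\<close>, \<open>csA\<close> of the restriction to \<open>A\<close> has its rows in \<open>set csA \<times> BF\<close>; it is extended by \<open>rsC\<close>, \<open>csC\<close> to
  a pivot of the whole matrix.\<close>
locale pivots =
  fixes P :: "('e set \<times> 'f, 'k::field) mpol set"
    and BA C :: "'e set" and BF :: "'f set"
    and rsA rsC :: "('e \<times> 'f) list" and csA csC :: "'e list"
  assumes P: "prime_set P"
    and fin: "finite BA" "finite C" "finite BF"
    and disj: "BA \<inter> C = {}"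
    and dist: "distinct (rsA @ rsC)" "distinct (csA @ csC)"
    and len: "length csA = length rsA" "length csC = length rsC"
    and sub: "set csA \<subseteq> BA" "set csC \<subseteq> C" "set rsA \<subseteq> set csA \<times> BF" "set rsC \<subseteq> BA \<times> BF"
    and pivot: "sub_det entry rsA csA \<notin> P" "sub_det entry (rsA @ rsC) (csA @ csC) \<notin> P"
begin

abbreviation "T \<equiv> coords BA C BF"
abbreviation "rs \<equiv> rsA @ rsC"
abbreviation "cs \<equiv> csA @ csC"
abbreviation "e \<equiv> entry :: 'e \<times> 'f \<Rightarrow> 'e \<Rightarrow> ('e set \<times> 'f, 'k) mpol"
abbreviation "\<delta>\<^sub>A \<equiv> sub_det e rsA csA"
abbreviation "\<delta>\<^sub>E \<equiv> sub_det e rs cs"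

text \<open>Where the rank on \<open>A\<close> is \<open>length rsA\<close>, the columns of \<open>A\<close> depend on the pivot columns.  This defines a projection of
  \<open>A\<close> to the span of \<open>csA\<close> with coefficients \<open>cramer e rsA csA j u / \<delta>\<^sub>A\<close>, and \<open>quad y\<close> is \<open>\<delta>\<^sub>A\<^sup>2\<close> times the pullback of
  the form \<open>y\<close>.  Unlike the plain Cramer relation it is symmetric, so it gives one equation for each unordered pair.\<close>
definition quad :: "'f \<Rightarrow> 'e \<Rightarrow> 'e \<Rightarrow> ('e set \<times> 'f, 'k) mpol" where
  "quad y u u' = (\<Sum>j<length rsA. \<Sum>j'<length rsA.
     cramer e rsA csA j u * cramer e rsA csA j' u' * e (csA ! j, y) (csA ! j'))"

definition rhs :: "'e \<Rightarrow> 'f \<Rightarrow> 'e \<Rightarrow> ('e set \<times> 'f, 'k) mpol" where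
  "rhs x y u = (if u \<in> BA then quad y x u else (\<Sum>j<length rs. e (x, y) (cs ! j) * cramer e rs cs j u))"

text \<open>If \<open>(x, y)\<close> is a pivot row, then \<open>x\<close> is in \<open>csA\<close>; hence a pair of two elements outside \<open>csA\<close> is always solved.\<close>
definition solvedA :: "('e set \<times> 'f) set" where
  "solvedA = {({x, k}, y) | x k y. x \<in> BA \<and> k \<in> BA - set csA \<and> y \<in> BF \<and> (x, y) \<notin> set rsA}"

definition solvedC :: "('e set \<times> 'f) set" where
  "solvedC = {({x, c}, y) | x c y. x \<in> BA \<and> c \<in> C - set csC \<and> y \<in> BF \<and> (x, y) \<notin> set rs}"

definition den :: "'e set \<times> 'f \<Rightarrow> ('e set \<times> 'f, 'k) mpol" where
  "den t = (if fst t \<subseteq> BA then \<delta>\<^sub>A\<^sup>2 else \<delta>\<^sub>E)"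

definition num :: "'e set \<times> 'f \<Rightarrow> ('e set \<times> 'f, 'k) mpol" where
  "num = lift_pairs BA C (\<lambda>x u y. rhs x y u)"

lemma quad_sym: "quad y u u' = quad y u' u"
  unfolding quad_def by (subst sum.swap) (simp add: entry_sym mult_ac)

text \<open>The projection fixes the pivot vectors, so one of the two sums collapses.\<close>
lemma quad_pivot:
  assumes "x \<in> set csA"
  shows "quad y x u = \<delta>\<^sub>A * (\<Sum>j<length rsA. e (x, y) (csA ! j) * cramer e rsA csA j u)"
proof -
  obtain l where l: "l < length rsA" "x = csA ! l" using assms len by (auto simp: in_set_conv_nth)
  have "quad y x u = (\<Sum>j<length rsA. if j = l then (\<Sum>j'<length rsA.
     \<delta>\<^sub>A * cramer e rsA csA j' u * e (csA ! l, y) (csA ! j')) else 0)"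
    unfolding quad_def by (intro sum.cong) (use l in \<open>auto simp: cramer_col\<close>)
  then show ?thesis using l by (simp add: sum_distrib_left mult_ac)
qed

lemma num_eq:
  assumes "x \<in> BA" "y \<in> BF" "u \<in> BA \<union> C"
  shows "num ({x, u}, y) = rhs x y u"
  unfolding num_def by (rule lift_pairs_eq) (use assms in \<open>auto simp: rhs_def quad_sym\<close>)

lemma den_eq: "x \<in> BA \<Longrightarrow> u \<in> BA \<union> C \<Longrightarrow> den ({x, u}, y) = (if u \<in> BA then \<delta>\<^sub>A\<^sup>2 else \<delta>\<^sub>E)"
  using disj by (auto simp: den_def)

lemma den_notin: "den t \<notin> P"
  using pivot P by (auto simp: den_def power2_eq_square prime_set_def)

lemma length_rs: "length cs = length rs"
  using len by simp

lemma rs_sub: "set rs \<subseteq> BA \<times> BF"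
  using sub by auto

lemma cs_sub: "set cs \<subseteq> BA \<union> C"
  using sub by auto

text \<open>On \<open>A\<close>, Cramer's relation is applied to the column \<open>u\<close> and then, after a use of symmetry, to the column \<open>x\<close>.\<close>
lemma relations_in_saturated:
  assumes J: "saturated_ideal P J"
    and minorsA: "minors e (BA \<times> BF) BA (int (Suc (length rsA))) \<subseteq> J"
    and minorsE: "minors e (BA \<times> BF) (BA \<union> C) (int (Suc (length rs))) \<subseteq> J"
    and t: "t \<in> T"
  shows "den t * mvar t - num t \<in> J"
proof -
  interpret saturated_ideal P J by (rule J)
  from t obtain x u y where xuy: "t = ({x, u}, y)" "x \<in> BA" "u \<in> BA \<union> C" "y \<in> BF"
    unfolding coords_def by blast
  have border: "sub_det e (rs @ [r]) (cs @ [c]) \<in> J" if "r \<in> BA \<times> BF - set rs" "c \<in> BA \<union> C - set cs" for r c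
    using bordered_minor[OF dist(1) rs_sub dist(2) cs_sub length_rs that, of e] minorsE by blast
  have borderA: "sub_det e (rsA @ [r]) (csA @ [c]) \<in> J" if "r \<in> BA \<times> BF - set rsA" "c \<in> BA - set csA" for r c
    using bordered_minor[of rsA "BA \<times> BF" csA BA r c e] that minorsA dist sub len rs_sub by auto
  have A: "\<delta>\<^sub>A * e r c \<approx>[J] (\<Sum>j<length rsA. e r (csA ! j) * cramer e rsA csA j c)"
    if "r \<in> BA \<times> BF" "c \<in> BA" for r c
    by (rule cramer_eqv[OF pivot(1) len(1) borderA that])
  have "den t * e (x, y) u \<approx>[J] num t"
  proof (cases "u \<in> BA")
    case True
    have "\<delta>\<^sub>A * (\<delta>\<^sub>A * e (x, y) u) \<approx>[J] \<delta>\<^sub>A * (\<Sum>j<length rsA. e (x, y) (csA ! j) * cramer e rsA csA j u)"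
      by (intro eqv_mult_left A) (use xuy True in auto)
    also have "\<dots> = (\<Sum>j<length rsA. cramer e rsA csA j u * (\<delta>\<^sub>A * e (csA ! j, y) x))"
      by (simp add: sum_distrib_left entry_sym[of x] mult_ac)
    also have "\<dots> \<approx>[J] (\<Sum>j<length rsA. cramer e rsA csA j u *
       (\<Sum>j'<length rsA. e (csA ! j, y) (csA ! j') * cramer e rsA csA j' x))"
      by (intro eqv_sum eqv_mult_left A) (use xuy True sub len in auto)
    also have "\<dots> = quad y x u"
      by (subst quad_sym) (simp add: quad_def sum_distrib_left mult_ac)
    finally show ?thesis
      using True xuy by (simp add: num_eq rhs_def den_eq power2_eq_square mult.assoc)
  next
    case False
    have "\<delta>\<^sub>E * e (x, y) u \<approx>[J] (\<Sum>j<length rs. e (x, y) (cs ! j) * cramer e rs cs j u)"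
      by (rule cramer_eqv[where Rs = "BA \<times> BF" and Cs = "BA \<union> C", OF pivot(2) length_rs border])
        (use xuy in \<open>simp_all del: set_append\<close>)
    then show ?thesis using xuy False by (simp add: num_eq rhs_def den_eq)
  qed
  then show ?thesis by (simp add: eqv_def entry_def xuy)
qed

text \<open>The converse: the relations for the solved coordinates imply those for all coordinates.  In a pivot row and
  for a pair of pivot columns the relation is an identity, and the remaining pairs on \<open>A\<close> reduce to these cases by
  symmetry.  The relation then factors the matrix through the pivot columns.\<close>
lemma relations_imp_rank:
  assumes J: "saturated_ideal P J"
    and rel: "\<And>t. t \<in> solvedA \<union> solvedC \<Longrightarrow> den t * mvar t - num t \<in> J"
  shows "saturated_ideal.rank_le P J (length rsA) e (BA \<times> BF) BA"
    and "saturated_ideal.rank_le P J (length rs) e (BA \<times> BF) (BA \<union> C)"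
proof -
  interpret saturated_ideal P J by (rule J)
  have nonpivot: "\<delta>\<^sub>A\<^sup>2 * e (x, y) u \<approx>[J] quad y x u"
    if "x \<in> BA" "y \<in> BF" "u \<in> BA - set csA" "(x, y) \<notin> set rsA" for x y u
  proof -
    have "({x, u}, y) \<in> solvedA" using that by (auto simp: solvedA_def)
    then have "den ({x, u}, y) * mvar ({x, u}, y) - num ({x, u}, y) \<in> J" using rel by blast
    then show ?thesis using that by (simp add: num_eq den_eq rhs_def eqv_def entry_def)
  qed
  have pivotrow: "\<delta>\<^sub>A\<^sup>2 * e (x, y) u \<approx>[J] quad y x u" if xy: "(x, y) \<in> set rsA" for x y u
  proof -
    obtain i where i: "i < length rsA" "rsA ! i = (x, y)" using xy by (auto simp: in_set_conv_nth)
    have "x \<in> set csA" using xy sub by blast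
    then have "quad y x u = \<delta>\<^sub>A\<^sup>2 * e (x, y) u"
      using cramer_row[OF i(1), of e csA u] i by (simp add: quad_pivot power2_eq_square mult.assoc)
    then show ?thesis by simp
  qed
  have A: "\<delta>\<^sub>A\<^sup>2 * e (x, y) u \<approx>[J] quad y x u" if "x \<in> BA" "y \<in> BF" "u \<in> BA" for x y u
  proof (cases "u \<in> set csA")
    case False
    then show ?thesis using nonpivot pivotrow that by blast
  next
    case True
    show ?thesis
    proof (cases "x \<in> set csA")
      case False
      have "\<delta>\<^sub>A\<^sup>2 * e (u, y) x \<approx>[J] quad y u x"
        using nonpivot[of u y x] pivotrow[of u y x] that False by blast
      then show ?thesis by (simp add: entry_sym[of x] quad_sym[of _ x])
    next
      case x: True
      obtain l where l: "l < length rsA" "u = csA ! l" using True len by (auto simp: in_set_conv_nth)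
      have "(\<Sum>j<length rsA. e (x, y) (csA ! j) * cramer e rsA csA j u) =
        (\<Sum>j<length rsA. if j = l then e (x, y) u * \<delta>\<^sub>A else 0)"
        using l by (intro sum.cong) (auto simp: cramer_col)
      then have "quad y x u = \<delta>\<^sub>A\<^sup>2 * e (x, y) u"
        using l by (simp add: quad_pivot[OF x] power2_eq_square mult_ac)
      then show ?thesis by simp
    qed
  qed
  show rA: "rank_le (length rsA) e (BA \<times> BF) BA"
  proof (rule rank_leI)
    show "\<delta>\<^sub>A\<^sup>2 \<notin> P" using power_notin[OF pivot(1)] .
    fix r c assume r: "r \<in> BA \<times> BF" "c \<in> BA"
    then have "\<delta>\<^sub>A\<^sup>2 * e r c \<approx>[J] quad (snd r) (fst r) c" using A by auto
    also have "quad (snd r) (fst r) c = (\<Sum>l<length rsA. (\<Sum>j<length rsA. cramer e rsA csA j (fst r) *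
       e (csA ! j, snd r) (csA ! l)) * cramer e rsA csA l c)"
      unfolding quad_def sum_distrib_right by (subst sum.swap) (simp add: mult_ac)
    finally show "\<delta>\<^sub>A\<^sup>2 * e r c \<approx>[J] (\<Sum>l<length rsA. (\<Sum>j<length rsA. cramer e rsA csA j (fst r) *
       e (csA ! j, snd r) (csA ! l)) * cramer e rsA csA l c)" .
  qed
  have minorsA: "minors e (BA \<times> BF) BA (int (Suc (length rsA))) \<subseteq> J"
    by (rule rank_le_minors[OF rA]) simp
  have borderA: "sub_det e (rsA @ [r]) (csA @ [c]) \<in> J" if "r \<in> BA \<times> BF - set rsA" "c \<in> BA - set csA" for r c
    using bordered_minor[of rsA "BA \<times> BF" csA BA r c e] that minorsA dist sub len rs_sub by auto
  have E: "\<delta>\<^sub>E * e r c \<approx>[J] (\<Sum>j<length rs. e r (cs ! j) * cramer e rs cs j c)"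
    if r: "r \<in> BA \<times> BF" and c: "c \<in> C" for r c
  proof -
    consider (row) "r \<in> set rs" | (col) "c \<in> set csC" | (rel) "r \<notin> set rs" "c \<notin> set csC" by blast
    then show ?thesis
    proof cases
      case row
      then obtain i where "i < length rs" "r = rs ! i" by (metis in_set_conv_nth)
      then show ?thesis using cramer_row[of i rs e cs c] by simp
    next
      case col
      then have "c \<in> set cs" by simp
      then obtain l where l: "l < length rs" "c = cs ! l" using length_rs by (metis in_set_conv_nth)
      have "(\<Sum>j<length rs. e r (cs ! j) * cramer e rs cs j c) =
        (\<Sum>j<length rs. if j = l then e r c * \<delta>\<^sub>E else 0)"
        by (rule sum.cong[OF refl]) (use l cramer_col[OF _ l(1), of _ e cs] in auto)
      then show ?thesis using l by (simp add: mult.commute)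
    next
      case rel
      obtain x y where xy: "r = (x, y)" "x \<in> BA" "y \<in> BF" using r by blast
      have cBA: "c \<notin> BA" using c disj by blast
      have "({x, c}, y) \<in> solvedC" unfolding solvedC_def using rel c xy by blast
      then have "den ({x, c}, y) * mvar ({x, c}, y) - num ({x, c}, y) \<in> J" using assms(2) by blast
      then show ?thesis using xy c cBA by (simp add: num_eq den_eq rhs_def eqv_def entry_def)
    qed
  qed
  show "rank_le (length rs) e (BA \<times> BF) (BA \<union> C)"
  proof (rule rank_le_union[OF pivot, of "length rsA"])
    fix r c assume r: "r \<in> BA \<times> BF"
    show "\<delta>\<^sub>A * e r c \<approx>[J] (\<Sum>j<length rsA. e r (cs ! j) * cramer e rsA csA j c)" if "c \<in> BA"
      using cramer_eqv[OF pivot(1) len(1) borderA r that] len by (simp add: nth_append)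
    show "\<delta>\<^sub>E * e r c \<approx>[J] (\<Sum>j<length rs. e r (cs ! j) * cramer e rs cs j c)" if "c \<in> C"
      by (rule E[OF r that])
  qed simp
qed

subsection \<open>Which coordinates the relations involve\<close>

lemma solved_coords: "solvedA \<subseteq> T" "solvedC \<subseteq> T"
  unfolding solvedA_def solvedC_def coords_def by blast+

text \<open>The coordinates in this lemma and the next are those in the relations on \<open>A\<close>; the two lemmas after them
  treat the relations on \<open>C\<close>, whose coefficients may contain coordinates solved on \<open>A\<close>.\<close>
lemma free_pivot_square:
  assumes "x \<in> set csA" "u \<in> set csA" "y \<in> BF"
  shows "({x, u}, y) \<in> T - (solvedA \<union> solvedC)"
proof -
  have "({x, u}, y) \<notin> solvedA" using assms by (auto simp: solvedA_def doubleton_eq_iff)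
  moreover have "({x, u}, y) \<notin> solvedC"
    using assms disj sub by (auto simp: solvedC_def doubleton_eq_iff)
  ultimately show ?thesis using assms sub unfolding coords_def by blast
qed

lemma free_pivot_row:
  assumes "(x, y) \<in> set rsA" "u \<in> BA"
  shows "({x, u}, y) \<in> T - (solvedA \<union> solvedC)"
proof -
  have x: "x \<in> set csA" "x \<in> BA" "y \<in> BF" using assms sub by auto
  have "({x, u}, y) \<notin> solvedA" using assms x by (auto simp: solvedA_def doubleton_eq_iff)
  moreover have "({x, u}, y) \<notin> solvedC"
    using assms x disj sub by (auto simp: solvedC_def doubleton_eq_iff)
  ultimately show ?thesis using assms x unfolding coords_def by blast
qed

lemma unsolved_pivot_row:
  assumes "(x, y) \<in> set rs" "u \<in> BA \<union> C"
  shows "({x, u}, y) \<in> T - solvedC"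
proof -
  have x: "x \<in> BA" "y \<in> BF" using assms rs_sub by auto
  moreover have "({x, u}, y) \<notin> solvedC"
    using assms x disj by (auto simp: solvedC_def doubleton_eq_iff)
  ultimately show ?thesis using assms unfolding coords_def by blast
qed

lemma unsolved_pivot_column:
  assumes "x \<in> BA" "y \<in> BF" "u \<in> set cs"
  shows "({x, u}, y) \<in> T - solvedC"
proof -
  have "({x, u}, y) \<notin> solvedC"
    using assms disj sub by (auto simp: solvedC_def doubleton_eq_iff)
  then show ?thesis using assms sub unfolding coords_def by auto
qed

lemma solvedA_polys:
  assumes "t \<in> solvedA"
  shows "den t \<in> polys (T - (solvedA \<union> solvedC))" (is "_ \<in> polys ?V")
    and "num t \<in> polys (T - (solvedA \<union> solvedC))"
proof -
  from assms obtain x k y where t: "t = ({x, k}, y)" "x \<in> BA" "k \<in> BA" "y \<in> BF"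
    unfolding solvedA_def by blast
  have row: "e r u \<in> polys ?V" if "r \<in> set rsA" "u \<in> BA" for r u
    using that entry_polys[OF free_pivot_row[of "fst r" "snd r" u]] by simp
  have "\<delta>\<^sub>A \<in> polys ?V" by (rule sub_det_polys[OF len(1)]) (use row sub in blast)
  then show "den t \<in> polys ?V" using t by (auto simp: den_eq)
  have "cramer e rsA csA j u \<in> polys ?V" if "j < length rsA" "u \<in> BA" for j u
    by (rule cramer_polys[OF len(1)]) (use row sub that in blast)+
  moreover have "e (csA ! j, y) (csA ! j') \<in> polys ?V" if "j < length rsA" "j' < length rsA" for j j'
    by (rule entry_polys[OF free_pivot_square]) (use that t len in auto)
  ultimately have "quad y x k \<in> polys ?V"
    unfolding quad_def using t by (intro polys_sum polys_mult) auto
  then show "num t \<in> polys ?V" using t by (simp add: num_eq rhs_def)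
qed

lemma solvedC_polys:
  assumes "t \<in> solvedC"
  shows "den t \<in> polys (T - solvedC)" (is "_ \<in> polys ?V")
    and "num t \<in> polys (T - solvedC)"
proof -
  from assms obtain x c y where t: "t = ({x, c}, y)" "x \<in> BA" "c \<in> C" "y \<in> BF"
    unfolding solvedC_def by blast
  have c: "c \<notin> BA" using t disj by blast
  have row: "e r u \<in> polys ?V" if "r \<in> set rs" "u \<in> BA \<union> C" for r u
    using that entry_polys[OF unsolved_pivot_row[of "fst r" "snd r" u]] by simp
  have cs: "set cs \<subseteq> BA \<union> C" using sub by auto
  have "\<delta>\<^sub>E \<in> polys ?V" by (rule sub_det_polys[OF length_rs]) (use row cs in blast)
  then show "den t \<in> polys ?V" using t c by (auto simp: den_eq)
  have "cramer e rs cs j c \<in> polys ?V" if "j < length rs" for j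
    by (rule cramer_polys[OF length_rs]) (use row cs that t in blast)+
  moreover have "e (x, y) (cs ! j) \<in> polys ?V" if "j < length rs" for j
    by (rule entry_polys[OF unsolved_pivot_column]) (use t that length_rs in \<open>auto simp del: set_append\<close>)
  ultimately have "(\<Sum>j<length rs. e (x, y) (cs ! j) * cramer e rs cs j c) \<in> polys ?V"
    by (intro polys_sum polys_mult) auto
  then show "num t \<in> polys ?V" using t c by (simp add: num_eq rhs_def)
qed

lemma solved_disjoint: "solvedA \<inter> solvedC = {}"
  using disj by (auto simp: solvedA_def solvedC_def doubleton_eq_iff)

text \<open>The coordinates on \<open>A\<close> are solved before those on \<open>C\<close>.\<close>
lemma triangular_relations:
  "\<exists>xs. set xs = solvedA \<union> solvedC \<and> triangular T xs den num"
proof -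
  have finite_T: "finite T" by (rule finite_coords[OF fin])
  have fins: "finite solvedA" "finite solvedC"
    using solved_coords finite_T finite_subset by blast+
  obtain la where la: "set la = solvedA" "distinct la" using finite_distinct_list[OF fins(1)] by blast
  obtain lc where lc: "set lc = solvedC" "distinct lc" using finite_distinct_list[OF fins(2)] by blast
  have "den ((la @ lc) ! i) \<in> polys (T - set (drop i (la @ lc))) \<and>
      num ((la @ lc) ! i) \<in> polys (T - set (drop i (la @ lc)))" if i: "i < length (la @ lc)" for i
  proof (cases "i < length la")
    case True
    then have t: "(la @ lc) ! i \<in> solvedA" using nth_mem[OF True] la(1) by (simp add: nth_append)
    have "set (drop i (la @ lc)) \<subseteq> solvedA \<union> solvedC"
      using set_drop_subset[of i "la @ lc"] unfolding set_append la(1) lc(1) .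
    then have "T - (solvedA \<union> solvedC) \<subseteq> T - set (drop i (la @ lc))" by blast
    then show ?thesis using solvedA_polys[OF t] polys_mono by blast
  next
    case False
    then have t: "(la @ lc) ! i \<in> solvedC"
      using nth_mem[of "i - length la" lc] lc(1) i by (simp add: nth_append)
    have "set (drop i (la @ lc)) \<subseteq> solvedC"
      using set_drop_subset[of "i - length la" lc] lc(1) False by simp
    then have "T - solvedC \<subseteq> T - set (drop i (la @ lc))" by blast
    then show ?thesis using solvedC_polys[OF t] polys_mono by blast
  qed
  then have "triangular (T) (la @ lc) den num"
    unfolding triangular_def using la lc solved_coords solved_disjoint by simp
  then show ?thesis using la(1) lc(1) by (intro exI[of _ "la @ lc"]) simp
qed

end

subsection \<open>The number of relations\<close>

lemma card_unordered_pairs: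
  assumes "finite K"
  shows "2 * card {{k, k'} | k k'. k \<in> K \<and> k' \<in> K} = card K * (card K + 1)"
  using assms
proof (induction K rule: finite_induct)
  case (insert z K)
  let ?S = "\<lambda>K. {{k, k'} | k k'. k \<in> K \<and> k' \<in> K}"
  have fin: "finite (?S K)"
    by (rule finite_subset[of _ "(\<lambda>(k, k'). {k, k'}) ` (K \<times> K)"]) (use insert in auto)
  have "?S (insert z K) = ?S K \<union> (\<lambda>k. {z, k}) ` insert z K" by (auto simp: insert_commute)
  moreover have "?S K \<inter> (\<lambda>k. {z, k}) ` insert z K = {}" using insert.hyps by (auto simp: doubleton_eq_iff)
  moreover have "inj_on (\<lambda>k. {z, k}) (insert z K)" by (auto simp: inj_on_def doubleton_eq_iff)
  ultimately have "card (?S (insert z K)) = card (?S K) + Suc (card K)"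
    using insert.hyps fin by (simp add: card_Un_disjoint card_image)
  then show ?case using insert by simp
qed simp

context pivots
begin

lemma card_solvedC:
  "card solvedC = (card C - length rsC) * (card BA * card BF - length rs)"
proof -
  let ?g = "\<lambda>((x, y), c). ({x, c}, y)"
  have "solvedC = ?g ` ((BA \<times> BF - set rs) \<times> (C - set csC))"
  proof (intro equalityI subsetI)
    fix t assume "t \<in> solvedC"
    then obtain x c y where t: "t = ({x, c}, y)" "x \<in> BA" "c \<in> C - set csC" "y \<in> BF" "(x, y) \<notin> set rs"
      unfolding solvedC_def by blast
    then show "t \<in> ?g ` ((BA \<times> BF - set rs) \<times> (C - set csC))"
      by (intro image_eqI[of _ _ "((x, y), c)"]) simp_all
  next
    fix t assume "t \<in> ?g ` ((BA \<times> BF - set rs) \<times> (C - set csC))"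
    then show "t \<in> solvedC" unfolding solvedC_def by auto
  qed
  moreover have "inj_on ?g ((BA \<times> BF - set rs) \<times> (C - set csC))"
    using disj by (auto simp: inj_on_def doubleton_eq_iff)
  ultimately have "card solvedC = card (BA \<times> BF - set rs) * card (C - set csC)"
    by (simp add: card_image card_cartesian_product del: set_append)
  also have "card (BA \<times> BF - set rs) = card BA * card BF - length rs"
    using rs_sub dist fin
    by (subst card_Diff_subset) (auto simp: card_cartesian_product distinct_card simp del: set_append)
  also have "card (C - set csC) = card C - length rsC"
    using sub dist fin len by (subst card_Diff_subset) (auto simp: distinct_card)
  finally show ?thesis by simp
qed

text \<open>The solved coordinates with one element of the pair in the pivot are counted by the non-pivot rows in
  \<open>set csA \<times> BF\<close>, the others by unordered pairs of non-pivot columns.\<close>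
lemma card_solvedA:
  "2 * card solvedA = 2 * ((length rsA * card BF - length rsA) * (card BA - length rsA)) +
     (card BA - length rsA) * (card BA - length rsA + 1) * card BF"
proof -
  let ?K = "BA - set csA"
  let ?g = "\<lambda>((x, y), c). ({x, c}, y)"
  let ?S1 = "?g ` ((set csA \<times> BF - set rsA) \<times> ?K)"
  let ?S2 = "{{k, k'} | k k'. k \<in> ?K \<and> k' \<in> ?K} \<times> BF"
  have rsA: "(x, y) \<in> set rsA \<Longrightarrow> x \<in> set csA" for x y using sub by blast
  have un: "solvedA = ?S1 \<union> ?S2"
  proof (intro equalityI subsetI)
    fix t assume "t \<in> solvedA"
    then obtain x k y where t: "t = ({x, k}, y)" "x \<in> BA" "k \<in> ?K" "y \<in> BF" "(x, y) \<notin> set rsA"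
      unfolding solvedA_def by blast
    show "t \<in> ?S1 \<union> ?S2"
    proof (cases "x \<in> set csA")
      case True
      then have "t = ?g ((x, y), k)" "((x, y), k) \<in> (set csA \<times> BF - set rsA) \<times> ?K" using t by auto
      then show ?thesis by blast
    next
      case False
      then show ?thesis using t by blast
    qed
  next
    fix t assume "t \<in> ?S1 \<union> ?S2"
    then show "t \<in> solvedA"
    proof
      assume "t \<in> ?S1"
      then show ?thesis using sub unfolding solvedA_def by auto
    next
      assume "t \<in> ?S2"
      then show ?thesis unfolding solvedA_def using rsA by blast
    qed
  qed
  have disjoint: "?S1 \<inter> ?S2 = {}" by (auto simp: doubleton_eq_iff)
  have finp: "finite {{k, k'} | k k'. k \<in> ?K \<and> k' \<in> ?K}"
    by (rule finite_subset[of _ "(\<lambda>(k, k'). {k, k'}) ` (?K \<times> ?K)"]) (use fin in auto)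
  have K: "card ?K = card BA - length rsA"
    using sub dist fin len by (subst card_Diff_subset) (auto simp: distinct_card)
  have "card (set csA \<times> BF - set rsA) = length rsA * card BF - length rsA"
    using sub dist fin len by (subst card_Diff_subset) (auto simp: card_cartesian_product distinct_card)
  moreover have "inj_on ?g ((set csA \<times> BF - set rsA) \<times> ?K)"
    by (auto simp: inj_on_def doubleton_eq_iff)
  ultimately have 1: "card ?S1 = (length rsA * card BF - length rsA) * (card BA - length rsA)"
    by (simp add: card_image card_cartesian_product K)
  have 2: "2 * card ?S2 = card ?K * (card ?K + 1) * card BF"
    using card_unordered_pairs[of ?K] fin by (simp add: card_cartesian_product)
  have "card solvedA = card ?S1 + card ?S2"
    unfolding un using disjoint finp fin by (intro card_Un_disjoint) auto
  then have "2 * card solvedA = 2 * card ?S1 + 2 * card ?S2" by simp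
  then show ?thesis unfolding 1 2 K .
qed

end

section \<open>Chains of primes and growth\<close>

text \<open>Exponents are bounded in each variable separately, so that the count is a plain power.\<close>
definition expbox :: "'t set \<Rightarrow> nat \<Rightarrow> ('t \<Rightarrow>\<^sub>0 nat) set" where
  "expbox T u = {m. keys m \<subseteq> T \<and> (\<forall>t. lookup m t < u)}"

definition polybox :: "'t set \<Rightarrow> nat \<Rightarrow> ('t, 'k::field) mpol set" where
  "polybox T u = {q. keys q \<subseteq> expbox T u}"

lemma card_expbox:
  assumes T: "finite T" and u: "0 < u"
  shows "finite (expbox T u)" "card (expbox T u) = u ^ card T"
proof -
  let ?g = "\<lambda>m. restrict (lookup m) T"
  have "bij_betw ?g (expbox T u) (PiE T (\<lambda>_. {..<u}))"
    unfolding bij_betw_def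
  proof
    show "inj_on ?g (expbox T u)"
    proof (rule inj_onI, rule poly_mapping_eqI)
      fix m m' t assume *: "m \<in> expbox T u" "m' \<in> expbox T u" "?g m = ?g m'"
      show "lookup m t = lookup m' t"
      proof (cases "t \<in> T")
        case True
        then show ?thesis using fun_cong[OF *(3), of t] by simp
      next
        case False
        then have "t \<notin> keys m" "t \<notin> keys m'" using * by (auto simp: expbox_def)
        then show ?thesis by (simp add: in_keys_iff)
      qed
    qed
    show "?g ` expbox T u = PiE T (\<lambda>_. {..<u})"
    proof (intro equalityI subsetI)
      fix f assume f: "f \<in> PiE T (\<lambda>_. {..<u})"
      let ?m = "Abs_poly_mapping (\<lambda>t. if t \<in> T then f t else 0)"
      have fin: "finite {t. (if t \<in> T then f t else 0) \<noteq> 0}"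
        by (rule finite_subset[OF _ T]) auto
      have l: "lookup ?m = (\<lambda>t. if t \<in> T then f t else 0)"
        using fin by simp
      have "?m \<in> expbox T u"
        using f u by (auto simp: expbox_def in_keys_iff l split: if_splits)
      moreover have "f = ?g ?m" unfolding l using f by (auto simp: PiE_def extensional_def fun_eq_iff)
      ultimately show "f \<in> ?g ` expbox T u" by (rule image_eqI[rotated])
    qed (auto simp: expbox_def)
  qed
  then show "finite (expbox T u)" "card (expbox T u) = u ^ card T"
    using T by (auto simp: bij_betw_finite bij_betw_same_card card_PiE finite_PiE)
qed

lemma expbox_mono: "u \<le> v \<Longrightarrow> expbox T u \<subseteq> expbox T v"
  by (auto simp: expbox_def intro: less_le_trans)

lemma polybox_mono: "u \<le> v \<Longrightarrow> polybox T u \<subseteq> polybox T v"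
  using expbox_mono[of u v T] by (auto simp: polybox_def)

lemma polybox_add: "p \<in> polybox T u \<Longrightarrow> q \<in> polybox T u \<Longrightarrow> p + q \<in> polybox T u"
  unfolding polybox_def using Poly_Mapping.keys_add[of p q] by blast

lemma polybox_mult:
  assumes "p \<in> polybox T u" "q \<in> polybox T v" shows "p * q \<in> polybox T (u + v)"
  unfolding polybox_def
proof (intro CollectI subsetI)
  fix m assume "m \<in> keys (p * q)"
  with keys_mult[of p q] obtain m1 m2 where m: "m = m1 + m2" "m1 \<in> keys p" "m2 \<in> keys q"
    by blast
  then have "m1 \<in> expbox T u" "m2 \<in> expbox T v" using assms by (auto simp: polybox_def)
  then show "m \<in> expbox T (u + v)"
    using Poly_Mapping.keys_add[of m1 m2] unfolding expbox_def m(1)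
    by (auto simp: lookup_add intro: add_strict_mono)
qed

lemma polybox_const: "mconst c \<in> polybox T 1"
  by (auto simp: polybox_def expbox_def mconst_def)

lemma polybox_exists:
  assumes "q \<in> polys T" shows "\<exists>u. q \<in> polybox T u"
  using assms
proof (induction rule: polys_induct)
  case (const c)
  show ?case using polybox_const by blast
next
  case (var v)
  then have "mvar v \<in> polybox T 2"
    by (auto simp: polybox_def expbox_def mvar_def lookup_single when_def)
  then show ?case ..
next
  case (add a b)
  then obtain u v where "a \<in> polybox T u" "b \<in> polybox T v" by blast
  then have "a + b \<in> polybox T (max u v)"
    using polybox_mono[of u "max u v" T] polybox_mono[of v "max u v" T] by (intro polybox_add) auto
  then show ?case ..
next
  case (mult a b)
  then show ?case using polybox_mult by blast
qed

lemma polybox_power: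
  assumes "f \<in> polybox T s" shows "f ^ j \<in> polybox T (j * s + 1)"
proof (induction j)
  case 0
  then show ?case using polybox_const[of 1 T] by simp
next
  case (Suc j)
  then show ?case using polybox_mult[OF assms Suc] by (simp add: add.assoc)
qed

text \<open>The residue ring modulo \<open>Q\<close> grows at least like \<open>u ^ D\<close>; for a prime \<open>Q\<close> this bounds the transcendence degree of
  that ring from below.\<close>
definition growth :: "'t set \<Rightarrow> ('t, 'k::field) mpol set \<Rightarrow> nat \<Rightarrow> bool" where
  "growth T Q D \<longleftrightarrow> (\<exists>K. \<forall>u>0. \<exists>G. (\<forall>i < u ^ D. G i \<in> polybox T (K * u)) \<and>
     (\<forall>c. (\<Sum>i < u ^ D. mconst (c i) * G i) \<in> Q \<longrightarrow> (\<forall>i < u ^ D. c i = 0)))"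

lemma growth_free:
  assumes T: "finite T" "F \<subseteq> T" and free: "\<And>q. q \<in> polys F \<Longrightarrow> q \<in> Q \<Longrightarrow> q = 0"
  shows "growth T Q (card F)"
  unfolding growth_def
proof (rule exI[of _ "1::nat"], intro allI impI)
  fix u :: nat assume u: "0 < u"
  have F: "finite F" using T finite_subset by blast
  obtain e where e: "bij_betw e {0..<card (expbox F u)} (expbox F u)"
    using ex_bij_betw_nat_finite[OF card_expbox(1)[OF F u]] by blast
  let ?N = "u ^ card F"
  let ?G = "\<lambda>i. single (e i) 1 :: ('a, 'b) mpol"
  have mem: "e i \<in> expbox F u" if "i < ?N" for i
    using bij_betwE[OF e] that by (auto simp: card_expbox[OF F u])
  have inj: "e i = e j \<longleftrightarrow> i = j" if "i < ?N" "j < ?N" for i j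
    using bij_betw_imp_inj_on[OF e] that by (auto simp: card_expbox[OF F u] inj_on_eq_iff)
  show "\<exists>G. (\<forall>i<?N. G i \<in> polybox T (1 * u)) \<and>
    (\<forall>c. (\<Sum>i<?N. mconst (c i) * G i) \<in> Q \<longrightarrow> (\<forall>i<?N. c i = 0))"
  proof (intro exI[of _ ?G] conjI allI impI)
    fix i assume "i < ?N"
    then show "?G i \<in> polybox T (1 * u)" using mem[of i] T by (auto simp: polybox_def expbox_def)
  next
    fix c i assume *: "(\<Sum>i<?N. mconst (c i) * ?G i) \<in> Q" and i: "i < ?N"
    have eq: "(\<Sum>i<?N. mconst (c i) * ?G i) = (\<Sum>i<?N. single (e i) (c i))"
      by (simp add: mconst_def mult_single)
    have "(\<Sum>i<?N. mconst (c i) * ?G i) \<in> polys F"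
      unfolding eq using mem by (intro polys_sum polys_single) (auto simp: expbox_def)
    from free[OF this *] have "0 = lookup (\<Sum>i<?N. single (e i) (c i)) (e i)"
      unfolding eq by simp
    also have "\<dots> = (\<Sum>j<?N. if j = i then c j else 0)"
      unfolding lookup_sum by (intro sum.cong) (use i inj in \<open>auto simp: lookup_single when_def\<close>)
    also have "\<dots> = c i" using i by simp
    finally show "c i = 0" by simp
  qed
qed

text \<open>Let \<open>G\<close> be independent modulo \<open>Q'\<close>.  Then the products \<open>f ^ j * G i\<close> are independent modulo \<open>Q\<close>: reduce a relation
  modulo \<open>Q'\<close>, where \<open>f\<close> is 0, to remove the terms with \<open>j = 0\<close>, divide by \<open>f\<close>, which is allowed modulo the prime \<open>Q\<close>,
  and repeat.  Allowing \<open>u\<close> powers of \<open>f\<close> gains one factor \<open>u\<close> at the price of larger boxes of linear size.\<close>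
lemma growth_step:
  assumes Q: "prime_set Q" and Q': "prime_set Q'" "Q \<subseteq> Q'" and f: "f \<in> Q'" "f \<notin> Q" "f \<in> polys T"
    and gr: "growth T Q' D"
  shows "growth T Q (Suc D)"
proof -
  interpret Q': saturated_ideal Q' Q' by (rule prime_set_saturated[OF Q'(1)])
  have Q_mult: "a \<in> Q \<or> b \<in> Q" if "a * b \<in> Q" for a b using Q that by (auto simp: prime_set_def)
  from gr obtain K where K: "\<forall>u>0. \<exists>G. (\<forall>i < u ^ D. G i \<in> polybox T (K * u)) \<and>
     (\<forall>c. (\<Sum>i < u ^ D. mconst (c i) * G i) \<in> Q' \<longrightarrow> (\<forall>i < u ^ D. c i = 0))"
    unfolding growth_def by blast
  obtain s where s: "f \<in> polybox T s" using polybox_exists[OF f(3)] by blast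
  show ?thesis unfolding growth_def
  \<comment> \<open>The power \<open>f ^ j\<close> lies in a box of size \<open>j * s + 1\<close>, and \<open>j < u\<close>.\<close>
  proof (rule exI[of _ "K + s + 1"], intro allI impI)
    fix u :: nat assume u: "0 < u"
    define w where "w = u ^ D"
    have w: "0 < w" using u by (simp add: w_def)
    from K u obtain G where G: "\<forall>i < w. G i \<in> polybox T (K * u)"
      and ind: "\<forall>c. (\<Sum>i < w. mconst (c i) * G i) \<in> Q' \<longrightarrow> (\<forall>i < w. c i = 0)"
      unfolding w_def by blast
    have main: "\<forall>c. (\<Sum>j<U. f ^ j * (\<Sum>i<w. mconst (c j i) * G i)) \<in> Q \<longrightarrow> (\<forall>j<U. \<forall>i<w. c j i = 0)" for U
    proof (induction U)
      case (Suc U)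
      show ?case
      proof (intro allI impI)
        fix c j i assume *: "(\<Sum>j<Suc U. f ^ j * (\<Sum>i<w. mconst (c j i) * G i)) \<in> Q"
          and j: "j < Suc U" and i: "i < w"
        let ?p = "\<lambda>j. \<Sum>i<w. mconst (c j i) * G i"
        let ?R = "\<Sum>j<U. f ^ j * ?p (Suc j)"
        have eq: "(\<Sum>j<Suc U. f ^ j * ?p j) = ?p 0 + f * ?R"
          by (subst sum.lessThan_Suc_shift) (simp add: sum_distrib_left mult.assoc)
        have "?p 0 + f * ?R \<in> Q'" using * Q'(2) eq by auto
        moreover have "?R * f \<in> Q'" using f(1) by (rule ring_module.subspace_scale[OF Q'.ideal])
        ultimately have "?p 0 + f * ?R - ?R * f \<in> Q'" by (rule ring_module.subspace_diff[OF Q'.ideal])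
        then have "?p 0 \<in> Q'" by (simp add: mult.commute)
        then have c0: "\<forall>i<w. c 0 i = 0" using ind by blast
        then have "?p 0 = 0" by simp
        then have "f * ?R \<in> Q" using * eq by simp
        then have "?R \<in> Q" using Q_mult f(2) by blast
        then have "\<forall>j<U. \<forall>i<w. c (Suc j) i = 0"
          using Suc.IH[rule_format, of "\<lambda>j. c (Suc j)"] by blast
        then show "c j i = 0" using c0 i j by (cases j) auto
      qed
    qed simp
    let ?G = "\<lambda>i. f ^ (i div w) * G (i mod w)"
    show "\<exists>G. (\<forall>i<u ^ Suc D. G i \<in> polybox T ((K + s + 1) * u)) \<and>
      (\<forall>c. (\<Sum>i<u ^ Suc D. mconst (c i) * G i) \<in> Q \<longrightarrow> (\<forall>i<u ^ Suc D. c i = 0))"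
    proof (intro exI[of _ ?G] conjI allI impI)
      fix i assume "i < u ^ Suc D"
      then have i: "i div w < u" "i mod w < w" using w by (auto simp: w_def less_mult_imp_div_less)
      then have "Suc (i div w) * (s + 1) \<le> u * (s + 1)" by (intro mult_right_mono) auto
      then have "(i div w * s + 1) + K * u \<le> (K + s + 1) * u" by (simp add: algebra_simps)
      moreover have "?G i \<in> polybox T ((i div w * s + 1) + K * u)"
        using i G polybox_mult[OF polybox_power[OF s]] by blast
      ultimately show "?G i \<in> polybox T ((K + s + 1) * u)" using polybox_mono by blast
    next
      fix c i assume *: "(\<Sum>i<u ^ Suc D. mconst (c i) * ?G i) \<in> Q" and i: "i < u ^ Suc D"
      have "(\<Sum>i<u ^ Suc D. mconst (c i) * ?G i) = (\<Sum>j<u. \<Sum>i\<in>{j * w..<j * w + w}. mconst (c i) * ?G i)"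
        by (simp add: sum.nat_group w_def)
      also have "\<dots> = (\<Sum>j<u. f ^ j * (\<Sum>i<w. mconst (c (j * w + i)) * G i))"
      proof (intro sum.cong refl)
        fix j
        have "(\<Sum>i\<in>{j * w..<j * w + w}. mconst (c i) * ?G i) = (\<Sum>i<w. mconst (c (j * w + i)) * ?G (j * w + i))"
          using sum.shift_bounds_nat_ivl[of "\<lambda>i. mconst (c i) * ?G i" 0 "j * w" w]
          by (simp add: lessThan_atLeast0 add.commute)
        also have "\<dots> = f ^ j * (\<Sum>i<w. mconst (c (j * w + i)) * G i)"
          unfolding sum_distrib_left by (intro sum.cong) (auto simp: mult_ac)
        finally show "(\<Sum>i\<in>{j * w..<j * w + w}. mconst (c i) * ?G i) = f ^ j * (\<Sum>i<w. mconst (c (j * w + i)) * G i)" .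
      qed
      finally have "\<forall>j<u. \<forall>i<w. c (j * w + i) = 0"
        using main[rule_format, of "\<lambda>j i. c (j * w + i)" u] * by auto
      moreover have "i div w < u" "i mod w < w" using i w by (auto simp: w_def less_mult_imp_div_less)
      ultimately have "c (i div w * w + i mod w) = 0" by blast
      then show "c i = 0" by simp
    qed
  qed
qed

lemma mconst_uminus: "mconst (- c) = - mconst c"
  by (simp add: mconst_def single_uminus)

lemma mpol_vector_space: "vector_space (\<lambda>c (q :: ('t, 'k::field) mpol). mconst c * q)"
  by standard (auto simp: mconst_add mconst_mult algebra_simps)

text \<open>A box of size \<open>K * u\<close> spans a space of dimension \<open>(K * u) ^ card T\<close> only, which is below \<open>u ^ D\<close> for large \<open>u\<close> if
  \<open>D\<close> exceeds \<open>card T\<close>.\<close>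
lemma growth_le_card:
  fixes Q :: "('t, 'k::field) mpol set"
  assumes T: "finite T" and Q: "0 \<in> Q" and gr: "growth T Q D"
  shows "D \<le> card T"
proof (rule ccontr)
  assume D: "\<not> D \<le> card T"
  interpret vs: vector_space "\<lambda>c (q :: ('t, 'k) mpol). mconst c * q" by (rule mpol_vector_space)
  from gr obtain K where K: "\<And>u. 0 < u \<Longrightarrow> \<exists>G::nat \<Rightarrow> ('t, 'k) mpol. (\<forall>i < u ^ D. G i \<in> polybox T (K * u)) \<and>
     (\<forall>c. (\<Sum>i < u ^ D. mconst (c i) * G i) \<in> Q \<longrightarrow> (\<forall>i < u ^ D. c i = 0))"
    unfolding growth_def by blast
  have bound: "u ^ D \<le> (Suc K * u) ^ card T" if u: "0 < u" for u
  proof -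
    let ?N = "u ^ D"
    from K[OF u] obtain G :: "nat \<Rightarrow> ('t, 'k) mpol" where G: "\<And>i. i < ?N \<Longrightarrow> G i \<in> polybox T (K * u)"
      and ind: "\<And>c i. (\<Sum>i < ?N. mconst (c i) * G i) \<in> Q \<Longrightarrow> i < ?N \<Longrightarrow> c i = 0" by blast
    have inj: "inj_on G {..<?N}"
    proof (rule inj_onI, rule ccontr)
      fix i j assume ij: "i \<in> {..<?N}" "j \<in> {..<?N}" "G i = G j" "i \<noteq> j"
      let ?c = "\<lambda>l. if l = i then 1 else if l = j then - 1 else 0 :: 'k"
      have "(\<Sum>l<?N. mconst (?c l) * G l) = (\<Sum>l<?N. (if l = i then G i else 0) - (if l = j then G j else 0))"
        by (intro sum.cong refl) (use ij in \<open>auto simp: mconst_uminus\<close>)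
      also have "\<dots> = 0" using ij by (simp add: sum_subtractf)
      finally show False using ind[of ?c i] Q ij by simp
    qed
    let ?B = "(\<lambda>m. single m 1 :: ('t, 'k) mpol) ` expbox T (Suc K * u)"
    have fin: "finite (expbox T (Suc K * u))" "card (expbox T (Suc K * u)) = (Suc K * u) ^ card T"
      using card_expbox[OF T, of "Suc K * u"] u by simp_all
    have "G ` {..<?N} \<subseteq> vs.span ?B"
    proof (rule image_subsetI)
      fix i assume i: "i \<in> {..<?N}"
      have "keys (G i) \<subseteq> expbox T (Suc K * u)"
        using G[of i] i expbox_mono[of "K * u" "Suc K * u" T] by (auto simp: polybox_def)
      then have "mconst (lookup (G i) m) * single m 1 \<in> vs.span ?B"
        if "m \<in> keys (G i)" for m
        using that by (intro vs.span_scale vs.span_base) auto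
      then have "(\<Sum>m\<in>keys (G i). mconst (lookup (G i) m) * single m 1) \<in> vs.span ?B"
        by (intro vs.span_sum)
      then show "G i \<in> vs.span ?B"
        using mpol_sum_single[of "G i"] by (simp add: mconst_def mult_single)
    qed
    moreover have "vs.independent (G ` {..<?N})"
    proof
      assume "vs.dependent (G ` {..<?N})"
      then obtain c v where c: "v \<in> G ` {..<?N}" "c v \<noteq> 0" "(\<Sum>v\<in>G ` {..<?N}. mconst (c v) * v) = 0"
        by (subst (asm) vs.dependent_finite) auto
      have "(\<Sum>i<?N. mconst (c (G i)) * G i) = 0" using c(3) inj by (simp add: sum.reindex)
      then show False using ind[of "\<lambda>i. c (G i)"] c(1,2) Q by auto
    qed
    ultimately have "card (G ` {..<?N}) \<le> card ?B"
      using vs.independent_span_bound[of ?B] fin by auto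
    also have "\<dots> \<le> (Suc K * u) ^ card T" using card_image_le[OF fin(1)] fin(2) by metis
    finally show ?thesis using inj by (simp add: card_image)
  qed
  \<comment> \<open>For \<open>D > card T\<close> the bound gives \<open>u \<le> Suc K ^ card T\<close>, which fails for the next number.\<close>
  define u where "u = Suc (Suc K ^ card T)"
  have "u ^ Suc (card T) \<le> u ^ D" using D by (intro power_increasing) (auto simp: u_def)
  also have "\<dots> \<le> (Suc K * u) ^ card T" by (rule bound) (simp add: u_def)
  also have "\<dots> = Suc K ^ card T * u ^ card T" by (rule power_mult_distrib)
  finally have "u * u ^ card T \<le> Suc K ^ card T * u ^ card T" by simp
  then have "u \<le> Suc K ^ card T" by (simp add: u_def)
  then show False by (simp add: u_def)
qed

text \<open>The growth modulo the top prime is at least \<open>card F\<close>, and each step down the chain adds 1.\<close>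
lemma prime_chain_bound:
  fixes Q :: "nat \<Rightarrow> ('t, 'k::field) mpol set"
  assumes T: "finite T" "F \<subseteq> T"
    and Q: "\<And>j. j \<le> m \<Longrightarrow> prime_set (Q j)"
    and chain: "\<And>j. j < m \<Longrightarrow> Q j \<subseteq> Q (Suc j) \<and> (\<exists>f \<in> polys T. f \<in> Q (Suc j) \<and> f \<notin> Q j)"
    and free: "\<And>q. q \<in> polys F \<Longrightarrow> q \<in> Q m \<Longrightarrow> q = 0"
  shows "m + card F \<le> card T"
proof -
  have "growth T (Q (m - j)) (card F + j)" if "j \<le> m" for j
    using that
  proof (induction j)
    case 0
    show ?case using growth_free[OF T free] by simp
  next
    case (Suc j)
    let ?j = "m - Suc j"
    have s: "Suc ?j = m - j" "?j < m" using Suc by auto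
    from chain[OF s(2)] obtain f where "Q ?j \<subseteq> Q (m - j)" "f \<in> polys T" "f \<in> Q (m - j)" "f \<notin> Q ?j"
      using s(1) by auto
    then have "growth T (Q ?j) (Suc (card F + j))"
      using growth_step[of "Q ?j" "Q (m - j)" f T "card F + j"] Q Suc by auto
    then show ?case by simp
  qed
  from this[of m] have "growth T (Q 0) (card F + m)" by simp
  moreover have "0 \<in> Q 0" using Q[of 0] ring_module.subspace_0 by (auto simp: prime_set_def)
  ultimately show ?thesis using growth_le_card[OF T(1)] by fastforce
qed

section \<open>Generic points of graphs\<close>

text \<open>Substitute \<open>r / d\<close> for the variable \<open>s\<close> and clear denominators.\<close>
lemma eliminate_variable:
  assumes d: "d \<in> polys (T - {s})" and r: "r \<in> polys (T - {s})" and q: "q \<in> polys T"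
  shows "\<exists>m w. \<exists>q' \<in> polys (T - {s}). d ^ m * q = q' + w * (d * mvar s - r)" (is "\<exists>m w. \<exists>q' \<in> _. _ = _ + w * ?g")
  using q
proof (induction rule: polys_induct)
  case (const c)
  show ?case by (rule exI[of _ 0], rule exI[of _ 0], rule bexI[of _ "mconst c"]) auto
next
  case (var v)
  show ?case
  proof (cases "v = s")
    case True
    show ?thesis
      by (rule exI[of _ 1], rule exI[of _ 1], rule bexI[of _ r]) (use True r in auto)
  next
    case False
    show ?thesis
      by (rule exI[of _ 0], rule exI[of _ 0], rule bexI[of _ "mvar v"]) (use False var in auto)
  qed
next
  case (add a b)
  then obtain m1 w1 q1 m2 w2 q2 where q: "q1 \<in> polys (T - {s})" "q2 \<in> polys (T - {s})"
    and e: "d ^ m1 * a = q1 + w1 * ?g" "d ^ m2 * b = q2 + w2 * ?g" by blast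
  have "d ^ (m1 + m2) * (a + b) = d ^ m2 * (d ^ m1 * a) + d ^ m1 * (d ^ m2 * b)"
    by (simp add: power_add algebra_simps)
  also have "\<dots> = (d ^ m2 * q1 + d ^ m1 * q2) + (d ^ m2 * w1 + d ^ m1 * w2) * ?g"
    unfolding e by (simp add: algebra_simps)
  finally have "d ^ (m1 + m2) * (a + b) =
    (d ^ m2 * q1 + d ^ m1 * q2) + (d ^ m2 * w1 + d ^ m1 * w2) * ?g" .
  moreover have "d ^ m2 * q1 + d ^ m1 * q2 \<in> polys (T - {s})" using q d by (intro polys_add polys_mult polys_power)
  ultimately show ?case by blast
next
  case (mult a b)
  then obtain m1 w1 q1 m2 w2 q2 where q: "q1 \<in> polys (T - {s})" "q2 \<in> polys (T - {s})"
    and e: "d ^ m1 * a = q1 + w1 * ?g" "d ^ m2 * b = q2 + w2 * ?g" by blast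
  have "d ^ (m1 + m2) * (a * b) = (d ^ m1 * a) * (d ^ m2 * b)"
    by (simp add: power_add algebra_simps)
  also have "\<dots> = q1 * q2 + (q1 * w2 + w1 * q2 + w1 * w2 * ?g) * ?g"
    unfolding e by (simp add: algebra_simps)
  finally have "d ^ (m1 + m2) * (a * b) =
    q1 * q2 + (q1 * w2 + w1 * q2 + w1 * w2 * ?g) * ?g" .
  moreover have "q1 * q2 \<in> polys (T - {s})" using q by (rule polys_mult)
  ultimately show ?case by blast
qed

definition vanishing :: "('k::field \<Rightarrow> 'r::comm_ring_1) \<Rightarrow> ('t \<Rightarrow> 'r) \<Rightarrow> ('t, 'k) mpol set" where
  "vanishing \<kappa> \<theta> = {q. meval \<kappa> \<theta> q = 0}"

text \<open>The coordinates of \<open>\<theta>\<close> in \<open>U\<close> satisfy no algebraic relations over the other coordinates: what vanishes at \<open>\<theta>\<close>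
  vanishes for all values of the variables in \<open>U\<close>.\<close>
definition generic_in :: "('k::field \<Rightarrow> 'r::comm_ring_1) \<Rightarrow> 't set \<Rightarrow> 't set \<Rightarrow> ('t \<Rightarrow> 'r) \<Rightarrow> bool" where
  "generic_in \<kappa> T U \<theta> \<longleftrightarrow> (\<forall>q \<in> polys T. q \<in> vanishing \<kappa> \<theta> \<longrightarrow>
     (\<forall>\<theta>'. (\<forall>t. t \<notin> U \<longrightarrow> \<theta>' t = \<theta> t) \<longrightarrow> q \<in> vanishing \<kappa> \<theta>'))"

context
  fixes \<kappa> :: "'k::field \<Rightarrow> 'r::field"
  assumes \<kappa>: "comm_ring_hom \<kappa>"
begin

lemma vanishing_prime: "prime_set (vanishing \<kappa> \<theta>)"
proof -
  interpret comm_ring_hom "meval \<kappa> \<theta>" by (rule meval_hom[OF \<kappa>])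
  show ?thesis
    by (auto simp: prime_set_def vanishing_def ring_module.subspace_def hom_add hom_mult)
qed

text \<open>One variable \<open>s\<close> of a generic point is specialised to the value that solves \<open>d * s = r\<close>.  The other variables of
  \<open>U\<close> stay generic, and the last part says that, up to powers of \<open>d\<close>, the vanishing ideal grows by this one relation.\<close>
lemma generic_step:
  assumes s: "s \<in> U" "U \<subseteq> T" and d: "d \<in> polys (T - U)" and r: "r \<in> polys (T - U)"
    and d0: "d \<notin> vanishing \<kappa> \<theta>" and gen: "generic_in \<kappa> T U \<theta>"
  defines "\<theta>' \<equiv> \<theta>(s := meval \<kappa> \<theta> r / meval \<kappa> \<theta> d)"
  shows "generic_in \<kappa> T (U - {s}) \<theta>'"
    and "q \<in> polys T \<Longrightarrow> q \<in> vanishing \<kappa> \<theta> \<Longrightarrow> q \<in> vanishing \<kappa> \<theta>'"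
    and "d * mvar s - r \<in> vanishing \<kappa> \<theta>'" "d * mvar s - r \<notin> vanishing \<kappa> \<theta>"
    and "q \<in> polys T \<Longrightarrow> q \<in> vanishing \<kappa> \<theta>' \<Longrightarrow>
      \<exists>m w. \<exists>q'\<in>polys T. d ^ m * q = q' + w * (d * mvar s - r) \<and> q' \<in> vanishing \<kappa> \<theta>"
proof -
  interpret h: comm_ring_hom "meval \<kappa> \<phi>" for \<phi> by (rule meval_hom[OF \<kappa>])
  have dn: "meval \<kappa> \<theta> d \<noteq> 0" using d0 by (simp add: vanishing_def)
  have d': "d \<in> polys (T - {s})" and r': "r \<in> polys (T - {s})"
    using d r s polys_mono[of "T - U" "T - {s}"] by blast+
  have off: "meval \<kappa> \<phi> x = meval \<kappa> \<theta> x" if "x \<in> polys (T - U)" "\<forall>t. t \<notin> U \<longrightarrow> \<phi> t = \<theta> t" for x \<phi>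
    using that by (intro meval_cong[OF \<kappa>, of x "T - U"]) auto
  have rel: "meval \<kappa> \<phi> (d * mvar s - r) = meval \<kappa> \<theta> d * \<phi> s - meval \<kappa> \<theta> r" if "\<forall>t. t \<notin> U \<longrightarrow> \<phi> t = \<theta> t" for \<phi>
    using off[OF d that] off[OF r that] by (simp add: h.hom_minus h.hom_mult meval_var[OF \<kappa>])
  show g: "d * mvar s - r \<in> vanishing \<kappa> \<theta>'"
    using s dn by (auto simp: vanishing_def rel \<theta>'_def)
  show "d * mvar s - r \<notin> vanishing \<kappa> \<theta>"
  proof
    assume "d * mvar s - r \<in> vanishing \<kappa> \<theta>"
    moreover have "d * mvar s - r \<in> polys T"
      using d r s polys_mono[of "T - U" T] by (intro polys_diff polys_mult polys_var) auto
    ultimately have "d * mvar s - r \<in> vanishing \<kappa> (\<theta>(s := z))" for z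
      using gen s unfolding generic_in_def by (metis fun_upd_apply)
    then have *: "meval \<kappa> \<theta> d * z - meval \<kappa> \<theta> r = 0" for z
      using rel[of "\<theta>(s := z)"] s by (auto simp: vanishing_def)
    \<comment> \<open>A linear equation with leading coefficient \<open>d \<noteq> 0\<close> cannot hold for two values of \<open>z\<close>.\<close>
    show False using *[of 0] *[of 1] dn by simp
  qed
  show elim: "\<exists>m w. \<exists>q'\<in>polys T. d ^ m * q = q' + w * (d * mvar s - r) \<and> q' \<in> vanishing \<kappa> \<theta>"
    if q: "q \<in> polys T" "q \<in> vanishing \<kappa> \<theta>'" for q
  proof -
    from eliminate_variable[OF d' r' q(1)] obtain m w q' where
      e: "d ^ m * q = q' + w * (d * mvar s - r)" and q': "q' \<in> polys (T - {s})" by blast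
    have "meval \<kappa> \<theta>' (d ^ m * q) = 0" using q(2) by (simp add: vanishing_def h.hom_mult)
    then have "meval \<kappa> \<theta>' q' = 0"
      unfolding e using g by (simp add: vanishing_def h.hom_mult h.hom_add)
    moreover have "meval \<kappa> \<theta>' q' = meval \<kappa> \<theta> q'"
      by (rule meval_cong[OF \<kappa> q']) (auto simp: \<theta>'_def)
    ultimately have "q' \<in> vanishing \<kappa> \<theta>" by (simp add: vanishing_def)
    moreover have "q' \<in> polys T" using q' polys_mono[of "T - {s}" T] by blast
    ultimately show ?thesis using e by blast
  qed
  show "generic_in \<kappa> T (U - {s}) \<theta>'"
    unfolding generic_in_def
  proof (intro ballI impI allI)
    fix q \<phi> assume q: "q \<in> polys T" "q \<in> vanishing \<kappa> \<theta>'" and \<phi>: "\<forall>t. t \<notin> U - {s} \<longrightarrow> \<phi> t = \<theta>' t"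
    have \<phi>U: "\<forall>t. t \<notin> U \<longrightarrow> \<phi> t = \<theta> t" using \<phi> s by (auto simp: \<theta>'_def)
    have \<phi>s: "\<phi> s = meval \<kappa> \<theta> r / meval \<kappa> \<theta> d" using \<phi> by (simp add: \<theta>'_def)
    from elim[OF q] obtain m w q' where e: "d ^ m * q = q' + w * (d * mvar s - r)"
      and q': "q' \<in> polys T" "q' \<in> vanishing \<kappa> \<theta>" by blast
    have "q' \<in> vanishing \<kappa> \<phi>" using gen q' \<phi>U unfolding generic_in_def by blast
    moreover have "meval \<kappa> \<phi> (d * mvar s - r) = 0" using rel[OF \<phi>U] \<phi>s dn by simp
    ultimately have "meval \<kappa> \<phi> (d ^ m * q) = 0"
      unfolding e by (simp add: vanishing_def h.hom_mult h.hom_add)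
    then have "meval \<kappa> \<theta> d ^ m * meval \<kappa> \<phi> q = 0"
      using off[OF d \<phi>U] by (simp add: h.hom_mult h.hom_power)
    then show "q \<in> vanishing \<kappa> \<phi>" using dn by (simp add: vanishing_def)
  qed
  show "q \<in> vanishing \<kappa> \<theta>'" if "q \<in> polys T" "q \<in> vanishing \<kappa> \<theta>"
    using gen that s unfolding generic_in_def \<theta>'_def by (metis fun_upd_apply)
qed

primrec graph_point :: "('t \<Rightarrow> ('t, 'k) mpol) \<Rightarrow> ('t \<Rightarrow> ('t, 'k) mpol) \<Rightarrow> 't list \<Rightarrow> ('t \<Rightarrow> 'r) \<Rightarrow> nat \<Rightarrow> 't \<Rightarrow> 'r" where
  "graph_point den num xs \<theta> 0 = \<theta>"
| "graph_point den num xs \<theta> (Suc i) = (graph_point den num xs \<theta> i)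
     (xs ! i := meval \<kappa> (graph_point den num xs \<theta> i) (num (xs ! i)) / meval \<kappa> (graph_point den num xs \<theta> i) (den (xs ! i)))"

text \<open>Along the chain, the vanishing ideals remain inside \<open>P\<close>: each relation lies in \<open>P\<close> and the denominators do not.
  For the same reason the denominators do not vanish at the points constructed so far, so the next step is possible.\<close>
lemma generic_chain:
  fixes P :: "('t, 'k) mpol set"
  assumes tri: "triangular T xs den num" and P: "prime_set P"
    and rel: "\<forall>t\<in>set xs. den t \<notin> P \<and> den t * mvar t - num t \<in> P"
    and free: "\<forall>q\<in>polys T. q \<in> vanishing \<kappa> \<theta> \<longrightarrow> q = 0"
  shows "\<exists>Q. (\<forall>j \<le> length xs. prime_set (Q j)) \<and>
    (\<forall>j < length xs. Q j \<inter> polys T \<subseteq> Q (Suc j) \<and> (\<exists>f\<in>polys T. f \<in> Q (Suc j) \<and> f \<notin> Q j)) \<and>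
    Q (length xs) \<inter> polys T \<subseteq> P \<and>
    (\<forall>q\<in>polys (T - set xs). q \<in> Q (length xs) \<longrightarrow> q = 0) \<and>
    (\<forall>t\<in>set xs. den t * mvar t - num t \<in> Q (length xs))"
proof -
  interpret P: saturated_ideal P P by (rule prime_set_saturated[OF P])
  let ?\<theta> = "graph_point den num xs \<theta>"
  let ?V = "\<lambda>i. vanishing \<kappa> (?\<theta> i)"
  let ?g = "\<lambda>t. den t * mvar t - num t"
  from tri have dist: "distinct xs" and sub: "set xs \<subseteq> T"
    and dn: "\<And>i. i < length xs \<Longrightarrow> den (xs ! i) \<in> polys (T - set (drop i xs))"
      "\<And>i. i < length xs \<Longrightarrow> num (xs ! i) \<in> polys (T - set (drop i xs))"
    by (auto simp: triangular_def)
  have U: "xs ! i \<in> set (drop i xs)" "set (drop i xs) \<subseteq> T"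
    "set (drop i xs) - {xs ! i} = set (drop (Suc i) xs)" if i: "i < length xs" for i
  proof -
    have dr: "drop i xs = xs ! i # drop (Suc i) xs" using i by (simp add: Cons_nth_drop_Suc)
    have "distinct (drop i xs)" using dist by simp
    then show "xs ! i \<in> set (drop i xs)" "set (drop i xs) - {xs ! i} = set (drop (Suc i) xs)"
      unfolding dr by auto
    show "set (drop i xs) \<subseteq> T" using set_drop_subset[of i xs] sub by blast
  qed
  have gT: "?g (xs ! i) \<in> polys T" if i: "i < length xs" for i
    using dn[OF i] polys_mono[of "T - set (drop i xs)" T] sub nth_mem[OF i]
    by (intro polys_diff polys_mult polys_var) auto
  have inv: "generic_in \<kappa> T (set (drop i xs)) (?\<theta> i) \<and> ?V i \<inter> polys T \<subseteq> P \<and>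
    (\<forall>t. t \<notin> set (take i xs) \<longrightarrow> ?\<theta> i t = \<theta> t)" if "i \<le> length xs" for i
    using that
  proof (induction i)
    case 0
    have z: "0 \<in> vanishing \<kappa> \<phi>" for \<phi> :: "'t \<Rightarrow> 'r" by (simp add: vanishing_def meval_def)
    have "generic_in \<kappa> T (set xs) \<theta>" unfolding generic_in_def using free z by blast
    moreover have "vanishing \<kappa> \<theta> \<inter> polys T \<subseteq> P" using free ring_module.subspace_0[OF P.ideal] by blast
    ultimately show ?case by simp
  next
    case (Suc i)
    then have i: "i < length xs" by simp
    from Suc have IH: "generic_in \<kappa> T (set (drop i xs)) (?\<theta> i)" "?V i \<inter> polys T \<subseteq> P"
      "\<forall>t. t \<notin> set (take i xs) \<longrightarrow> ?\<theta> i t = \<theta> t" by auto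
    have r: "den (xs ! i) \<notin> P" "?g (xs ! i) \<in> P" using bspec[OF rel nth_mem[OF i]] by auto
    have "den (xs ! i) \<in> polys T" using dn(1)[OF i] polys_mono[of "T - set (drop i xs)" T] by blast
    then have d0: "den (xs ! i) \<notin> ?V i" using IH(2) r by blast
    note step = generic_step[OF U(1,2)[OF i] dn[OF i] d0 IH(1)]
    have "generic_in \<kappa> T (set (drop (Suc i) xs)) (?\<theta> (Suc i))"
      using step(1) U(3)[OF i] by simp
    moreover have "?V (Suc i) \<inter> polys T \<subseteq> P"
    proof
      fix q assume "q \<in> ?V (Suc i) \<inter> polys T"
      then obtain m w q' where e: "den (xs ! i) ^ m * q = q' + w * ?g (xs ! i)"
        and q': "q' \<in> polys T" "q' \<in> ?V i" using step(5)[of q] by auto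
      have "q' \<in> P" using q' IH(2) by blast
      then have "q' + w * ?g (xs ! i) \<in> P"
        by (rule ring_module.subspace_add[OF P.ideal _ ring_module.subspace_scale[OF P.ideal r(2)]])
      then have "den (xs ! i) ^ m * q \<in> P" using e by simp
      then show "q \<in> P" using P.saturated P.power_notin[OF r(1)] by blast
    qed
    moreover have "\<forall>t. t \<notin> set (take (Suc i) xs) \<longrightarrow> ?\<theta> (Suc i) t = \<theta> t"
      using IH(3) i by (auto simp: take_Suc_conv_app_nth)
    ultimately show ?case by blast
  qed
  have chain: "?V i \<inter> polys T \<subseteq> ?V (Suc i) \<and> ?g (xs ! i) \<in> ?V (Suc i) \<and> ?g (xs ! i) \<notin> ?V i"
    if i: "i < length xs" for i
  proof -
    have IH: "generic_in \<kappa> T (set (drop i xs)) (?\<theta> i)" "?V i \<inter> polys T \<subseteq> P" using inv[of i] i by auto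
    have "den (xs ! i) \<in> polys T" using dn(1)[OF i] polys_mono[of "T - set (drop i xs)" T] by blast
    then have d0: "den (xs ! i) \<notin> ?V i" using IH(2) bspec[OF rel nth_mem[OF i]] by blast
    note step = generic_step[OF U(1,2)[OF i] dn[OF i] d0 IH(1)]
    show ?thesis using step(2,3,4) by auto
  qed
  have up: "?V i \<inter> polys T \<subseteq> ?V (i + j)" if "i + j \<le> length xs" for i j
    using that
  proof (induction j)
    case (Suc j)
    then have "?V i \<inter> polys T \<subseteq> ?V (i + j)" by simp
    moreover have "?V (i + j) \<inter> polys T \<subseteq> ?V (Suc (i + j))" using chain[of "i + j"] Suc by simp
    ultimately show ?case unfolding add_Suc_right by blast
  qed simp
  have "?g t \<in> ?V (length xs)" if t: "t \<in> set xs" for t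
  proof -
    obtain i where i: "i < length xs" "t = xs ! i" using t by (auto simp: in_set_conv_nth)
    have mem: "?g t \<in> ?V (Suc i) \<inter> polys T" using chain[OF i(1)] gT[OF i(1)] i(2) by blast
    have l: "Suc i + (length xs - Suc i) = length xs" using i(1) by simp
    have "?V (Suc i) \<inter> polys T \<subseteq> ?V (Suc i + (length xs - Suc i))"
      by (rule up) (use i(1) in simp)
    then show ?thesis using mem unfolding l by blast
  qed
  moreover have "q = 0" if q: "q \<in> polys (T - set xs)" "q \<in> ?V (length xs)" for q
  proof -
    have "meval \<kappa> (?\<theta> (length xs)) q = meval \<kappa> \<theta> q"
      by (rule meval_cong[OF \<kappa> q(1)]) (use inv[of "length xs"] in auto)
    then have "q \<in> vanishing \<kappa> \<theta>" using q(2) by (simp add: vanishing_def)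
    then show ?thesis using free polys_mono[of "T - set xs" T] q(1) by blast
  qed
  moreover have "?V (length xs) \<inter> polys T \<subseteq> P" using inv[of "length xs"] by simp
  moreover have "\<exists>f\<in>polys T. f \<in> ?V (Suc j) \<and> f \<notin> ?V j" if "j < length xs" for j
    by (rule bexI[of _ "?g (xs ! j)"]) (use chain[OF that] gT[OF that] in blast)+
  ultimately show ?thesis
    by (intro exI[of _ ?V] conjI allI impI ballI vanishing_prime) (use chain in blast)+
qed

end

definition frac_const :: "'k::field \<Rightarrow> (nat, 'k) mpol fract" where
  "frac_const c = Fract (mconst c) 1"

lemma frac_hom: "comm_ring_hom (\<lambda>x :: 'a::idom. Fract x 1)"
  by standard (auto simp: Zero_fract_def One_fract_def)

lemma frac_const_hom: "comm_ring_hom (frac_const :: 'k::field \<Rightarrow> _)"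
  using comm_ring_hom_comp[OF frac_hom mconst_hom] by (simp add: frac_const_def[abs_def])

text \<open>The variables are renamed to natural numbers, whose order makes the polynomials a domain with a field of
  fractions.\<close>
lemma free_point_exists:
  assumes "finite T"
  shows "\<exists>\<theta> :: 't \<Rightarrow> (nat, 'k::field) mpol fract. \<forall>q\<in>polys T. q \<in> vanishing frac_const \<theta> \<longrightarrow> q = 0"
proof -
  obtain \<iota> :: "'t \<Rightarrow> nat" where \<iota>: "inj_on \<iota> T"
    using finite_imp_inj_to_nat_seg[OF assms] by blast
  let ?\<theta> = "\<lambda>t. Fract (mvar (\<iota> t)) 1 :: (nat, 'k) mpol fract"
  let ?\<psi> = "\<lambda>t. mvar (\<iota> t) :: (nat, 'k) mpol" and ?\<phi> = "\<lambda>i. mvar (the_inv_into T \<iota> i) :: ('t, 'k) mpol"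
  have "q = 0" if q: "q \<in> polys T" "q \<in> vanishing frac_const ?\<theta>" for q
  proof -
    have "meval frac_const ?\<theta> q = Fract (meval mconst ?\<psi> q) 1"
      by (rule polys_hom_eq[OF meval_hom[OF frac_const_hom] comm_ring_hom_comp[OF frac_hom meval_hom[OF mconst_hom]] _ _ q(1)])
        (auto simp: meval_const[OF frac_const_hom] meval_const[OF mconst_hom] meval_var[OF frac_const_hom]
          meval_var[OF mconst_hom] frac_const_def)
    then have 0: "meval mconst ?\<psi> q = 0"
      using q(2) by (simp add: vanishing_def Zero_fract_def eq_fract)
    have "comm_ring_hom (\<lambda>q :: ('t, 'k) mpol. q)" by standard auto
    from polys_hom_eq[OF comm_ring_hom_comp[OF meval_hom[OF mconst_hom, of ?\<phi>] meval_hom[OF mconst_hom, of ?\<psi>]] this _ _ q(1)]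
    have "meval mconst ?\<phi> (meval mconst ?\<psi> q) = q"
      by (simp add: meval_const[OF mconst_hom] meval_var[OF mconst_hom] the_inv_into_f_f[OF \<iota>])
    then show "q = 0" unfolding 0 by (simp add: meval_def)
  qed
  then show ?thesis by blast
qed

section \<open>Linear changes of coordinates\<close>

lemma sum_delta_mult:
  assumes "finite S" "a \<in> S"
  shows "(\<Sum>x\<in>S. (if a = x then 1 else 0) * (f x :: 'a::comm_ring_1)) = f a"
proof -
  have "(\<Sum>x\<in>S. (if a = x then 1 else 0) * f x) = (\<Sum>x\<in>S. if a = x then f x else 0)"
    by (intro sum.cong) auto
  then show ?thesis using assms by simp
qed

text \<open>Variables outside \<open>T\<close> go to 0, so that this is a homomorphism on the whole type with image in the carrier of
  the polynomial ring in \<open>V\<close>.  Preimages of ideals of this ring are then ideals with respect to all elements of the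
  type.\<close>
definition lin_subst :: "'t set \<Rightarrow> 'v set \<Rightarrow> ('t \<Rightarrow> 'v \<Rightarrow> 'k::field) \<Rightarrow> ('t, 'k) mpol \<Rightarrow> ('v, 'k) mpol" where
  "lin_subst T V a = meval mconst (\<lambda>t. if t \<in> T then \<Sum>v\<in>V. mconst (a t v) * mvar v else 0)"

lemma lin_subst_hom: "comm_ring_hom (lin_subst T V a)"
  unfolding lin_subst_def by (rule meval_hom[OF mconst_hom])

lemma lin_subst_const: "lin_subst T V a (mconst c) = mconst c"
  by (simp add: lin_subst_def meval_const[OF mconst_hom])

lemma lin_subst_var: "t \<in> T \<Longrightarrow> lin_subst T V a (mvar t) = (\<Sum>v\<in>V. mconst (a t v) * mvar v)"
  by (simp add: lin_subst_def meval_var[OF mconst_hom])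

lemma lin_subst_polys: "lin_subst T V a q \<in> polys V"
  unfolding lin_subst_def by (rule meval_polys) (auto intro!: polys_sum polys_mult)

lemma lin_subst_inverse:
  fixes a :: "'t \<Rightarrow> 'v \<Rightarrow> 'k::field" and q :: "('v, 'k) mpol"
  assumes "finite V" and inv: "\<And>v v'. v \<in> V \<Longrightarrow> v' \<in> V \<Longrightarrow> (\<Sum>t\<in>T. b v t * a t v') = (if v = v' then 1 else 0)"
    and q: "q \<in> polys V"
  shows "lin_subst T V a (lin_subst V T b q) = q"
proof -
  interpret h: comm_ring_hom "lin_subst T V a" by (rule lin_subst_hom)
  have id: "comm_ring_hom (\<lambda>q :: ('v, 'k) mpol. q)" by standard auto
  show ?thesis
  proof (rule polys_hom_eq[OF comm_ring_hom_comp[OF lin_subst_hom lin_subst_hom] id _ _ q])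
    fix v assume v: "v \<in> V"
    have "lin_subst T V a (lin_subst V T b (mvar v)) = (\<Sum>t\<in>T. mconst (b v t) * lin_subst T V a (mvar t))"
      by (simp add: lin_subst_var[OF v] h.hom_sum h.hom_mult lin_subst_const)
    also have "\<dots> = (\<Sum>t\<in>T. \<Sum>v'\<in>V. mconst (b v t) * (mconst (a t v') * mvar v'))"
      by (intro sum.cong refl) (simp add: lin_subst_var sum_distrib_left)
    also have "\<dots> = (\<Sum>v'\<in>V. mconst (\<Sum>t\<in>T. b v t * a t v') * mvar v')"
      by (subst sum.swap) (simp add: mconst_sum mconst_mult sum_distrib_right mult.assoc)
    also have "\<dots> = (\<Sum>v'\<in>V. (if v = v' then 1 else 0) * mvar v')"
      by (intro sum.cong refl) (use inv[OF v] in simp)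
    also have "\<dots> = mvar v" using assms(1) v by (rule sum_delta_mult)
    finally show "lin_subst T V a (lin_subst V T b (mvar v)) = mvar v" .
  qed (simp add: lin_subst_const)
qed

text \<open>The linear forms with coefficients \<open>coef t\<close> are coordinates on the space with coordinates \<open>V\<close>.\<close>
locale linear_coordinates =
  fixes V :: "'v set" and T :: "'t set" and coef inv_coef :: "'t \<Rightarrow> 'v \<Rightarrow> 'k::field"
  assumes fin: "finite V" "finite T"
    and inv1: "t \<in> T \<Longrightarrow> t' \<in> T \<Longrightarrow> (\<Sum>b\<in>V. inv_coef t b * coef t' b) = (if t = t' then 1 else 0)"
    and inv2: "b \<in> V \<Longrightarrow> b' \<in> V \<Longrightarrow> (\<Sum>t\<in>T. inv_coef t b * coef t b') = (if b = b' then 1 else 0)"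
begin

definition toV :: "('t, 'k) mpol \<Rightarrow> ('v, 'k) mpol" where
  "toV = lin_subst T V coef"

definition toT :: "('v, 'k) mpol \<Rightarrow> ('t, 'k) mpol" where
  "toT = lin_subst V T (\<lambda>b t. inv_coef t b)"

sublocale toV: comm_ring_hom toV
  unfolding toV_def by (rule lin_subst_hom)

sublocale toT: comm_ring_hom toT
  unfolding toT_def by (rule lin_subst_hom)

lemma toV_const [simp]: "toV (mconst c) = mconst c"
  by (simp add: toV_def lin_subst_const)

lemma toV_var: "t \<in> T \<Longrightarrow> toV (mvar t) = (\<Sum>b\<in>V. mconst (coef t b) * mvar b)"
  by (simp add: toV_def lin_subst_var)

lemma toV_polys [simp, intro]: "toV q \<in> polys V"
  unfolding toV_def by (rule lin_subst_polys)

lemma toT_polys [simp, intro]: "toT q \<in> polys T"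
  unfolding toT_def by (rule lin_subst_polys)

lemma toV_toT: "q \<in> polys V \<Longrightarrow> toV (toT q) = q"
  unfolding toV_def toT_def by (rule lin_subst_inverse[OF fin(1) inv2])

lemma toT_toV: "q \<in> polys T \<Longrightarrow> toT (toV q) = q"
  unfolding toV_def toT_def
  by (rule lin_subst_inverse[OF fin(2)]) (use inv1 in \<open>auto simp: mult.commute[of "coef _ _"]\<close>)

abbreviation "R \<equiv> mpol_ring V :: ('v, 'k) mpol ring"

lemma ideal_ops:
  assumes "ideal J R"
  shows "J \<subseteq> polys V" "0 \<in> J" "\<And>a b. a \<in> J \<Longrightarrow> b \<in> J \<Longrightarrow> a + b \<in> J"
    "\<And>a b. a \<in> polys V \<Longrightarrow> b \<in> J \<Longrightarrow> a * b \<in> J"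
proof -
  interpret ideal J R by (rule assms)
  show "J \<subseteq> polys V" using Icarr by blast
  have add: "additive_subgroup J R" by (rule ideal.axioms(1)[OF assms])
  show "0 \<in> J" using additive_subgroup.zero_closed[OF add] by simp
  show "a + b \<in> J" if "a \<in> J" "b \<in> J" for a b
    using additive_subgroup.a_closed[OF add that] by simp
  show "a * b \<in> J" if "a \<in> polys V" "b \<in> J" for a b using I_l_closed[OF that(2,1)] by simp
qed

lemma idealI_ops:
  assumes "J \<subseteq> polys V" "0 \<in> J" "\<And>a b. a \<in> J \<Longrightarrow> b \<in> J \<Longrightarrow> a + b \<in> J"
    "\<And>a b. a \<in> polys V \<Longrightarrow> b \<in> J \<Longrightarrow> a * b \<in> J"
  shows "ideal J R"
proof -
  interpret cring R by (rule cring_mpol_ring)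
  have um: "- a \<in> J" if "a \<in> J" for a
    using assms(4)[OF polys_const that, of "- 1"] by (simp add: mconst_uminus)
  have inv: "inv\<^bsub>add_monoid R\<^esub> a = - a" if "a \<in> J" for a
  proof -
    have "\<ominus>\<^bsub>R\<^esub> a = - a"
      by (rule minus_equality) (use that assms(1) polys_uminus in auto)
    then show ?thesis by (simp add: a_inv_def)
  qed
  show ?thesis
  proof (rule idealI)
    show "subgroup J (add_monoid R)"
      by (rule subgroup.intro) (use assms um inv in auto)
    show "ring R" by (rule ring_axioms)
    show "x \<otimes>\<^bsub>R\<^esub> a \<in> J" if "a \<in> J" "x \<in> carrier R" for a x
      using assms(4)[OF that(2,1)] by simp
    show "a \<otimes>\<^bsub>R\<^esub> x \<in> J" if "a \<in> J" "x \<in> carrier R" for a x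
      using assms(4)[OF that(2,1)] by (simp add: mult.commute)
  qed
qed

lemma ideal_sum:
  assumes "ideal J R" "\<And>i. i \<in> I \<Longrightarrow> f i \<in> J" shows "(\<Sum>i\<in>I. f i) \<in> J"
  using assms(2) by (induction I rule: infinite_finite_induct) (auto intro: ideal_ops[OF assms(1)])

lemma ideal_diff:
  assumes "ideal J R" "a \<in> J" "b \<in> J" shows "a - b \<in> J"
  using ideal_ops(3)[OF assms(1,2) ideal_ops(4)[OF assms(1) polys_const assms(3), of "- 1"]]
  by (simp add: mconst_uminus)

lemma vimage_toV_subspace: "ideal J R \<Longrightarrow> ring_module.subspace {q. toV q \<in> J}"
  using ideal_ops[of J] by (auto simp: ring_module.subspace_def toV.hom_add toV.hom_mult)

lemma prime_ops:
  assumes "primeideal J R"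
  shows "ideal J R" "1 \<notin> J" "\<And>a b. a \<in> polys V \<Longrightarrow> b \<in> polys V \<Longrightarrow> a * b \<in> J \<Longrightarrow> a \<in> J \<or> b \<in> J"
proof -
  interpret primeideal J R by (rule assms)
  show "ideal J R" by (rule is_ideal)
  show "1 \<notin> J" using one_imp_carrier I_notcarr by auto
  show "a \<in> J \<or> b \<in> J" if "a \<in> polys V" "b \<in> polys V" "a * b \<in> J" for a b
    using I_prime[OF that(1,2)] that(3) by simp
qed

lemma vimage_toV_prime: "primeideal J R \<Longrightarrow> prime_set {q. toV q \<in> J}"
  using prime_ops[of J] vimage_toV_subspace[of J] by (auto simp: prime_set_def toV.hom_mult)

lemma vimage_toT_prime:
  assumes "prime_set Q" shows "primeideal {q \<in> polys V. toT q \<in> Q} R"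
proof (rule primeidealI)
  have sub: "ring_module.subspace Q" using assms by (simp add: prime_set_def)
  show "ideal {q \<in> polys V. toT q \<in> Q} R"
    by (rule idealI_ops) (auto simp: toT.hom_add toT.hom_mult ring_module.subspace_0[OF sub]
      intro!: ring_module.subspace_add[OF sub] ring_module.subspace_scale[OF sub])
  show "cring R" by (rule cring_mpol_ring)
  show "carrier R \<noteq> {q \<in> polys V. toT q \<in> Q}"
  proof -
    have "(1 :: ('v, 'k) mpol) \<notin> {q \<in> polys V. toT q \<in> Q}" using assms by (simp add: prime_set_def)
    then show ?thesis using polys_1[of V] by metis
  qed
  show "a \<in> {q \<in> polys V. toT q \<in> Q} \<or> b \<in> {q \<in> polys V. toT q \<in> Q}"
    if "a \<in> carrier R" "b \<in> carrier R" "a \<otimes>\<^bsub>R\<^esub> b \<in> {q \<in> polys V. toT q \<in> Q}" for a b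
    using that assms by (auto simp: prime_set_def toT.hom_mult)
qed

text \<open>The chain itself gives the lower bound.  For the upper bound, the variables outside \<open>xs\<close> are independent
  modulo the top prime, so \<open>prime_chain_bound\<close> leaves room for at most \<open>length xs\<close> steps.\<close>
lemma prime_height_eq:
  assumes xs: "distinct xs" "set xs \<subseteq> T"
    and Q: "\<And>j. j \<le> length xs \<Longrightarrow> prime_set (Q j)"
    and chain: "\<And>j. j < length xs \<Longrightarrow> Q j \<inter> polys T \<subseteq> Q (Suc j) \<and> (\<exists>f\<in>polys T. f \<in> Q (Suc j) \<and> f \<notin> Q j)"
    and free: "\<And>q. q \<in> polys (T - set xs) \<Longrightarrow> q \<in> Q (length xs) \<Longrightarrow> q = 0"
  shows "prime_height R {q \<in> polys V. toT q \<in> Q (length xs)} = enat (length xs)"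
proof -
  let ?P = "\<lambda>j. {q \<in> polys V. toT q \<in> Q j}"
  let ?c = "length xs"
  have upper: "enat m \<le> enat ?c" if RR: "\<forall>j\<le>m. primeideal (RR j) R" "\<forall>j<m. RR j \<subset> RR (Suc j)" "RR m = ?P ?c" for m RR
  proof -
    have "m + card (T - set xs) \<le> card T"
    proof (rule prime_chain_bound[where Q = "\<lambda>j. {q. toV q \<in> RR j}"])
      show "prime_set {q. toV q \<in> RR j}" if "j \<le> m" for j
        using vimage_toV_prime RR(1) that by blast
      show "{q. toV q \<in> RR j} \<subseteq> {q. toV q \<in> RR (Suc j)} \<and>
        (\<exists>f\<in>polys T. f \<in> {q. toV q \<in> RR (Suc j)} \<and> f \<notin> {q. toV q \<in> RR j})" if j: "j < m" for j
      proof
        show "{q. toV q \<in> RR j} \<subseteq> {q. toV q \<in> RR (Suc j)}" using RR(2) j by blast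
        obtain f where f: "f \<in> RR (Suc j)" "f \<notin> RR j" using RR(2) j by blast
        have "primeideal (RR (Suc j)) R" using RR(1) j by simp
        then have "f \<in> polys V" using f ideal_ops(1)[OF prime_ops(1)] by blast
        then show "\<exists>f\<in>polys T. f \<in> {q. toV q \<in> RR (Suc j)} \<and> f \<notin> {q. toV q \<in> RR j}"
          using f toV_toT[of f] by (intro bexI[of _ "toT f"]) auto
      qed
      show "q = 0" if q: "q \<in> polys (T - set xs)" "q \<in> {q. toV q \<in> RR m}" for q
      proof -
        have "q \<in> polys T" using q(1) polys_mono[of "T - set xs" T] by blast
        then have "q \<in> Q ?c" using q(2) RR(3) toT_toV[of q] by auto
        then show ?thesis using free q(1) by blast
      qed
    qed (use fin in auto)
    moreover have "card (T - set xs) = card T - ?c"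
      using xs fin by (simp add: card_Diff_subset distinct_card)
    moreover have "?c \<le> card T" using xs fin by (metis card_mono distinct_card)
    ultimately show ?thesis by simp
  qed
  have "\<forall>j<?c. ?P j \<subset> ?P (Suc j)"
  proof (intro allI impI psubsetI)
    fix j assume j: "j < ?c"
    show "?P j \<subseteq> ?P (Suc j)" using chain[OF j] toT_polys by blast
    obtain f where "f \<in> polys T" "f \<in> Q (Suc j)" "f \<notin> Q j" using chain[OF j] by blast
    then have "toV f \<in> ?P (Suc j)" "toV f \<notin> ?P j" using toT_toV[of f] by auto
    then show "?P j \<noteq> ?P (Suc j)" by blast
  qed
  then have lower: "\<exists>RR. (\<forall>j\<le>?c. primeideal (RR j) R) \<and> (\<forall>j<?c. RR j \<subset> RR (Suc j)) \<and> RR ?c = ?P ?c"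
    using vimage_toT_prime Q by (intro exI[of _ ?P]) auto
  show ?thesis unfolding prime_height_def
    by (intro antisym Sup_least Sup_upper) (use upper lower in blast)+
qed

lemma span_toV:
  assumes "q \<in> ring_module.span G"
  shows "toV q \<in> Idl\<^bsub>R\<^esub> (toV ` G)"
proof -
  interpret cring R by (rule cring_mpol_ring)
  have sub: "toV ` G \<subseteq> carrier R" by auto
  have "ring_module.span G \<subseteq> {q. toV q \<in> Idl\<^bsub>R\<^esub> (toV ` G)}"
    by (rule ring_module.span_minimal[OF _ vimage_toV_subspace[OF genideal_ideal[OF sub]]])
      (use genideal_self[OF sub] in auto)
  then show ?thesis using assms by blast
qed

lemma mpartial_toV:
  assumes "b \<in> V"
  shows "mpartial b (toV q) = (\<Sum>t\<in>T. mconst (coef t b) * toV (mpartial t q))"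
proof -
  let ?W = "T \<union> (\<Union>m\<in>keys q. keys m)"
  let ?\<eta> = "\<lambda>t. if t \<in> T then \<Sum>b\<in>V. mconst (coef t b) * mvar b else 0 :: ('v, 'k) mpol"
  have W: "finite ?W" "q \<in> polys ?W" using fin by (auto simp: polys_iff)
  have \<eta>: "mpartial b (?\<eta> t) = (if t \<in> T then mconst (coef t b) else 0)" for t
  proof -
    have "mpartial b (\<Sum>b'\<in>V. mconst (coef t b') * mvar b') = (\<Sum>b'\<in>V. if b = b' then mconst (coef t b') else 0)"
      unfolding mpartial_sum by (intro sum.cong refl) (simp add: mpartial_mult mpartial_var)
    then show ?thesis using assms fin by simp
  qed
  have "mpartial b (toV q) = (\<Sum>t\<in>?W. mpartial b (?\<eta> t) * toV (mpartial t q))"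
    unfolding toV_def lin_subst_def by (rule mpartial_chain_rule[OF W])
  also have "\<dots> = (\<Sum>t\<in>T. mconst (coef t b) * toV (mpartial t q))"
    unfolding \<eta> using W(1) by (intro sum.mono_neutral_cong_right) auto
  finally show ?thesis .
qed

text \<open>The combination of partial derivatives dual to the coordinate \<open>t\<close>.\<close>
lemma dual_derivative:
  assumes "t \<in> T"
  shows "(\<Sum>b\<in>V. mconst (inv_coef t b) * mpartial b (toV q)) = toV (mpartial t q)"
proof -
  have "(\<Sum>b\<in>V. mconst (inv_coef t b) * mpartial b (toV q)) =
      (\<Sum>b\<in>V. \<Sum>t'\<in>T. mconst (inv_coef t b * coef t' b) * toV (mpartial t' q))"
    by (intro sum.cong refl) (simp add: mpartial_toV sum_distrib_left mconst_mult mult.assoc)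
  also have "\<dots> = (\<Sum>t'\<in>T. mconst (\<Sum>b\<in>V. inv_coef t b * coef t' b) * toV (mpartial t' q))"
    by (subst sum.swap) (simp add: mconst_sum sum_distrib_right)
  also have "\<dots> = (\<Sum>t'\<in>T. (if t = t' then 1 else 0) * toV (mpartial t' q))"
    by (intro sum.cong refl) (use inv1[OF assms] in auto)
  also have "\<dots> = toV (mpartial t q)" using fin(2) assms by (rule sum_delta_mult)
  finally show ?thesis .
qed

text \<open>At \<open>P\<close> the factor \<open>s\<close> only rescales the differentials, and the derivative of a relation with respect to a variable
  that is solved later is 0.  So a dependency is resolved from the last relation to the first.\<close>
lemma differentials_independent:
  assumes P: "primeideal P R" and tri: "triangular T xs den num" and s: "toV s \<notin> P"
    and den: "\<And>t. t \<in> set xs \<Longrightarrow> toV (den t) \<notin> P"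
    and rel: "\<And>t. t \<in> set xs \<Longrightarrow> toV (den t * mvar t - num t) \<in> P"
    and c: "\<And>j. j < length xs \<Longrightarrow> c j \<in> polys V"
    and dep: "\<And>b. b \<in> V \<Longrightarrow>
      (\<Sum>j<length xs. c j * mpartial b (toV (s * (den (xs ! j) * mvar (xs ! j) - num (xs ! j))))) \<in> P"
    and "j < length xs"
  shows "c j \<in> P"
proof -
  let ?g = "\<lambda>j. den (xs ! j) * mvar (xs ! j) - num (xs ! j)" and ?n = "length xs"
  note I = prime_ops(1)[OF P]
  note P_ops = ideal_ops[OF I]
  have D: "(\<Sum>j<?n. c j * toV (mpartial t (?g j))) \<in> P" if t: "t \<in> T" for t
  proof -
    have "(\<Sum>b\<in>V. mconst (inv_coef t b) * (\<Sum>j<?n. c j * mpartial b (toV (s * ?g j)))) \<in> P"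
      by (intro ideal_sum[OF I] P_ops(4) polys_const dep)
    also have "(\<Sum>b\<in>V. mconst (inv_coef t b) * (\<Sum>j<?n. c j * mpartial b (toV (s * ?g j)))) =
        (\<Sum>j<?n. c j * (\<Sum>b\<in>V. mconst (inv_coef t b) * mpartial b (toV (s * ?g j))))"
      unfolding sum_distrib_left by (subst sum.swap) (simp add: mult.left_commute)
    also have "\<dots> = (\<Sum>j<?n. c j * toV (mpartial t (s * ?g j)))"
      by (simp only: dual_derivative[OF t])
    also have "\<dots> = toV s * (\<Sum>j<?n. c j * toV (mpartial t (?g j))) +
        (\<Sum>j<?n. (c j * toV (mpartial t s)) * toV (?g j))"
      unfolding mpartial_mult[of t s] toV.hom_add toV.hom_mult[of s] toV.hom_mult[of "mpartial t s"]
      by (simp only: sum_distrib_left distrib_left sum.distrib mult_ac)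
    finally have total: "toV s * (\<Sum>j<?n. c j * toV (mpartial t (?g j))) +
        (\<Sum>j<?n. (c j * toV (mpartial t s)) * toV (?g j)) \<in> P" .
    have "(\<Sum>j<?n. (c j * toV (mpartial t s)) * toV (?g j)) \<in> P"
      by (intro ideal_sum[OF I] P_ops(4) polys_mult c toV_polys rel) auto
    from ideal_diff[OF I total this] have "toV s * (\<Sum>j<?n. c j * toV (mpartial t (?g j))) \<in> P" by simp
    moreover have "(\<Sum>j<?n. c j * toV (mpartial t (?g j))) \<in> polys V"
      by (intro polys_sum polys_mult c toV_polys) simp
    ultimately show ?thesis using prime_ops(3)[OF P toV_polys] s by blast
  qed
  show ?thesis using \<open>j < ?n\<close>
  proof (induction "?n - j" arbitrary: j rule: less_induct)
    case less
    have j: "j < ?n" by (rule less.prems)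
    have t: "xs ! j \<in> T" "xs ! j \<in> set xs" using tri j by (auto simp: triangular_def)
    let ?a = "\<lambda>i. c i * toV (mpartial (xs ! j) (?g i))"
    have others: "?a i \<in> P" if i: "i \<in> {..<?n} - {j}" for i
    proof (cases "i < j")
      case True
      then show ?thesis using mpartial_triangular[OF tri, of i j] j P_ops(2) by simp
    next
      case False
      then have "c i \<in> P" using less.hyps[of i] i by auto
      then have "toV (mpartial (xs ! j) (?g i)) * c i \<in> P" by (rule P_ops(4)[OF toV_polys])
      then show ?thesis by (simp only: mult.commute)
    qed
    have "(\<Sum>i<?n. ?a i) = ?a j + (\<Sum>i\<in>{..<?n} - {j}. ?a i)"
      using j by (intro sum.remove) auto
    then have aj: "?a j = (\<Sum>i<?n. ?a i) - (\<Sum>i\<in>{..<?n} - {j}. ?a i)" by simp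
    have "?a j \<in> P" unfolding aj by (rule ideal_diff[OF I D[OF t(1)] ideal_sum[OF I others]])
    then have "c j * toV (den (xs ! j)) \<in> P" using mpartial_triangular[OF tri order_refl j] by simp
    then show "c j \<in> P" using prime_ops(3)[OF P c[OF j] toV_polys] den[OF t(2)] by blast
  qed
qed

text \<open>The generators near \<open>P\<close> are the relations, multiplied by a common denominator that moves them into the ideal.\<close>
lemma smooth_at_triangular:
  assumes P: "primeideal P R" and G: "finite G" "toV ` G \<subseteq> P"
    and tri: "triangular T xs den num"
    and den: "\<And>t. t \<in> set xs \<Longrightarrow> toV (den t) \<notin> P"
    and rel: "\<And>t. t \<in> set xs \<Longrightarrow> den t * mvar t - num t \<in> saturation {q. toV q \<in> P} (ring_module.span G)"
    and gen: "G \<subseteq> saturation {q. toV q \<in> P} (ring_module.span ((\<lambda>t. den t * mvar t - num t) ` set xs))"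
  shows "smooth_at V (Idl\<^bsub>R\<^esub> (toV ` G), U) P"
proof -
  interpret R: cring R by (rule cring_mpol_ring)
  let ?P = "{q. toV q \<in> P}" and ?g = "\<lambda>t. den t * mvar t - num t"
  have Pp: "prime_set ?P" by (rule vimage_toV_prime[OF P])
  interpret saturated_ideal ?P ?P by (rule prime_set_saturated[OF Pp])
  obtain s where s: "s \<notin> ?P" "\<forall>q\<in>?g ` set xs. s * q \<in> ring_module.span G"
    using common_denominator[OF Pp ring_module.subspace_span, of "?g ` set xs" G] rel by blast
  obtain s' where s': "s' \<notin> ?P" "\<forall>q\<in>G. s' * q \<in> ring_module.span (?g ` set xs)"
    using common_denominator[OF Pp ring_module.subspace_span G(1) gen] by blast
  have gP: "toV (?g t) \<in> P" if t: "t \<in> set xs" for t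
  proof -
    have "ring_module.span G \<subseteq> ?P"
      by (rule ring_module.span_minimal[OF _ ideal]) (use G in blast)
    then have "s * ?g t \<in> ?P" using s(2) t by blast
    then show ?thesis using saturated[of s "?g t"] s(1) by blast
  qed
  define gs where "gs = map (\<lambda>t. toV (s * ?g t)) xs"
  have set_gs: "set gs = toV ` (*) s ` ?g ` set xs" by (auto simp: gs_def)
  have gs_sub: "set gs \<subseteq> Idl\<^bsub>R\<^esub> (toV ` G)"
    using span_toV s(2) unfolding set_gs by auto
  have gs_carrier: "set gs \<subseteq> carrier R" unfolding set_gs by auto
  note Igs = ideal_ops[OF R.genideal_ideal[OF gs_carrier]]
  let ?S = "toV (s * s')"
  have "Idl\<^bsub>R\<^esub> (toV ` G) \<subseteq> {q \<in> polys V. ?S * q \<in> Idl\<^bsub>R\<^esub> (set gs)}"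
  proof (rule R.genideal_minimal)
    show "ideal {q \<in> polys V. ?S * q \<in> Idl\<^bsub>R\<^esub> (set gs)} R"
      by (rule idealI_ops) (auto simp: distrib_left mult.left_commute[of ?S] intro: Igs)
    show "toV ` G \<subseteq> {q \<in> polys V. ?S * q \<in> Idl\<^bsub>R\<^esub> (set gs)}"
    proof (intro image_subsetI CollectI conjI toV_polys)
      fix \<mu> assume "\<mu> \<in> G"
      then have "s * (s' * \<mu>) \<in> ring_module.span ((*) s ` ?g ` set xs)" using s'(2) by (intro span_scaled) blast
      from span_toV[OF this] show "?S * toV \<mu> \<in> Idl\<^bsub>R\<^esub> (set gs)"
        unfolding set_gs by (simp only: toV.hom_mult mult.assoc)
    qed
  qed
  moreover have "?S \<notin> P" using mult_notin[OF s(1) s'(1)] by blast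
  ultimately have local: "\<exists>S \<in> polys V - P. \<forall>q \<in> Idl\<^bsub>R\<^esub> (toV ` G). S * q \<in> Idl\<^bsub>R\<^esub> (set gs)"
    by (intro bexI[of _ ?S]) auto
  have s_notin: "toV s \<notin> P" using s(1) by blast
  have "\<forall>j<length gs. c j \<in> P"
    if "\<forall>j<length gs. c j \<in> polys V" "\<forall>v\<in>V. (\<Sum>j<length gs. c j * mpartial v (gs ! j)) \<in> P" for c
    using differentials_independent[OF P tri s_notin den gP, of c] that by (simp add: gs_def)
  then show ?thesis
    unfolding smooth_at_def fst_conv using gs_sub local by (intro exI[of _ gs] conjI) auto
qed

end

section \<open>The local structure of the determinantal scheme\<close>

lemma finite_minors:
  assumes "finite Rs" "finite Cs" shows "finite (minors M Rs Cs (int m))"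
proof -
  have "minors M Rs Cs (int m) \<subseteq> (\<lambda>(rs, cs). sub_det M rs cs) `
      ({rs. set rs \<subseteq> Rs \<and> length rs = m} \<times> {cs. set cs \<subseteq> Cs \<and> length cs = m})"
    by (force simp: minors_iff)
  then show ?thesis
    using finite_lists_length_eq[OF assms(1)] finite_lists_length_eq[OF assms(2)]
    by (meson finite_SigmaI finite_imageI finite_subset)
qed

lemma minors_mono: "Cs \<subseteq> Cs' \<Longrightarrow> minors M Rs Cs (int m) \<subseteq> minors M Rs Cs' (int m)"
  unfolding subset_iff minors_iff by blast

lemma (in comm_ring_hom) sub_det_hom:
  assumes "length cs = length rs" "\<And>r c. r \<in> set rs \<Longrightarrow> c \<in> set cs \<Longrightarrow> N r c = hom (M r c)"
  shows "sub_det N rs cs = hom (sub_det M rs cs)"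
proof -
  let ?A = "mat (length rs) (length rs) (\<lambda>(j, l). M (rs ! j) (cs ! l))"
  have "map_mat hom ?A = mat (length rs) (length rs) (\<lambda>(j, l). N (rs ! j) (cs ! l))"
    by (rule eq_matI) (use assms in auto)
  then show ?thesis unfolding sub_det_def by (metis hom_det)
qed

lemma (in comm_ring_hom) minors_hom:
  assumes "\<And>r c. r \<in> Rs \<Longrightarrow> c \<in> Cs \<Longrightarrow> N r c = hom (M r c)"
  shows "minors N Rs Cs (int m) = hom ` minors M Rs Cs (int m)"
proof -
  have eq: "sub_det N rs cs = hom (sub_det M rs cs)"
    if "length rs = m" "set rs \<subseteq> Rs" "length cs = m" "set cs \<subseteq> Cs" for rs cs
    by (rule sub_det_hom) (use that assms in auto)
  show ?thesis
  proof (intro equalityI subsetI)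
    fix \<mu> assume "\<mu> \<in> minors N Rs Cs (int m)"
    then obtain rs cs where l: "\<mu> = sub_det N rs cs" "length rs = m" "distinct rs" "set rs \<subseteq> Rs"
      "length cs = m" "distinct cs" "set cs \<subseteq> Cs" unfolding minors_iff by blast
    then have "sub_det M rs cs \<in> minors M Rs Cs (int m)" unfolding minors_iff by blast
    then show "\<mu> \<in> hom ` minors M Rs Cs (int m)" using l eq by blast
  next
    fix \<mu> assume "\<mu> \<in> hom ` minors M Rs Cs (int m)"
    then obtain \<nu> where \<nu>: "\<mu> = hom \<nu>" "\<nu> \<in> minors M Rs Cs (int m)" by blast
    then obtain rs cs where l: "\<nu> = sub_det M rs cs" "length rs = m" "distinct rs" "set rs \<subseteq> Rs"
      "length cs = m" "distinct cs" "set cs \<subseteq> Cs" unfolding minors_iff by blast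
    then have "\<mu> = sub_det N rs cs" using eq \<nu>(1) by simp
    then show "\<mu> \<in> minors N Rs Cs (int m)" unfolding minors_iff using l by blast
  qed
qed

text \<open>The matrix \<open>M\<close> has columns with respect to the basis \<open>BE\<close> and arises from the generic symmetric matrix by the base
  change \<open>g\<close> with inverse \<open>g'\<close>; \<open>\<tau>\<close> is the same matrix in the coordinates \<open>V\<close>.\<close>
locale determinantal = linear_coordinates V "coords BA C BF" coef inv_coef
  for V :: "'v set" and BA C :: "'e set" and BF :: "'f set" and coef inv_coef :: "'e set \<times> 'f \<Rightarrow> 'v \<Rightarrow> 'k::field" +
  fixes BE :: "'e set" and M :: "'e \<times> 'f \<Rightarrow> 'e \<Rightarrow> ('e set \<times> 'f, 'k) mpol" and g g' :: "'e \<Rightarrow> 'e \<Rightarrow> 'k"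
    and \<tau> :: "'e \<times> 'f \<Rightarrow> 'e \<Rightarrow> ('v, 'k) mpol"
  assumes fin_bases: "finite BA" "finite C" "finite BF" "finite BE"
    and disj: "BA \<inter> C = {}"
    and M_entry: "\<And>r u. r \<in> BA \<times> BF \<Longrightarrow> u \<in> BE \<Longrightarrow> M r u = (\<Sum>w\<in>BA \<union> C. mconst (g w u) * entry r w)"
    and entry_M: "\<And>r w. r \<in> BA \<times> BF \<Longrightarrow> w \<in> BA \<union> C \<Longrightarrow> entry r w = (\<Sum>u\<in>BE. mconst (g' u w) * M r u)"
    and \<tau>_M: "\<And>r u. r \<in> BA \<times> BF \<Longrightarrow> u \<in> BE \<Longrightarrow> \<tau> r u = toV (M r u)"
    and \<tau>_entry: "\<And>r u. r \<in> BA \<times> BF \<Longrightarrow> u \<in> BA \<Longrightarrow> \<tau> r u = toV (entry r u)"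
begin

abbreviation "ent \<equiv> entry :: 'e \<times> 'f \<Rightarrow> 'e \<Rightarrow> ('e set \<times> 'f, 'k) mpol"

text \<open>For nonnegative ranks \<open>n\<close> and \<open>d\<close> this is the subscheme \<open>Delta\<close>.\<close>
definition scheme :: "nat \<Rightarrow> nat \<Rightarrow> ('v, 'k) mpol lc_subscheme" where
  "scheme n d = (Idl\<^bsub>R\<^esub> (minors \<tau> (BA \<times> BF) BE (int (Suc n)) \<union> minors \<tau> (BA \<times> BF) BA (int (Suc d))),
     {P. primeideal P R \<and> (\<exists>g \<in> minors \<tau> (BA \<times> BF) BE (int n). g \<notin> P) \<and>
       (\<exists>g \<in> minors \<tau> (BA \<times> BF) BA (int d). g \<notin> P)})"

lemma minors_\<tau>:
  "minors \<tau> (BA \<times> BF) BE (int m) = toV ` minors M (BA \<times> BF) BE (int m)"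
  "minors \<tau> (BA \<times> BF) BA (int m) = toV ` minors ent (BA \<times> BF) BA (int m)"
  by (rule toV.minors_hom, rule \<tau>_M \<tau>_entry, assumption+)+

lemma rank_le_BE_iff:
  assumes "saturated_ideal P J"
  shows "saturated_ideal.rank_le P J k M (BA \<times> BF) BE \<longleftrightarrow> saturated_ideal.rank_le P J k ent (BA \<times> BF) (BA \<union> C)"
proof -
  interpret saturated_ideal P J by (rule assms)
  show ?thesis
    using rank_le_columns[of k M "BA \<times> BF" BE "BA \<union> C" ent "\<lambda>u w. mconst (g' u w)"]
      rank_le_columns[of k ent "BA \<times> BF" "BA \<union> C" BE M "\<lambda>w u. mconst (g w u)"] M_entry entry_M by blast
qed

text \<open>The rank at \<open>P\<close> does not change from the columns \<open>BE\<close> to the columns \<open>BA \<union> C\<close>, so the pivot lemmas apply to the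
  generic symmetric matrix.\<close>
lemma pivots_exist:
  assumes Pp: "prime_set P" and vM: "minors M (BA \<times> BF) BE (int (Suc n)) \<subseteq> P"
    and vA: "minors ent (BA \<times> BF) BA (int (Suc d)) \<subseteq> P"
    and \<mu>E: "\<mu>E \<in> minors M (BA \<times> BF) BE (int n)" "\<mu>E \<notin> P"
    and \<mu>A: "\<mu>A \<in> minors ent (BA \<times> BF) BA (int d)" "\<mu>A \<notin> P"
  shows "\<exists>rsA rsC csA csC. d \<le> n \<and> pivots P BA C BF rsA rsC csA csC \<and> length rsA = d \<and> length rsC = n - d"
proof -
  interpret saturated_ideal P P by (rule prime_set_saturated[OF Pp])
  let ?Rs = "BA \<times> BF"
  have "\<not> minors ent ?Rs (BA \<union> C) (int n) \<subseteq> P"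
  proof
    assume "minors ent ?Rs (BA \<union> C) (int n) \<subseteq> P"
    from prime_rank_le[OF Pp this] obtain k where k: "k < n" "rank_le k ent ?Rs (BA \<union> C)" by blast
    then have "rank_le k M ?Rs BE" using rank_le_BE_iff[OF saturated_ideal_axioms] by blast
    then show False using rank_le_minors k(1) \<mu>E by blast
  qed
  then obtain \<mu> where \<mu>: "\<mu> \<in> minors ent ?Rs (BA \<union> C) (int n)" "\<mu> \<notin> P" by blast
  have dn: "d \<le> n"
  proof (rule ccontr)
    assume "\<not> d \<le> n"
    then have "n < d" by simp
    have "rank_le n M ?Rs BE"
      using minors_rank_le[OF \<mu>E] vM by simp
    then have "rank_le n ent ?Rs (BA \<union> C)" using rank_le_BE_iff[OF saturated_ideal_axioms] by blast
    from rank_le_minors[OF this \<open>n < d\<close>] show False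
      using \<mu>A minors_mono[of BA "BA \<union> C" ent ?Rs d] by blast
  qed
  obtain rsA csA where A: "length rsA = d" "length csA = d" "distinct rsA" "distinct csA"
    "set csA \<subseteq> BA" "set rsA \<subseteq> set csA \<times> BF" "sub_det ent rsA csA \<notin> P"
    by (rule symmetric_pivot[OF Pp vA \<mu>A])
  have rsA: "set rsA \<subseteq> ?Rs" using A by auto
  obtain rsC csC where Cc: "length rsC = n - d" "length csC = n - d" "distinct (rsA @ rsC)" "distinct (csA @ csC)"
    "set rsC \<subseteq> ?Rs" "set csC \<subseteq> C" "sub_det ent (rsA @ rsC) (csA @ csC) \<notin> P"
    using pivot_extension[OF Pp vA \<mu> A(1-5) rsA A(7) disj dn order_refl] by blast
  have "pivots P BA C BF rsA rsC csA csC"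
    by unfold_locales (use Pp fin_bases disj Cc A in auto)
  then show ?thesis using A Cc dn by blast
qed

text \<open>At a point \<open>P\<close> one chooses pivots and solves.  The vanishing ideal of the generic point of the resulting graph lies
  in \<open>P\<close> and contains the minors, and the minors that are nonzero at \<open>P\<close> are nonzero there as well.  So it is a point of
  the scheme below \<open>P\<close>.\<close>
lemma local_structure:
  assumes pt: "P \<in> points (scheme n d)"
  shows "smooth_at V (scheme n d) P \<and> (\<exists>c. (P \<in> generic_points (scheme n d) \<longrightarrow> prime_height R P = enat c) \<and>
    d \<le> card BA \<and> d \<le> d * card BF \<and> n \<le> card BA * card BF \<and> d \<le> n \<and> n - d \<le> card C \<and>
    2 * c = 2 * ((d * card BF - d) * (card BA - d)) + (card BA - d) * (card BA - d + 1) * card BF +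
      2 * ((card C - (n - d)) * (card BA * card BF - n)))"
proof -
  interpret Rc: cring R by (rule cring_mpol_ring)
  let ?Rs = "BA \<times> BF" and ?T = "coords BA C BF"
  define G where "G = minors M ?Rs BE (int (Suc n)) \<union> minors ent ?Rs BA (int (Suc d))"
  have ideal_G: "fst (scheme n d) = Idl\<^bsub>R\<^esub> (toV ` G)"
    by (simp add: scheme_def minors_\<tau> G_def image_Un del: of_nat_Suc)
  have finG: "finite G"
    unfolding G_def using fin_bases by (intro finite_UnI finite_minors finite_cartesian_product)
  let ?P = "{q. toV q \<in> P}"
  from pt have prime: "primeideal P R" and IP: "Idl\<^bsub>R\<^esub> (toV ` G) \<subseteq> P"
    and nvE: "\<exists>\<mu>\<in>minors M ?Rs BE (int n). \<mu> \<notin> ?P" and nvA: "\<exists>\<mu>\<in>minors ent ?Rs BA (int d). \<mu> \<notin> ?P"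
    using ideal_G unfolding points_def by (auto simp: scheme_def minors_\<tau>)
  have Pp: "prime_set ?P" by (rule vimage_toV_prime[OF prime])
  interpret satP: saturated_ideal ?P ?P by (rule prime_set_saturated[OF Pp])
  have GP: "toV ` G \<subseteq> P" using Rc.genideal_self[of "toV ` G"] IP by auto
  then have G_P: "G \<subseteq> ?P" by blast
  from nvA obtain \<mu>A where \<mu>A: "\<mu>A \<in> minors ent ?Rs BA (int d)" "\<mu>A \<notin> ?P" by blast
  from nvE obtain \<mu>E where \<mu>E: "\<mu>E \<in> minors M ?Rs BE (int n)" "\<mu>E \<notin> ?P" by blast
  from pivots_exist[OF Pp _ _ \<mu>E \<mu>A] obtain rsA rsC csA csC where dn: "d \<le> n"
    and piv: "pivots ?P BA C BF rsA rsC csA csC" and len_A: "length rsA = d" and len_C: "length rsC = n - d"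
    using G_P by (auto simp: G_def simp del: of_nat_Suc)
  interpret pivots ?P BA C BF rsA rsC csA csC by (rule piv)
  have len_rs: "length rs = n" using len_A len_C dn by simp
  have finite_T: "finite ?T" by (rule finite_coords[OF fin_bases(1-3)])
  from triangular_relations obtain xs where xs: "set xs = solvedA \<union> solvedC" and tri: "triangular ?T xs den num" by blast
  let ?g = "\<lambda>t. den t * mvar t - num t"
  let ?J1 = "saturation ?P (ring_module.span G)" and ?J2 = "saturation ?P (ring_module.span (?g ` set xs))"
  have sat1: "saturated_ideal ?P ?J1" and sat2: "saturated_ideal ?P ?J2"
    by (rule saturation_saturated[OF Pp ring_module.subspace_span])+
  interpret J1: saturated_ideal ?P ?J1 by (rule sat1)
  interpret J2: saturated_ideal ?P ?J2 by (rule sat2)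
  have G_J1: "G \<subseteq> ?J1" using ring_module.span_superset[of G] saturation_superset[OF Pp] by blast
  have rel: "?g t \<in> ?J1" if t: "t \<in> set xs" for t
  proof (rule relations_in_saturated[OF sat1])
    show "minors ent ?Rs BA (int (Suc (length rsA))) \<subseteq> ?J1"
      using G_J1 len_A by (simp add: G_def del: of_nat_Suc)
    have "J1.rank_le n M ?Rs BE"
      using J1.minors_rank_le[OF \<mu>E] G_J1 by (simp add: G_def del: of_nat_Suc)
    then have "J1.rank_le n ent ?Rs (BA \<union> C)" using rank_le_BE_iff[OF sat1] by blast
    then show "minors ent ?Rs (BA \<union> C) (int (Suc (length rs))) \<subseteq> ?J1"
      by (rule J1.rank_le_minors) (simp only: len_rs lessI)
    show "t \<in> ?T" using t xs solved_coords by blast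
  qed
  have g_J2: "?g t \<in> ?J2" if "t \<in> solvedA \<union> solvedC" for t
    using ring_module.span_base[of "?g t" "?g ` set xs"] saturation_superset[OF Pp] xs that by blast
  have gen: "G \<subseteq> ?J2"
  proof -
    have "minors ent ?Rs BA (int (Suc d)) \<subseteq> ?J2"
      by (rule J2.rank_le_minors[OF relations_imp_rank(1)[OF sat2 g_J2]]) (simp_all add: len_A)
    moreover have "J2.rank_le (length rs) M ?Rs BE"
      using relations_imp_rank(2)[OF sat2 g_J2] rank_le_BE_iff[OF sat2] by blast
    then have "minors M ?Rs BE (int (Suc n)) \<subseteq> ?J2"
      by (rule J2.rank_le_minors) (simp only: len_rs lessI)
    ultimately show ?thesis by (simp add: G_def del: of_nat_Suc)
  qed
  have den_P: "toV (den t) \<notin> P" for t using den_notin[of t] by blast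
  have "smooth_at V (Idl\<^bsub>R\<^esub> (toV ` G), snd (scheme n d)) P"
    by (rule smooth_at_triangular[OF prime finG GP tri den_P rel gen])
  then have smooth: "smooth_at V (scheme n d) P" using ideal_G by (metis prod.collapse)
  have J1_P: "?J1 \<subseteq> ?P"
  proof
    fix q assume "q \<in> ?J1"
    then obtain s where s: "s \<notin> ?P" "s * q \<in> ring_module.span G" by (auto simp: saturation_def)
    have "ring_module.span G \<subseteq> ?P" by (rule ring_module.span_minimal[OF G_P satP.ideal])
    then show "q \<in> ?P" using satP.saturated[OF s(1)] s(2) by blast
  qed
  have relP: "\<forall>t\<in>set xs. den t \<notin> ?P \<and> ?g t \<in> ?P"
    using den_notin rel J1_P by blast
  obtain \<theta> :: "'e set \<times> 'f \<Rightarrow> (nat, 'k) mpol fract"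
    where \<theta>: "\<forall>q\<in>polys ?T. q \<in> vanishing frac_const \<theta> \<longrightarrow> q = 0"
    using free_point_exists[OF finite_T] by blast
  from generic_chain[OF frac_const_hom tri Pp relP \<theta>] obtain Q where
    Q: "\<forall>j \<le> length xs. prime_set (Q j)"
    and chain: "\<forall>j < length xs. Q j \<inter> polys ?T \<subseteq> Q (Suc j) \<and> (\<exists>f\<in>polys ?T. f \<in> Q (Suc j) \<and> f \<notin> Q j)"
    and QP: "Q (length xs) \<inter> polys ?T \<subseteq> ?P"
    and free: "\<forall>q\<in>polys (?T - set xs). q \<in> Q (length xs) \<longrightarrow> q = 0"
    and gQ: "\<forall>t\<in>set xs. ?g t \<in> Q (length xs)" by (elim exE conjE) (rule that)
  let ?Qc = "Q (length xs)"
  \<comment> \<open>The vanishing ideal of the generic point of the graph.\<close>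
  let ?P' = "{q \<in> polys V. toT q \<in> ?Qc}"
  from tri have xs_T: "distinct xs" "set xs \<subseteq> ?T" by (auto simp: triangular_def)
  have height: "prime_height R ?P' = enat (length xs)"
    by (rule prime_height_eq[OF xs_T]) (use Q chain free in blast)+
  have P'P: "?P' \<subseteq> P"
  proof
    fix q assume q: "q \<in> ?P'"
    then have "toT q \<in> ?P" using QP by auto
    then show "q \<in> P" using toV_toT[of q] q by simp
  qed
  have Qprime: "prime_set ?Qc" using Q by blast
  have P'prime: "primeideal ?P' R" by (rule vimage_toT_prime[OF Qprime])
  have "toV ` G \<subseteq> ?P'"
  proof (intro image_subsetI)
    fix \<mu> assume "\<mu> \<in> G"
    with gen obtain s where s: "s \<notin> ?P" "s * \<mu> \<in> ring_module.span (?g ` set xs)" by (auto simp: saturation_def)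
    have "?g ` set xs \<subseteq> {q. toV q \<in> ?P'}"
    proof (intro image_subsetI CollectI conjI toV_polys)
      fix t assume t: "t \<in> set xs"
      have "den t \<in> polys ?T" "num t \<in> polys ?T"
        using solvedA_polys[of t] solvedC_polys[of t] t xs polys_mono[of _ ?T] by blast+
      then have "?g t \<in> polys ?T" using t xs_T by (intro polys_diff polys_mult polys_var) auto
      then show "toT (toV (?g t)) \<in> ?Qc" using gQ t by (simp only: toT_toV)
    qed
    then have "ring_module.span (?g ` set xs) \<subseteq> {q. toV q \<in> ?P'}"
      by (rule ring_module.span_minimal[OF _ vimage_toV_subspace[OF prime_ops(1)[OF P'prime]]])
    then have "toV s * toV \<mu> \<in> ?P'" using s(2) by (auto simp: toV.hom_mult)
    moreover have "toV s \<notin> ?P'" using s(1) P'P by blast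
    ultimately show "toV \<mu> \<in> ?P'" using prime_ops(3)[OF P'prime toV_polys toV_polys] by blast
  qed
  then have IP': "Idl\<^bsub>R\<^esub> (toV ` G) \<subseteq> ?P'" by (rule Rc.genideal_minimal[OF prime_ops(1)[OF P'prime]])
  have "?P' \<in> points (scheme n d)"
  proof -
    from pt obtain \<mu>1 \<mu>2 where "\<mu>1 \<in> minors \<tau> (BA \<times> BF) BE (int n)" "\<mu>1 \<notin> P"
      "\<mu>2 \<in> minors \<tau> (BA \<times> BF) BA (int d)" "\<mu>2 \<notin> P"
      unfolding points_def scheme_def by auto
    then have "\<exists>\<mu>\<in>minors \<tau> (BA \<times> BF) BE (int n). \<mu> \<notin> ?P'" "\<exists>\<mu>\<in>minors \<tau> (BA \<times> BF) BA (int d). \<mu> \<notin> ?P'"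
      using P'P by (meson subsetD)+
    then have "?P' \<in> snd (scheme n d)"
      using P'prime unfolding scheme_def snd_conv by (intro CollectI conjI)
    then show ?thesis unfolding points_def using IP' ideal_G by simp
  qed
  then have generic: "prime_height R P = enat (length xs)" if "P \<in> generic_points (scheme n d)"
    using that P'P height unfolding generic_points_def by fastforce
  have "length xs = card solvedA + card solvedC"
    using xs xs_T solved_disjoint finite_T solved_coords
    by (metis card_Un_disjoint distinct_card finite_subset)
  then have "2 * length xs = 2 * ((d * card BF - d) * (card BA - d)) + (card BA - d) * (card BA - d + 1) * card BF +
      2 * ((card C - (n - d)) * (card BA * card BF - n))"
    using card_solvedA card_solvedC len_rs len_A len_C by simp
  moreover have "d \<le> card BA"
    using card_mono[OF fin(1) sub(1)] dist len len_A by (simp add: distinct_card)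
  moreover have "d \<le> d * card BF"
    using card_mono[OF _ sub(3)] dist len len_A fin by (simp add: card_cartesian_product distinct_card)
  moreover have "n \<le> card BA * card BF"
    using card_mono[OF _ rs_sub] len_rs distinct_card[OF dist(1)] fin by (simp add: card_cartesian_product)
  moreover have "n - d \<le> card C"
    using card_mono[OF fin(2) sub(2)] dist len len_C by (simp add: distinct_card)
  ultimately show ?thesis using smooth generic dn by blast
qed

end

section \<open>Coordinates on the space of symmetric maps\<close>

lemma vector_space_fun_scale:
  assumes "vector_space s" shows "vector_space (fun_scale s)"
proof -
  interpret vector_space s by (rule assms)
  show ?thesis
    by standard (auto simp: fun_scale_def fun_eq_iff scale_right_distrib scale_left_distrib)
qed

locale symmetric_maps =
  E: finite_dimensional_vector_space sE BE + F: finite_dimensional_vector_space sF BF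
  for sE :: "'k::field \<Rightarrow> 'e::ab_group_add \<Rightarrow> 'e" and BE and sF :: "'k \<Rightarrow> 'f::ab_group_add \<Rightarrow> 'f" and BF +
  fixes A BA :: "'e set" and BH :: "('e \<Rightarrow> 'e \<Rightarrow> 'f) set"
  assumes A: "E.subspace A" and BA: "is_basis sE A BA"
    and BH: "is_basis (fun_scale (fun_scale sF)) (sym_maps sE sF A) BH"
begin

abbreviation "scale \<equiv> fun_scale (fun_scale sF)"
abbreviation "Sym \<equiv> sym_maps sE sF A"

sublocale H: vector_space "scale"
  by (intro vector_space_fun_scale F.vector_space_axioms)

definition W :: "'e set" where "W = E.extend_basis BA"
definition C :: "'e set" where "C = W - BA"

text \<open>The coordinate of \<open>v\<close> at the basis vector \<open>w\<close>.\<close>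
definition xi :: "'e \<Rightarrow> 'e \<Rightarrow> 'k" where "xi w v = E.representation W v w"

lemma BA_facts: "BA \<subseteq> A" "E.independent BA" "E.span BA = A"
  using BA by (auto simp: is_basis_def)

lemma W_facts: "BA \<subseteq> W" "E.independent W" "E.span W = UNIV" "finite W" "W = BA \<union> C" "BA \<inter> C = {}" "finite BA"
proof -
  show *: "BA \<subseteq> W" "E.independent W" "E.span W = UNIV"
    unfolding W_def using E.extend_basis_superset E.independent_extend_basis E.span_extend_basis BA_facts by auto
  show "finite W" using * E.finiteI_independent by blast
  then show "finite BA" using * finite_subset by blast
qed (use E.extend_basis_superset[OF BA_facts(2)] in \<open>auto simp: C_def W_def\<close>)

lemma card_facts:
  "card BA = E.dim A" "card BA + card C = E.dim UNIV" "card BF = F.dim UNIV" "card BE = E.dim UNIV"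
proof -
  show "card BA = E.dim A" using E.dim_eq_card[of BA A] BA_facts E.span_span[of BA] by metis
  have "card W = E.dim UNIV" using E.dim_eq_card[of W UNIV] W_facts by simp
  then show "card BA + card C = E.dim UNIV"
    using W_facts by (metis card_Un_disjoint finite_Un)
  show "card BF = F.dim UNIV" using F.dim_eq_card[of BF UNIV] F.independent_Basis F.span_Basis by simp
  show "card BE = E.dim UNIV" using E.dim_eq_card[of BE UNIV] E.independent_Basis E.span_Basis by simp
qed

lemma xi_add: "xi w (v + v') = xi w v + xi w v'"
  unfolding xi_def using E.representation_add[OF W_facts(2)] W_facts(3) by simp

lemma xi_scale: "xi w (sE c v) = c * xi w v"
  unfolding xi_def using E.representation_scale[OF W_facts(2)] W_facts(3) by simp

lemma xi_sum: "xi w (\<Sum>i\<in>I. f i) = (\<Sum>i\<in>I. xi w (f i))"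
  unfolding xi_def by (subst E.representation_sum[OF W_facts(2)]) (simp_all add: W_facts(3))

lemma xi_basis: "w' \<in> W \<Longrightarrow> xi w w' = (if w = w' then 1 else 0)"
  unfolding xi_def using E.representation_basis[OF W_facts(2)] by simp

lemma xi_expand: "(\<Sum>w\<in>W. sE (xi w v) w) = v"
  unfolding xi_def using E.sum_representation_eq[OF W_facts(2) _ W_facts(4)] W_facts(3) by simp

lemma xi_A: "v \<in> A \<Longrightarrow> c \<in> C \<Longrightarrow> xi c v = 0"
  unfolding xi_def
  using E.representation_extend[OF W_facts(2) _ W_facts(1), of v] BA_facts(3)
    E.representation_ne_zero[of BA v c] W_facts(6) by force

lemma xi_expand_A: "v \<in> A \<Longrightarrow> (\<Sum>x\<in>BA. sE (xi x v) x) = v"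
proof -
  assume v: "v \<in> A"
  have "(\<Sum>x\<in>BA. sE (xi x v) x) = (\<Sum>x\<in>W. sE (xi x v) x)"
    using W_facts xi_A[OF v] by (intro sum.mono_neutral_left) auto
  then show ?thesis using xi_expand by simp
qed

abbreviation eta :: "'f \<Rightarrow> 'f \<Rightarrow> 'k" where "eta z y \<equiv> F.representation BF z y"

lemma eta_scale: "eta (sF c z) y = c * eta z y"
  using F.representation_scale[OF F.independent_Basis] F.span_Basis by simp

lemma eta_sum: "eta (\<Sum>i\<in>I. f i) y = (\<Sum>i\<in>I. eta (f i) y)"
  by (subst F.representation_sum[OF F.independent_Basis]) (simp_all add: F.span_Basis)

lemma eta_inj:
  assumes "\<And>y. y \<in> BF \<Longrightarrow> eta z y = eta z' y" shows "z = z'"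
proof -
  have "(\<Sum>y\<in>BF. sF (eta z y) y) = z" for z
    using F.sum_representation_eq[OF F.independent_Basis _ F.finite_Basis] F.span_Basis by simp
  then show ?thesis using assms by (metis (mono_tags, lifting) sum.cong)
qed

lemma fun_scale2: "scale c h v w = sF c (h v w)"
  by (simp add: fun_scale_def)

lemma sym_mapsD:
  assumes "h \<in> Sym"
  shows "h (v + v') w = h v w + h v' w" "h (sE c v) w = sF c (h v w)"
    "w \<in> A \<Longrightarrow> w' \<in> A \<Longrightarrow> h v (w + w') = h v w + h v w'" "w \<in> A \<Longrightarrow> h v (sE c w) = sF c (h v w)"
    "w \<notin> A \<Longrightarrow> h v w = 0" "v \<in> A \<Longrightarrow> w \<in> A \<Longrightarrow> h v w = h w v"
proof -
  have lin: "Vector_Spaces.linear sE (fun_scale sF) h" and hf: "h v \<in> hom_from sE sF A" for v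
    using assms by (auto simp: sym_maps_def)
  interpret L: Vector_Spaces.linear sE "fun_scale sF" h by (rule lin)
  show "h (v + v') w = h v w + h v' w" "h (sE c v) w = sF c (h v w)"
    using L.add[of v v'] L.scale[of c v] by (auto simp: fun_scale_def)
  show "w \<in> A \<Longrightarrow> w' \<in> A \<Longrightarrow> h v (w + w') = h v w + h v w'" "w \<in> A \<Longrightarrow> h v (sE c w) = sF c (h v w)"
    "w \<notin> A \<Longrightarrow> h v w = 0"
    using hf[of v] by (auto simp: hom_from_def)
  show "v \<in> A \<Longrightarrow> w \<in> A \<Longrightarrow> h v w = h w v" using assms by (auto simp: sym_maps_def)
qed

lemma sym_mapsI:
  assumes "\<And>v v' w. h (v + v') w = h v w + h v' w" "\<And>c v w. h (sE c v) w = sF c (h v w)"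
    "\<And>v w w'. w \<in> A \<Longrightarrow> w' \<in> A \<Longrightarrow> h v (w + w') = h v w + h v w'"
    "\<And>c v w. w \<in> A \<Longrightarrow> h v (sE c w) = sF c (h v w)"
    "\<And>v w. w \<notin> A \<Longrightarrow> h v w = 0" "\<And>v w. v \<in> A \<Longrightarrow> w \<in> A \<Longrightarrow> h v w = h w v"
  shows "h \<in> Sym"
proof -
  have "Vector_Spaces.linear sE (fun_scale sF) h"
    unfolding Vector_Spaces.linear_iff
    using assms(1,2) E.vector_space_axioms vector_space_fun_scale[OF F.vector_space_axioms]
    by (auto simp: fun_scale_def fun_eq_iff)
  then show ?thesis
    unfolding sym_maps_def hom_from_def using assms by blast
qed

lemma sym_maps_subspace: "H.subspace (Sym)"
  using BH H.subspace_span by (metis is_basis_def)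

lemma sym_maps_sum_left:
  assumes "h \<in> Sym"
  shows "h v w = (\<Sum>u\<in>W. sF (xi u v) (h u w))"
proof -
  have 0: "h 0 w = 0" using sym_mapsD(2)[OF assms, of 0 0 w] by simp
  have "h (\<Sum>u\<in>I. sE (xi u v) u) w = (\<Sum>u\<in>I. sF (xi u v) (h u w))" for I
    by (induction I rule: infinite_finite_induct) (simp_all add: 0 sym_mapsD[OF assms])
  then show ?thesis using xi_expand[of v] by metis
qed

lemma sym_maps_sum_right:
  assumes h: "h \<in> Sym" and w: "w \<in> A"
  shows "h v w = (\<Sum>x\<in>BA. sF (xi x w) (h v x))"
proof -
  have 0: "h v 0 = 0" using sym_mapsD(4)[OF h E.subspace_0[OF A], of v 0] by simp
  have "h v (\<Sum>x\<in>I. sE (xi x w) x) = (\<Sum>x\<in>I. sF (xi x w) (h v x))" if "I \<subseteq> BA" for I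
    using that
  proof (induction I rule: infinite_finite_induct)
    case (insert x I)
    have "sE (xi x w) x \<in> A" "(\<Sum>x\<in>I. sE (xi x w) x) \<in> A"
      using insert BA_facts A by (auto intro!: E.subspace_sum E.subspace_scale)
    then show ?case using insert BA_facts by (auto simp: sym_mapsD[OF h])
  qed (auto simp: 0)
  then show ?thesis using xi_expand_A[OF w] by (metis order_refl)
qed

lemma sym_maps_eqI:
  assumes h: "h \<in> Sym" "h' \<in> Sym"
    and eq: "\<And>x u y. x \<in> BA \<Longrightarrow> u \<in> W \<Longrightarrow> y \<in> BF \<Longrightarrow> eta (h u x) y = eta (h' u x) y"
  shows "h = h'"
proof (intro ext)
  fix v w
  have b: "h u x = h' u x" if "x \<in> BA" "u \<in> W" for x u using eta_inj eq that by blast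
  show "h v w = h' v w"
  proof (cases "w \<in> A")
    case True
    have "h u w = h' u w" if "u \<in> W" for u
      unfolding sym_maps_sum_right[OF h(1) True, of u] sym_maps_sum_right[OF h(2) True, of u]
      using b that by simp
    then show ?thesis unfolding sym_maps_sum_left[OF h(1), of v w] sym_maps_sum_left[OF h(2), of v w] by simp
  next
    case False
    then show ?thesis by (simp add: sym_mapsD(5)[OF h(1)] sym_mapsD(5)[OF h(2)])
  qed
qed

abbreviation T :: "('e set \<times> 'f) set" where "T \<equiv> coords BA C BF"

text \<open>The bilinear form on \<open>E \<times> A\<close> that is 1 on basis vectors with pair \<open>s\<close> and 0 on all others.\<close>
definition elem_form :: "'e set \<Rightarrow> 'e \<Rightarrow> 'e \<Rightarrow> 'k" where
  "elem_form s v w = (\<Sum>x\<in>BA. \<Sum>u\<in>W. if {x, u} = s then xi x w * xi u v else 0)"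

definition elem_map :: "'e set \<times> 'f \<Rightarrow> 'e \<Rightarrow> 'e \<Rightarrow> 'f" where
  "elem_map t v w = (if w \<in> A then sF (elem_form (fst t) v w) (snd t) else 0)"

lemma elem_form_sym:
  assumes "v \<in> A" "w \<in> A" shows "elem_form s v w = elem_form s w v"
proof -
  have eq: "elem_form s v w = (\<Sum>x\<in>BA. \<Sum>u\<in>BA. if {x, u} = s then xi x w * xi u v else 0)"
    if "v \<in> A" for v w
    unfolding elem_form_def
    by (intro sum.cong refl sum.mono_neutral_right) (use W_facts xi_A[OF that] in auto)
  show ?thesis
    unfolding eq[OF assms(1)] eq[OF assms(2)]
    by (subst sum.swap) (simp add: insert_commute mult.commute cong: if_cong)
qed

lemma elem_map_in: "elem_map t \<in> Sym"
proof (rule sym_mapsI)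
  have add: "elem_form s (v + v') w = elem_form s v w + elem_form s v' w"
    and scale: "elem_form s (sE c v) w = c * elem_form s v w"
    and add': "elem_form s v (w + w') = elem_form s v w + elem_form s v w'"
    and scale': "elem_form s v (sE c w) = c * elem_form s v w" for s v v' w w' c
    unfolding elem_form_def sum.distrib[symmetric] sum_distrib_left
    by (intro sum.cong refl; simp add: xi_add xi_scale algebra_simps)+
  show "elem_map t (v + v') w = elem_map t v w + elem_map t v' w" for v v' w
    by (simp add: elem_map_def add F.scale_left_distrib)
  show "elem_map t (sE c v) w = sF c (elem_map t v w)" for c v w
    by (simp add: elem_map_def scale)
  show "elem_map t v (w + w') = elem_map t v w + elem_map t v w'" if "w \<in> A" "w' \<in> A" for v w w'
    using that A by (simp add: elem_map_def add' F.scale_left_distrib E.subspace_add)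
  show "elem_map t v (sE c w) = sF c (elem_map t v w)" if "w \<in> A" for c v w
    using that A by (simp add: elem_map_def scale' E.subspace_scale)
  show "elem_map t v w = 0" if "w \<notin> A" for v w using that by (simp add: elem_map_def)
  show "elem_map t v w = elem_map t w v" if "v \<in> A" "w \<in> A" for v w
    using that elem_form_sym by (simp add: elem_map_def)
qed

lemma elem_map_entry:
  assumes "x \<in> BA" "u \<in> W" "y \<in> BF" "snd t \<in> BF"
  shows "eta (elem_map t u x) y = (if ({x, u}, y) = t then 1 else 0)"
proof -
  have x: "x \<in> W" "x \<in> A" using assms W_facts BA_facts by auto
  have "elem_form s u x = (if {x, u} = s then 1 else 0)" for s
  proof -
    have "elem_form s u x = (\<Sum>x'\<in>BA. \<Sum>u'\<in>W. if u' = u then if x' = x then if {x, u} = s then 1 else 0 else 0 else 0)"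
      unfolding elem_form_def by (intro sum.cong refl) (auto simp: xi_basis x assms)
    then show ?thesis using assms W_facts by simp
  qed
  then have "elem_map t u x = sF (if {x, u} = fst t then 1 else 0) (snd t)"
    using x by (simp add: elem_map_def)
  then have "eta (elem_map t u x) y = (if {x, u} = fst t then 1 else 0) * eta (snd t) y"
    by (simp only: eta_scale)
  also have "eta (snd t) y = (if y = snd t then 1 else 0)"
    using F.representation_basis[OF F.independent_Basis assms(4)] by simp
  finally show ?thesis by (cases t) auto
qed

definition coef :: "'e set \<times> 'f \<Rightarrow> ('e \<Rightarrow> 'e \<Rightarrow> 'f) \<Rightarrow> 'k" where
  "coef t h = lift_pairs BA C (\<lambda>x u y. eta (h u x) y) t"

text \<open>The coordinates, with respect to \<open>BH\<close>, of the element of \<open>H\<close> dual to \<open>t\<close>.\<close>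
definition inv_coef :: "'e set \<times> 'f \<Rightarrow> ('e \<Rightarrow> 'e \<Rightarrow> 'f) \<Rightarrow> 'k" where
  "inv_coef t b = H.representation BH (elem_map t) b"

lemma coef_eq:
  assumes "h \<in> Sym" "x \<in> BA" "u \<in> W" "y \<in> BF"
  shows "coef ({x, u}, y) h = eta (h u x) y"
  unfolding coef_def
proof (rule lift_pairs_eq)
  show "u \<in> BA \<union> C" using assms W_facts by blast
  show "eta (h u x) y = eta (h x u) y" if "x \<in> BA" "u \<in> BA"
    using sym_mapsD(6)[OF assms(1), of u x] subsetD[OF BA_facts(1)] that by simp
qed (rule assms)

lemma T_cases:
  assumes "t \<in> T" obtains x u y where "t = ({x, u}, y)" "x \<in> BA" "u \<in> W" "y \<in> BF"
  using assms W_facts unfolding coords_def by blast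

lemma T_snd: "t \<in> T \<Longrightarrow> snd t \<in> BF"
  unfolding coords_def by auto

lemma T_mem: "x \<in> BA \<Longrightarrow> u \<in> W \<Longrightarrow> y \<in> BF \<Longrightarrow> ({x, u}, y) \<in> T"
  using W_facts unfolding coords_def by blast

lemma finite_T: "finite T"
  by (rule finite_coords) (use W_facts F.finite_Basis in auto)

lemma eta_sum_maps:
  "eta ((\<Sum>i\<in>I. scale (c i) (h i)) u x) y = (\<Sum>i\<in>I. c i * eta (h i u x) y)"
proof -
  have "(\<Sum>i\<in>I. scale (c i) (h i)) u x = (\<Sum>i\<in>I. sF (c i) (h i u x))"
    by (induction I rule: infinite_finite_induct) (auto simp: fun_scale2)
  then show ?thesis by (simp add: eta_sum eta_scale)
qed

lemma expand_in_elem_maps: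
  assumes h: "h \<in> Sym"
  shows "h = (\<Sum>t\<in>T. scale (coef t h) (elem_map t))" (is "_ = ?s")
proof (rule sym_maps_eqI[OF h])
  show "?s \<in> Sym"
    using sym_maps_subspace elem_map_in by (intro H.subspace_sum H.subspace_scale)
  fix x u y assume xuy: "x \<in> BA" "u \<in> W" "y \<in> BF"
  have "eta (?s u x) y = (\<Sum>t\<in>T. coef t h * eta (elem_map t u x) y)" by (rule eta_sum_maps)
  also have "\<dots> = (\<Sum>t\<in>T. if ({x, u}, y) = t then coef t h else 0)"
    by (intro sum.cong refl) (simp add: elem_map_entry[OF xuy T_snd])
  also have "\<dots> = coef ({x, u}, y) h" using finite_T T_mem xuy by simp
  finally show "eta (h u x) y = eta (?s u x) y" using coef_eq[OF h xuy] by simp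
qed

lemma BH_facts: "BH \<subseteq> Sym" "H.independent BH" "H.span BH = Sym" "finite BH"
proof -
  show *: "BH \<subseteq> Sym" "H.independent BH" "H.span BH = Sym"
    using BH by (auto simp: is_basis_def)
  have "Sym \<subseteq> H.span (elem_map ` T)"
  proof
    fix h assume "h \<in> Sym"
    from expand_in_elem_maps[OF this] show "h \<in> H.span (elem_map ` T)"
      by (metis (no_types, lifting) H.span_base H.span_scale H.span_sum imageI)
  qed
  then show "finite BH"
    using H.independent_span_bound[of "elem_map ` T" BH] finite_T * by blast
qed

lemma inv1:
  assumes "t \<in> T" "t' \<in> T"
  shows "(\<Sum>b\<in>BH. inv_coef t b * coef t' b) = (if t = t' then 1 else 0)"
proof -
  obtain x u y where t': "t' = ({x, u}, y)" "x \<in> BA" "u \<in> W" "y \<in> BF" using assms(2) by (rule T_cases)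
  have "(\<Sum>b\<in>BH. scale (inv_coef t b) b) = elem_map t"
    unfolding inv_coef_def
    by (rule H.sum_representation_eq[OF BH_facts(2) _ BH_facts(4)]) (use elem_map_in BH_facts in auto)
  then have "eta (elem_map t u x) y = (\<Sum>b\<in>BH. inv_coef t b * eta (b u x) y)"
    using eta_sum_maps[of "inv_coef t" "\<lambda>b. b" BH u x y] by simp
  also have "\<dots> = (\<Sum>b\<in>BH. inv_coef t b * coef t' b)"
    by (intro sum.cong refl) (use t' BH_facts coef_eq in auto)
  finally show ?thesis
    using elem_map_entry[OF t'(2-4) T_snd[OF assms(1)]] t'(1) by auto
qed

lemma inv2:
  assumes "b \<in> BH" "b' \<in> BH"
  shows "(\<Sum>t\<in>T. inv_coef t b * coef t b') = (if b = b' then 1 else 0)"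
proof -
  have b': "b' \<in> Sym" using assms BH_facts by blast
  have "H.representation BH b' b = H.representation BH (\<Sum>t\<in>T. scale (coef t b') (elem_map t)) b"
    using expand_in_elem_maps[OF b'] by simp
  also have "\<dots> = (\<Sum>t\<in>T. coef t b' * inv_coef t b)"
    unfolding inv_coef_def
    using elem_map_in BH_facts sym_maps_subspace
    by (subst H.representation_sum[OF BH_facts(2)])
      (auto simp: H.representation_scale[OF BH_facts(2)] H.subspace_scale)
  finally show ?thesis
    using H.representation_basis[OF BH_facts(2) assms(2)] by (simp add: mult.commute)
qed

lemma taut_eq: "taut sF BF BH (x, y) u = (\<Sum>b\<in>BH. mconst (eta (b u x) y) * mvar b)"
  unfolding taut_def by (simp add: mconst_def mvar_def mult_single)

sublocale lc: linear_coordinates BH T coef inv_coef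
  by (unfold_locales) (use BH_facts finite_T inv1 inv2 in auto)

lemma toV_entry:
  assumes "x \<in> BA" "u \<in> W" "y \<in> BF"
  shows "lc.toV (entry (x, y) u) = taut sF BF BH (x, y) u"
  unfolding taut_eq entry_def using assms BH_facts coef_eq
  by (auto simp: lc.toV_var[OF T_mem[OF assms]] intro!: sum.cong)

definition col :: "'e \<times> 'f \<Rightarrow> 'e \<Rightarrow> ('e set \<times> 'f, 'k) mpol" where
  "col r u = (\<Sum>w\<in>W. mconst (xi w u) * entry r w)"

lemma toV_col:
  assumes "x \<in> BA" "y \<in> BF"
  shows "lc.toV (col (x, y) u) = taut sF BF BH (x, y) u"
proof -
  have "lc.toV (col (x, y) u) = (\<Sum>w\<in>W. mconst (xi w u) * taut sF BF BH (x, y) w)"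
    unfolding col_def lc.toV.hom_sum lc.toV.hom_mult lc.toV_const
    by (intro sum.cong refl) (simp only: toV_entry[OF assms(1) _ assms(2)])
  also have "\<dots> = (\<Sum>w\<in>W. \<Sum>b\<in>BH. mconst (xi w u * eta (b w x) y) * mvar b)"
    unfolding taut_eq sum_distrib_left by (simp add: mconst_mult mult.assoc)
  also have "\<dots> = (\<Sum>b\<in>BH. mconst (\<Sum>w\<in>W. xi w u * eta (b w x) y) * mvar b)"
    by (subst sum.swap) (simp add: mconst_sum sum_distrib_right)
  also have "\<dots> = (\<Sum>b\<in>BH. mconst (eta (b u x) y) * mvar b)"
  proof (intro sum.cong refl)
    fix b assume "b \<in> BH"
    then have "b u x = (\<Sum>w\<in>W. sF (xi w u) (b w x))" using sym_maps_sum_left BH_facts by blast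
    then have "eta (b u x) y = (\<Sum>w\<in>W. xi w u * eta (b w x) y)" by (simp only: eta_sum eta_scale)
    then show "mconst (\<Sum>w\<in>W. xi w u * eta (b w x) y) * mvar b = mconst (eta (b u x) y) * mvar b" by simp
  qed
  finally show ?thesis unfolding taut_eq .
qed

lemma entry_col:
  assumes w: "w \<in> W"
  shows "entry r w = (\<Sum>u\<in>BE. mconst (E.representation BE w u) * col r u)"
proof -
  have "w = (\<Sum>u\<in>BE. sE (E.representation BE w u) u)"
    using E.sum_representation_eq[OF E.independent_Basis _ E.finite_Basis] E.span_Basis by simp
  then have "xi w' w = (\<Sum>u\<in>BE. E.representation BE w u * xi w' u)" for w'
    using xi_sum[of w' "\<lambda>u. sE (E.representation BE w u) u" BE] by (simp add: xi_scale)
  then have rep: "(\<Sum>u\<in>BE. E.representation BE w u * xi w' u) = (if w = w' then 1 else 0)" for w'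
    using xi_basis[OF w, of w'] by auto
  have "(\<Sum>u\<in>BE. mconst (E.representation BE w u) * col r u) =
    (\<Sum>w'\<in>W. mconst (\<Sum>u\<in>BE. E.representation BE w u * xi w' u) * entry r w')"
    unfolding col_def sum_distrib_left
    by (subst sum.swap) (simp add: mconst_sum mconst_mult sum_distrib_right mult.assoc)
  also have "\<dots> = (\<Sum>w'\<in>W. (if w = w' then 1 else 0) * entry r w')"
    unfolding rep by (intro sum.cong refl) simp
  also have "\<dots> = entry r w" using W_facts(4) w by (rule sum_delta_mult)
  finally show ?thesis by simp
qed

sublocale det: determinantal BH BA C BF coef inv_coef BE col xi "\<lambda>u w. E.representation BE w u" "taut sF BF BH"
proof unfold_locales
  show "finite C" using W_facts by simp
  show "finite BA" "BA \<inter> C = {}" using W_facts by auto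
  show "finite BF" "finite BE" using F.finite_Basis E.finite_Basis by auto
  show "col r u = (\<Sum>w\<in>BA \<union> C. mconst (xi w u) * entry r w)" for r u
    unfolding col_def using W_facts(5) by simp
  show "entry r w = (\<Sum>u\<in>BE. mconst (E.representation BE w u) * col r u)" if "w \<in> BA \<union> C" for r w
    using entry_col that W_facts(5) by simp
  show "taut sF BF BH r u = lc.toV (col r u)" if "r \<in> BA \<times> BF" for r u
    using that toV_col by auto
  show "taut sF BF BH r u = lc.toV (entry r u)" if "r \<in> BA \<times> BF" "u \<in> BA" for r u
    using that toV_entry W_facts by auto
qed

end

section \<open>Smoothness and codimension\<close>

text \<open>The number of solved coordinates, counted twice to avoid the division in the number of unordered pairs.\<close>
lemma codimension_formula:
  fixes c d n a f q p :: nat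
  assumes "d \<le> a" "d \<le> d * f" "n \<le> a * f" "d \<le> n" "n - d \<le> q" and p: "int a - int p = int d"
    and c: "2 * c = 2 * ((d * f - d) * (a - d)) + (a - d) * (a - d + 1) * f + 2 * ((q - (n - d)) * (a * f - n))"
  shows "rat_of_nat c =
    rat_of_nat p * (rat_of_nat n - rat_of_nat a + rat_of_nat p)
      + rat_of_nat f * (1 / 2 * (- (rat_of_nat p ^ 2) + rat_of_nat p)
          + (rat_of_nat (a + q) - rat_of_nat n) * rat_of_nat a)
      - rat_of_nat n * (rat_of_nat (a + q) - rat_of_nat n)"
proof -
  define A D F N Q where "A = rat_of_nat a" "D = rat_of_nat d" "F = rat_of_nat f" "N = rat_of_nat n" "Q = rat_of_nat q"
  have p': "p = a - d" using p assms(1) by linarith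
  have P: "rat_of_nat p = A - D" using p' assms(1) by (simp add: of_nat_diff A_D_F_N_Q_def)
  have "rat_of_nat (2 * c) = 2 * ((D * F - D) * (A - D)) + (A - D) * (A - D + 1) * F +
      2 * ((Q - (N - D)) * (A * F - N))"
    unfolding c A_D_F_N_Q_def
    by (simp only: of_nat_add of_nat_mult of_nat_numeral of_nat_1 of_nat_diff[OF assms(1)]
      of_nat_diff[OF assms(2)] of_nat_diff[OF assms(3)] of_nat_diff[OF assms(4)] of_nat_diff[OF assms(5)])
  then have 2: "2 * rat_of_nat c = 2 * ((D * F - D) * (A - D)) + (A - D) * (A - D + 1) * F +
      2 * ((Q - (N - D)) * (A * F - N))" by simp
  have "2 * rat_of_nat c = 2 * ((A - D) * (N - A + (A - D)) + F * (1 / 2 * (- ((A - D) ^ 2) + (A - D))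
      + (A + Q - N) * A) - N * (A + Q - N))"
    unfolding 2 by (simp add: field_simps power2_eq_square)
  then show ?thesis unfolding P by (simp add: A_D_F_N_Q_def)
qed

text \<open>A nonempty scheme therefore has \<open>n \<ge> 0\<close> and \<open>p \<le> a\<close>.\<close>
lemma minors_nonempty_size: "\<mu> \<in> minors M Rs Cs r \<Longrightarrow> \<exists>m. r = int m"
  by (auto simp: minors_def)

context symmetric_maps
begin

lemma determinantal_smooth_codimension:
  assumes e: "e = E.dim UNIV" and f: "f = F.dim UNIV" and a: "a = E.dim A"
    and n: "n = int (min e (a * f)) - int i"
    and nonempty: "points (Delta sE sF A BE BA BF BH i p) \<noteq> {}"
  shows "smooth_scheme BH (Delta sE sF A BE BA BF BH i p) \<and>
    (\<exists>c. pure_codimension (mpol_ring BH) (Delta sE sF A BE BA BF BH i p) c \<and>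
      rat_of_nat c =
        rat_of_nat p * (rat_of_int n - rat_of_nat a + rat_of_nat p)
        + rat_of_nat f * (1 / 2 * (- (rat_of_nat p ^ 2) + rat_of_nat p)
            + (rat_of_nat e - rat_of_int n) * rat_of_nat a)
        - rat_of_int n * (rat_of_nat e - rat_of_int n))"
proof -
  let ?\<Delta> = "Delta sE sF A BE BA BF BH i p"
  let ?t = "taut sF BF BH"
  have card: "card BA = a" "card BF = f" "a + card C = e"
    unfolding e f a using card_facts(1,3) card_facts(2)[unfolded card_facts(1)] by blast+
  have \<Delta>: "?\<Delta> = (Idl\<^bsub>mpol_ring BH\<^esub> (minors ?t (BA \<times> BF) BE (n + 1) \<union> minors ?t (BA \<times> BF) BA (int a - int p + 1)),
       {P. primeideal P (mpol_ring BH) \<and> (\<exists>g \<in> minors ?t (BA \<times> BF) BE n. g \<notin> P) \<and>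
         (\<exists>g \<in> minors ?t (BA \<times> BF) BA (int a - int p). g \<notin> P)})"
    unfolding Delta_def Let_def e f a n ..
  obtain P0 where P0: "P0 \<in> points ?\<Delta>" using nonempty by blast
  then obtain \<mu> \<nu> where "\<mu> \<in> minors ?t (BA \<times> BF) BE n" "\<nu> \<in> minors ?t (BA \<times> BF) BA (int a - int p)"
    unfolding points_def \<Delta> by auto
  then obtain n' d where n': "n = int n'" and d: "int a - int p = int d"
    using minors_nonempty_size by metis
  have X: "?\<Delta> = det.scheme n' d"
    unfolding \<Delta> det.scheme_def n' d by (simp add: add.commute)
  note local = det.local_structure[of _ n' d, folded X, unfolded card]
  from local[OF P0] obtain c where c: "d \<le> a" "d \<le> d * f" "n' \<le> a * f" "d \<le> n'" "n' - d \<le> card C"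
    "2 * c = 2 * ((d * f - d) * (a - d)) + (a - d) * (a - d + 1) * f + 2 * ((card C - (n' - d)) * (a * f - n'))"
    by blast
  have "pure_codimension (mpol_ring BH) ?\<Delta> c"
    unfolding pure_codimension_def
  proof
    fix P assume P: "P \<in> generic_points ?\<Delta>"
    then have "P \<in> points ?\<Delta>" by (simp add: generic_points_def)
    from local[OF this] P obtain c' where "prime_height (mpol_ring BH) P = enat c'" "2 * c' = 2 * c"
      unfolding c(6) by blast
    then show "prime_height (mpol_ring BH) P = enat c" by simp
  qed
  moreover have "smooth_scheme BH ?\<Delta>"
    unfolding smooth_scheme_def using local by blast
  ultimately show ?thesis
    using codimension_formula[OF c(1-5) d c(6)] unfolding card(3) n' by (intro conjI exI[of _ c]) simp_all
qed

end

theorem theorem1p4: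
  fixes sE :: "'k::field \<Rightarrow> 'e::ab_group_add \<Rightarrow> 'e"
    and sF :: "'k \<Rightarrow> 'f::ab_group_add \<Rightarrow> 'f"
    and A BE BA :: "'e set" and BF :: "'f set"
    and BH :: "('e \<Rightarrow> 'e \<Rightarrow> 'f) set"
    and e f a i p :: nat and n :: int
  assumes "finite_dimensional_vector_space sE BE"
    and "finite_dimensional_vector_space sF BF"
    and "module.subspace sE A"
    and "is_basis sE A BA"
    and "is_basis (fun_scale (fun_scale sF)) (sym_maps sE sF A) BH"
    and "e = vector_space.dim sE UNIV"
    and "f = vector_space.dim sF UNIV"
    and "a = vector_space.dim sE A"
    and "n = int (min e (a * f)) - int i"
    and "points (Delta sE sF A BE BA BF BH i p) \<noteq> {}"
  shows "smooth_scheme BH (Delta sE sF A BE BA BF BH i p) \<and>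
    (\<exists>c. pure_codimension (mpol_ring BH) (Delta sE sF A BE BA BF BH i p) c \<and>
      rat_of_nat c =
        rat_of_nat p * (rat_of_int n - rat_of_nat a + rat_of_nat p)
        + rat_of_nat f * (1 / 2 * (- (rat_of_nat p ^ 2) + rat_of_nat p)
            + (rat_of_nat e - rat_of_int n) * rat_of_nat a)
        - rat_of_int n * (rat_of_nat e - rat_of_int n))"
proof -
  have "symmetric_maps sE BE sF BF A BA BH"
    by (rule symmetric_maps.intro[OF assms(1,2) symmetric_maps_axioms.intro[OF assms(3-5)]])
  from symmetric_maps.determinantal_smooth_codimension[OF this assms(6-10)] show ?thesis .
qed

end
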